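(* Let $\overline M$ be a $7$-dimensional Riemannian manifold with a $G_2$-structure of type $\mathcal X_4$. Let $\iota:M\to\overline M$ be an orientable hypersurface with unit normal vector field $n$, with the induced $SU(3)$-structure determined by $n$ and the constant function $\theta=0$ (resp. $\theta=\pi/2$). Put $\varepsilon=+$ if $\theta=0$ and $\varepsilon=-$ if $\theta=\pi/2$. Then $3Id^*\omega=\iota^*pd^*\varphi=36\,\eta$ and $M$ is of type $\mathcal W_1^{\varepsilon}+\mathcal W_2^{\varepsilon}+\mathcal W_3+\mathcal W_4+\mathcal W_5$. Moreover, the $SU(3)$-structure on $M$ is of the type given on the left if and only if the condition on the right holds: 1. $\mathcal W_1^{\varepsilon}+\mathcal W_2^{\varepsilon}+\mathcal W_3$: $p_\varphi$ is normal to $M$. 2. $\mathcal W_1^{\varepsilon}+\mathcal W_2^{\varepsilon}+\mathcal W_4+\mathcal W_5$: $IB=B$. 3. $\mathcal W_1^{\varepsilon}+\mathcal W_3+\mathcal W_4+\mathcal W_5$: $(1+I)B=2h\langle\cdot,\cdot\rangle$. 4. $\mathcal W_2^{\varepsilon}+\mathcal W_3+\mathcal W_4+\mathcal W_5$: $pd^*\varphi(n)=12h$. 5. $\mathcal W_1^{\varepsilon}+\mathcal W_4+\mathcal W_5$: $M$ is totally umbilic.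
   Context: $G_2$-structures: a $G_2$-structure on a Riemannian $7$-manifold $(\overline M,\langle\cdot,\cdot\rangle)$ is given by a global three-form $\varphi$ such that locally there is an orthonormal frame $\{e_0,\dots,e_6\}$ (indices in $\mathbb Z_7$) with $\varphi=\sum_ie_i\wedge e_{i+1}\wedge e_{i+3}$ (vectors are identified with one-forms via the metric). $\langle P(x,y),z\rangle=\varphi(x,y,z)$, and $*\varphi=-\sum_{i}e_{i+2}\wedge e_{i+4}\wedge e_{i+5}\wedge e_{i+6}$ (Hodge dual for the orientation $e_0\wedge\dots\wedge e_6$). $\overline\nabla$ is the Levi-Civita connection and $\overline r(\varphi)(x,y)=\frac14\langle\overline\nabla_x\varphi,y\lrcorner*\varphi\rangle$, where $\langle a,b\rangle=\frac1{p!}\sum a(e_{i_1},\dots)b(e_{i_1},\dots)$ for $p$-forms. The one-form $pd^*\varphi$ and the vector field $p_\varphi$ are given by $pd^*\varphi=*( *d\varphi\wedge\varphi)=\langle p_\varphi,\cdot\rangle$. Type $\mathcal X_4$ (locally conformal parallel): $\overline r(\varphi)=-\frac1{12}\,p_\varphi\lrcorner\varphi$. Induced structure on $M$: the induced metric, $Ix=P(n,x)$, and $\Psi=\psi_++i\psi_-$ with $\psi_+=\cos\theta\,\iota^*\varphi-\sin\theta\,\iota^*(n\lrcorner*\varphi)$, $\psi_-=\sin\theta\,\iota^*\varphi+\cos\theta\,\iota^*(n\lrcorner*\varphi)$. $B(x,y)=\langle II(x,y),n\rangle=\langle\overline\nabla_xy,n\rangle$ is the second fundamental form, $h=\frac16\mathrm{Tr}\,B$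 (so $h=\langle H,n\rangle$, $H$ the mean curvature); totally umbilic means $B=h\langle\cdot,\cdot\rangle$. For a bilinear form $b$ on $M$, $(Ib)(x,y)=b(Ix,Iy)$; for a one-form $\mu$, $(I\mu)(x)=-\mu(Ix)$. "$p_\varphi$ is normal to $M$" means that its tangential part vanishes along $M$. Types of $SU(3)$-structure: $\nabla$ is the Levi-Civita connection of $M$, $\omega(x,y)=\langle x,Iy\rangle$, $d^*\omega=-\sum_ie_i\lrcorner\nabla_{e_i}\omega$. $\nabla\omega$ lies in $\{\alpha\mid\alpha(x,y,z)=-\alpha(x,z,y)=-\alpha(x,Iy,Iz)\}=\mathcal W_1\oplus\mathcal W_2\oplus\mathcal W_3\oplus\mathcal W_4$ (Gray–Hervella), where $\mathcal W_1$: $\alpha$ totally skew; $\mathcal W_2$: cyclic sum of $\alpha(x,y,z)$ is zero; $\mathcal W_3$: $\alpha(Ix,Iy,z)=\alpha(x,y,z)$ and $\sum_i\alpha(e_i,e_i,z)=0$; $\mathcal W_4$: $\alpha(x,y,z)=\langle x,y\rangle\tau(z)-\langle x,z\rangle\tau(y)-\langle x,Iy\rangle\tau(Iz)+\langle x,Iz\rangle\tau(Iy)$ for some one-form $\tau$. With $r(\alpha)(x,y)=\frac12\langle x\lrcorner\alpha,y\lrcorner\psi_+\rangle$, for $i=1,2$ one has $\mathcal W_i=\mathcal W_i^+\oplus\mathcal W_i^-$, where $\mathcal W_i^+$ (resp. $\mathcal W_i^-$) is the set of $\alpha\in\mathcal W_i$ with $r(\alpha)$ symmetric (resp. skew-symmetric).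 The $\mathcal W_5$-part of the torsion is the one-form $\eta$ determined by requiring that the metric connection $\nabla+\eta+\xi$, with $\eta_XY=(I\eta)(X)IY$ and $\xi_XY=-\frac12I(\nabla_XI)Y$, makes $\omega,\psi_+,\psi_-$ parallel; equivalently $(I\eta)(X)=-\frac1{12}\langle\nabla_X\psi_+,\psi_-\rangle$. $M$ is of type $\mathcal U$, a sum of some of $\mathcal W_1^\pm,\mathcal W_2^\pm,\mathcal W_3,\mathcal W_4,\mathcal W_5$, if the components of $\nabla\omega$ in the $\mathcal W$'s not occurring in $\mathcal U$ vanish everywhere and, when $\mathcal W_5$ does not occur, $\eta=0$. *)

theory Defs
  imports "HOL-Analysis.Analysis"
begin

section \<open>Smooth manifolds given by an atlas\<close>

text \<open>The iterated directional derivatives characterise \<open>C\<^sup>k\<close>-maps on open sets only; all sets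
  \<open>S\<close> to which this is applied below are open.\<close>

fun Ck_on :: "nat \<Rightarrow> 'v::euclidean_space set \<Rightarrow> ('v \<Rightarrow> 'w::real_normed_vector) \<Rightarrow> bool" where
  "Ck_on 0 S f = continuous_on S f"
| "Ck_on (Suc k) S f =
    (f differentiable_on S \<and> (\<forall>v. Ck_on k S (\<lambda>x. frechet_derivative f (at x) v)))"

definition smooth_on :: "'v::euclidean_space set \<Rightarrow> ('v \<Rightarrow> 'w::real_normed_vector) \<Rightarrow> bool" where
  "smooth_on S f \<longleftrightarrow> (\<forall>k. Ck_on k S f)"

type_synonym ('a, 'n) chart = "'a set \<times> ('a \<Rightarrow> real ^ 'n)"

definition cimg :: "('a, 'n::finite) chart \<Rightarrow> (real ^ 'n) set" where
  "cimg c = snd c ` fst c"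

definition cinv :: "('a, 'n::finite) chart \<Rightarrow> real ^ 'n \<Rightarrow> 'a" where
  "cinv c = inv_into (fst c) (snd c)"

record ('a, 'n::finite) manifold =
  topo :: "'a topology"
  charts :: "('a, 'n) chart set"

definition smooth_manifold :: "('a, 'n::finite, 'z) manifold_scheme \<Rightarrow> bool" where
  "smooth_manifold M \<longleftrightarrow>
     Hausdorff_space (topo M) \<and> second_countable (topo M) \<and>
     \<Union> (fst ` charts M) = topspace (topo M) \<and>
     (\<forall>c\<in>charts M. openin (topo M) (fst c) \<and> open (cimg c) \<and>
        homeomorphic_map (subtopology (topo M) (fst c)) (top_of_set (cimg c)) (snd c)) \<and>
     (\<forall>c\<in>charts M. \<forall>c'\<in>charts M.
        smooth_on (snd c ` (fst c \<inter> fst c')) (snd c' \<circ> cinv c))"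

definition chart_at :: "('a, 'n::finite, 'z) manifold_scheme \<Rightarrow> 'a \<Rightarrow> ('a, 'n) chart" where
  "chart_at M p = (SOME c. c \<in> charts M \<and> p \<in> fst c)"

text \<open>A tangent vector at \<open>p\<close> is represented, in each chart \<open>c\<close> around \<open>p\<close>, by its component vector.
  \<open>tangent_map c d f p\<close> is the differential of \<open>f\<close> at \<open>p\<close> in the charts \<open>c\<close> around \<open>p\<close> and \<open>d\<close> around
  \<open>f p\<close>; for \<open>f = id\<close> it is the change of components from \<open>c\<close> to \<open>d\<close>.\<close>

definition tangent_map ::
  "('a, 'n::finite) chart \<Rightarrow> ('b, 'm::finite) chart \<Rightarrow> ('a \<Rightarrow> 'b) \<Rightarrow> 'a \<Rightarrow> real ^ 'n \<Rightarrow> real ^ 'm" where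
  "tangent_map c d f p = frechet_derivative (snd d \<circ> f \<circ> cinv c) (at (snd c p))"

definition deriv_along ::
  "('a, 'n::finite) chart \<Rightarrow> ('a \<Rightarrow> real) \<Rightarrow> 'a \<Rightarrow> real ^ 'n \<Rightarrow> real" where
  "deriv_along c f p = frechet_derivative (f \<circ> cinv c) (at (snd c p))"

text \<open>A covariant tensor field of degree \<open>k\<close> is given in each chart by a function of the point and of
  a list of \<open>k\<close> component vectors; values on lists of other lengths are irrelevant.\<close>

type_synonym ('a, 'n) tensor = "('a, 'n) chart \<Rightarrow> 'a \<Rightarrow> (real ^ 'n) list \<Rightarrow> real"

definition multilinear :: "nat \<Rightarrow> ('v::real_vector list \<Rightarrow> real) \<Rightarrow> bool" where
  "multilinear k T \<longleftrightarrow> (\<forall>vs i. length vs = k \<and> i < k \<longrightarrow> linear (\<lambda>v. T (vs[i := v])))"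

definition alternating :: "nat \<Rightarrow> ('v::real_vector list \<Rightarrow> real) \<Rightarrow> bool" where
  "alternating k T \<longleftrightarrow>
     (\<forall>vs i j. length vs = k \<and> i < j \<and> j < k \<and> vs ! i = vs ! j \<longrightarrow> T vs = 0)"

definition tensor_field ::
  "('a, 'n::finite, 'z) manifold_scheme \<Rightarrow> nat \<Rightarrow> ('a, 'n) tensor \<Rightarrow> bool" where
  "tensor_field M k T \<longleftrightarrow>
     (\<forall>c\<in>charts M.
        (\<forall>p\<in>fst c. multilinear k (T c p)) \<and>
        (\<forall>vs. length vs = k \<longrightarrow> smooth_on (cimg c) (\<lambda>u. T c (cinv c u) vs)) \<and>
        (\<forall>c'\<in>charts M. \<forall>p\<in>fst c \<inter> fst c'. \<forall>vs. length vs = k \<longrightarrow>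
           T c p vs = T c' p (map (tangent_map c c' id p) vs)))"

definition form_field ::
  "('a, 'n::finite, 'z) manifold_scheme \<Rightarrow> nat \<Rightarrow> ('a, 'n) tensor \<Rightarrow> bool" where
  "form_field M k T \<longleftrightarrow>
     tensor_field M k T \<and> (\<forall>c\<in>charts M. \<forall>p\<in>fst c. alternating k (T c p))"

text \<open>Exterior derivative in coordinates; the arguments are extended to constant vector fields of the
  chart, whose brackets vanish.\<close>

definition ext_deriv :: "('a, 'n::finite) tensor \<Rightarrow> ('a, 'n) tensor" where
  "ext_deriv T c p vs =
     (\<Sum>i<length vs. (-1) ^ i *
        deriv_along c (\<lambda>q. T c q (take i vs @ drop (Suc i) vs)) p (vs ! i))"

text \<open>Exterior products, normalised such that
  \<open>(\<alpha> \<and> \<beta>)(x, y) = \<alpha>(x) \<beta>(y) - \<alpha>(y) \<beta>(x)\<close> for one-forms: of a list of one-forms, and of a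
  form \<open>a\<close> of degree \<open>p\<close> with a form \<open>b\<close> (of degree \<open>length vs - p\<close>).\<close>

definition wedge1 :: "('v \<Rightarrow> real) list \<Rightarrow> 'v list \<Rightarrow> real" where
  "wedge1 as vs =
     (\<Sum>\<sigma> | \<sigma> permutes {..<length vs}.
        of_int (sign \<sigma>) * (\<Prod>j<length vs. (as ! j) (vs ! \<sigma> j)))"

definition wedge :: "nat \<Rightarrow> ('v list \<Rightarrow> real) \<Rightarrow> ('v list \<Rightarrow> real) \<Rightarrow> 'v list \<Rightarrow> real" where
  "wedge p a b vs =
     (\<Sum>\<sigma> | \<sigma> permutes {..<length vs}.
        of_int (sign \<sigma>) * a (map (\<lambda>i. vs ! \<sigma> i) [0..<p]) *
        b (map (\<lambda>i. vs ! \<sigma> i) [p..<length vs])) / (fact p * fact (length vs - p))"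


section \<open>Riemannian manifolds\<close>

record ('a, 'n::finite) riemannian = "('a, 'n) manifold" +
  met :: "('a, 'n) tensor"

definition riemannian_manifold :: "('a, 'n::finite, 'z) riemannian_scheme \<Rightarrow> bool" where
  "riemannian_manifold M \<longleftrightarrow>
     smooth_manifold M \<and> tensor_field M 2 (met M) \<and>
     (\<forall>c\<in>charts M. \<forall>p\<in>fst c.
        (\<forall>x y. met M c p [x, y] = met M c p [y, x]) \<and>
        (\<forall>x. x \<noteq> 0 \<longrightarrow> met M c p [x, x] > 0))"

text \<open>The vector corresponding to a one-form under the metric.\<close>

definition sharp ::
  "('a, 'n::finite, 'z) riemannian_scheme \<Rightarrow> ('a, 'n) chart \<Rightarrow> 'a \<Rightarrow> (real ^ 'n \<Rightarrow> real) \<Rightarrow> real ^ 'n" where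
  "sharp M c p \<mu> =
     (\<chi> i. \<Sum>j\<in>UNIV. matrix_inv (\<chi> i j. met M c p [axis i 1, axis j 1]) $ i $ j * \<mu> (axis j 1))"

definition flat ::
  "('a, 'n::finite, 'z) riemannian_scheme \<Rightarrow> ('a, 'n) chart \<Rightarrow> 'a \<Rightarrow> real ^ 'n \<Rightarrow> real ^ 'n \<Rightarrow> real" where
  "flat M c p x = (\<lambda>y. met M c p [x, y])"

text \<open>The Christoffel map \<open>\<Gamma>(x, y)\<close> of the Levi-Civita connection: the covariant derivative of the
  constant vector field \<open>y\<close> of the chart in direction \<open>x\<close>.\<close>

definition christoffel ::
  "('a, 'n::finite, 'z) riemannian_scheme \<Rightarrow> ('a, 'n) chart \<Rightarrow> 'a \<Rightarrow> real ^ 'n \<Rightarrow> real ^ 'n \<Rightarrow> real ^ 'n" where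
  "christoffel M c p x y =
     sharp M c p (\<lambda>z. (deriv_along c (\<lambda>q. met M c q [y, z]) p x
                     + deriv_along c (\<lambda>q. met M c q [x, z]) p y
                     - deriv_along c (\<lambda>q. met M c q [x, y]) p z) / 2)"

text \<open>\<open>nabla M T c p x\<close> is the Levi-Civita derivative of the covariant tensor field \<open>T\<close> at \<open>p\<close> in
  direction \<open>x\<close>.\<close>

definition nabla ::
  "('a, 'n::finite, 'z) riemannian_scheme \<Rightarrow> ('a, 'n) tensor \<Rightarrow> ('a, 'n) chart \<Rightarrow> 'a
     \<Rightarrow> real ^ 'n \<Rightarrow> (real ^ 'n) list \<Rightarrow> real" where
  "nabla M T c p x vs =
     deriv_along c (\<lambda>q. T c q vs) p x
     - (\<Sum>i<length vs. T c p (vs[i := christoffel M c p x (vs ! i)]))"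

definition orthonormal ::
  "('a, 'n::finite, 'z) riemannian_scheme \<Rightarrow> ('a, 'n) chart \<Rightarrow> 'a \<Rightarrow> ('n \<Rightarrow> real ^ 'n) \<Rightarrow> bool" where
  "orthonormal M c p e \<longleftrightarrow> (\<forall>i j. met M c p [e i, e j] = (if i = j then 1 else 0))"

text \<open>The traces and inner products formed with this basis do not depend on the choice.\<close>

definition onb ::
  "('a, 'n::finite, 'z) riemannian_scheme \<Rightarrow> ('a, 'n) chart \<Rightarrow> 'a \<Rightarrow> 'n \<Rightarrow> real ^ 'n" where
  "onb M c p = (SOME e. orthonormal M c p e)"

definition form_inner ::
  "('a, 'n::finite, 'z) riemannian_scheme \<Rightarrow> ('a, 'n) chart \<Rightarrow> 'a \<Rightarrow> nat
     \<Rightarrow> ((real ^ 'n) list \<Rightarrow> real) \<Rightarrow> ((real ^ 'n) list \<Rightarrow> real) \<Rightarrow> real" where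
  "form_inner M c p k a b =
     (\<Sum>is | length is = k. a (map (onb M c p) is) * b (map (onb M c p) is)) / fact k"


section \<open>$G_2$-structures\<close>

record 'a g2 = "('a, 7) riemannian" +
  phi :: "('a, 7) tensor"

text \<open>Indices are elements of the numeral type \<open>7\<close>, whose arithmetic is that of the integers modulo 7.\<close>

definition adapted ::
  "'a g2 \<Rightarrow> ('a, 7) chart \<Rightarrow> 'a \<Rightarrow> (7 \<Rightarrow> real ^ 7) \<Rightarrow> bool" where
  "adapted N c q e \<longleftrightarrow>
     orthonormal N c q e \<and>
     (\<forall>vs. length vs = 3 \<longrightarrow>
        phi N c q vs =
          (\<Sum>i\<in>UNIV. wedge1 [flat N c q (e i), flat N c q (e (i + 1)), flat N c q (e (i + 3))] vs))"

definition g2_manifold :: "'a g2 \<Rightarrow> bool" where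
  "g2_manifold N \<longleftrightarrow>
     riemannian_manifold N \<and> form_field N 3 (phi N) \<and>
     (\<forall>q\<in>topspace (topo N). \<exists>c\<in>charts N. \<exists>W e.
        openin (topo N) W \<and> q \<in> W \<and> W \<subseteq> fst c \<and>
        (\<forall>i. smooth_on (snd c ` W) (\<lambda>u. e (cinv c u) i)) \<and>
        (\<forall>q'\<in>W. adapted N c q' (e q')))"

text \<open>Hodge star at a point for the orientation \<open>e\<^sub>0 \<and> \<dots> \<and> e\<^sub>6\<close> of an adapted frame. Since
  \<open>G\<^sub>2\<close> is contained in \<open>SO(7)\<close>, the orientation does not depend on the choice of the frame. The degree
  of the form \<open>a\<close> is recovered from the number of arguments of the dual form.\<close>

definition g2_frame :: "'a g2 \<Rightarrow> ('a, 7) chart \<Rightarrow> 'a \<Rightarrow> 7 \<Rightarrow> real ^ 7" where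
  "g2_frame N c q = (SOME e. adapted N c q e)"

definition g2_vol :: "'a g2 \<Rightarrow> ('a, 7) tensor" where
  "g2_vol N c q = wedge1 (map (\<lambda>i. flat N c q (g2_frame N c q i)) [0, 1, 2, 3, 4, 5, 6])"

definition hodge ::
  "'a g2 \<Rightarrow> ('a, 7) chart \<Rightarrow> 'a \<Rightarrow> ((real ^ 7) list \<Rightarrow> real) \<Rightarrow> (real ^ 7) list \<Rightarrow> real" where
  "hodge N c q a vs =
     (\<Sum>is | length is = 7 - length vs.
        a (map (g2_frame N c q) is) * g2_vol N c q (map (g2_frame N c q) is @ vs))
     / fact (7 - length vs)"

definition star_phi :: "'a g2 \<Rightarrow> ('a, 7) tensor" where
  "star_phi N c q = hodge N c q (phi N c q)"

text \<open>The product \<open>P\<close>, determined by \<open>\<langle>P(x, y), z\<rangle> = \<phi>(x, y, z)\<close>.\<close>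

definition cross :: "'a g2 \<Rightarrow> ('a, 7) chart \<Rightarrow> 'a \<Rightarrow> real ^ 7 \<Rightarrow> real ^ 7 \<Rightarrow> real ^ 7" where
  "cross N c q x y = sharp N c q (\<lambda>z. phi N c q [x, y, z])"

text \<open>\<open>pd\<^sup>*\<phi> = *(*d\<phi> \<and> \<phi>)\<close>, a one-form.\<close>

definition pdstar_phi :: "'a g2 \<Rightarrow> ('a, 7) tensor" where
  "pdstar_phi N c q =
     hodge N c q (wedge 3 (hodge N c q (ext_deriv (phi N) c q)) (phi N c q))"

definition p_phi :: "'a g2 \<Rightarrow> ('a, 7) chart \<Rightarrow> 'a \<Rightarrow> real ^ 7" where
  "p_phi N c q = sharp N c q (\<lambda>x. pdstar_phi N c q [x])"

definition rbar :: "'a g2 \<Rightarrow> ('a, 7) chart \<Rightarrow> 'a \<Rightarrow> real ^ 7 \<Rightarrow> real ^ 7 \<Rightarrow> real" where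
  "rbar N c q x y =
     form_inner N c q 3 (nabla N (phi N) c q x) (\<lambda>vs. star_phi N c q (y # vs)) / 4"

definition type_X4 :: "'a g2 \<Rightarrow> bool" where
  "type_X4 N \<longleftrightarrow>
     (\<forall>c\<in>charts N. \<forall>q\<in>fst c. \<forall>x y.
        rbar N c q x y = - (1 / 12) * phi N c q [p_phi N c q, x, y])"


section \<open>$SU(3)$-structures and their torsion\<close>

record 'a su3 = "('a, 6) riemannian" +
  acs :: "('a, 6) chart \<Rightarrow> 'a \<Rightarrow> real ^ 6 \<Rightarrow> real ^ 6"
  psi_plus :: "('a, 6) tensor"
  psi_minus :: "('a, 6) tensor"

definition omega :: "'a su3 \<Rightarrow> ('a, 6) tensor" where
  "omega S c p vs = met S c p [vs ! 0, acs S c p (vs ! 1)]"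

definition nabla_omega ::
  "'a su3 \<Rightarrow> ('a, 6) chart \<Rightarrow> 'a \<Rightarrow> real ^ 6 \<Rightarrow> real ^ 6 \<Rightarrow> real ^ 6 \<Rightarrow> real" where
  "nabla_omega S c p x y z = nabla S (omega S) c p x [y, z]"

definition codiff_omega :: "'a su3 \<Rightarrow> ('a, 6) chart \<Rightarrow> 'a \<Rightarrow> real ^ 6 \<Rightarrow> real" where
  "codiff_omega S c p x =
     - (\<Sum>i\<in>UNIV. nabla_omega S c p (onb S c p i) (onb S c p i) x)"

text \<open>The action of the almost complex structure \<open>I\<close> on one-forms and on bilinear forms.\<close>

definition I_form ::
  "'a su3 \<Rightarrow> ('a, 6) chart \<Rightarrow> 'a \<Rightarrow> (real ^ 6 \<Rightarrow> real) \<Rightarrow> real ^ 6 \<Rightarrow> real" where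
  "I_form S c p \<mu> x = - \<mu> (acs S c p x)"

definition I_bil ::
  "'a su3 \<Rightarrow> ('a, 6) chart \<Rightarrow> 'a \<Rightarrow> (real ^ 6 \<Rightarrow> real ^ 6 \<Rightarrow> real) \<Rightarrow> real ^ 6 \<Rightarrow> real ^ 6 \<Rightarrow> real" where
  "I_bil S c p b x y = b (acs S c p x) (acs S c p y)"

text \<open>The one-form \<open>\<eta>\<close> with \<open>(I\<eta>)(X) = - \<langle>\<nabla>\<^sub>X \<psi>\<^sub>+, \<psi>\<^sub>-\<rangle> / 12\<close>; this is solved for
  \<open>\<eta>\<close> by inserting \<open>X = I x\<close>, as \<open>(I\<eta>)(I x) = - \<eta>(I I x) = \<eta>(x)\<close>.\<close>

definition eta :: "'a su3 \<Rightarrow> ('a, 6) chart \<Rightarrow> 'a \<Rightarrow> real ^ 6 \<Rightarrow> real" where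
  "eta S c p x =
     - (1 / 12) * form_inner S c p 3 (nabla S (psi_plus S) c p (acs S c p x)) (psi_minus S c p)"

type_synonym trilin = "real ^ 6 \<Rightarrow> real ^ 6 \<Rightarrow> real ^ 6 \<Rightarrow> real"

definition r_form :: "'a su3 \<Rightarrow> ('a, 6) chart \<Rightarrow> 'a \<Rightarrow> trilin \<Rightarrow> real ^ 6 \<Rightarrow> real ^ 6 \<Rightarrow> real" where
  "r_form S c p \<alpha> x y =
     form_inner S c p 2 (\<lambda>vs. \<alpha> x (vs ! 0) (vs ! 1)) (\<lambda>vs. psi_plus S c p (y # vs)) / 2"

datatype parity = Plus | Minus

datatype torsion_class = W1 parity | W2 parity | W3 | W4 | W5

fun has_parity :: "parity \<Rightarrow> ('v \<Rightarrow> 'v \<Rightarrow> real) \<Rightarrow> bool" where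
  "has_parity Plus b = (\<forall>x y. b x y = b y x)"
| "has_parity Minus b = (\<forall>x y. b x y = - b y x)"

definition gh_space :: "'a su3 \<Rightarrow> ('a, 6) chart \<Rightarrow> 'a \<Rightarrow> trilin set" where
  "gh_space S c p =
     {\<alpha>. (\<forall>y z. linear (\<lambda>x. \<alpha> x y z)) \<and> (\<forall>x z. linear (\<lambda>y. \<alpha> x y z)) \<and>
         (\<forall>x y. linear (\<lambda>z. \<alpha> x y z)) \<and>
         (\<forall>x y z. \<alpha> x y z = - \<alpha> x z y \<and> \<alpha> x y z = - \<alpha> x (acs S c p y) (acs S c p z))}"

text \<open>\<open>W5\<close> is not a subspace of \<open>gh_space\<close>: that part of the torsion is \<open>eta\<close>. The value given to it
  here is not used.\<close>

fun gh_module :: "'a su3 \<Rightarrow> ('a, 6) chart \<Rightarrow> 'a \<Rightarrow> torsion_class \<Rightarrow> trilin set" where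
  "gh_module S c p (W1 s) =
     {\<alpha> \<in> gh_space S c p.
        (\<forall>x y z. \<alpha> x y z = - \<alpha> y x z \<and> \<alpha> x y z = - \<alpha> x z y) \<and> has_parity s (r_form S c p \<alpha>)}"
| "gh_module S c p (W2 s) =
     {\<alpha> \<in> gh_space S c p.
        (\<forall>x y z. \<alpha> x y z + \<alpha> y z x + \<alpha> z x y = 0) \<and> has_parity s (r_form S c p \<alpha>)}"
| "gh_module S c p W3 =
     {\<alpha> \<in> gh_space S c p.
        (\<forall>x y z. \<alpha> (acs S c p x) (acs S c p y) z = \<alpha> x y z) \<and>
        (\<forall>z. (\<Sum>i\<in>UNIV. \<alpha> (onb S c p i) (onb S c p i) z) = 0)}"
| "gh_module S c p W4 =
     {\<alpha> \<in> gh_space S c p. \<exists>\<tau>. linear \<tau> \<and>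
        (\<forall>x y z. \<alpha> x y z =
             met S c p [x, y] * \<tau> z - met S c p [x, z] * \<tau> y
           - met S c p [x, acs S c p y] * \<tau> (acs S c p z)
           + met S c p [x, acs S c p z] * \<tau> (acs S c p y))}"
| "gh_module S c p W5 = {\<lambda>x y z. 0}"

definition gh_classes :: "torsion_class set" where
  "gh_classes = {W1 Plus, W1 Minus, W2 Plus, W2 Minus, W3, W4}"

text \<open>\<open>C k\<close> is the component of \<open>\<nabla>\<omega>\<close> in the summand \<open>k\<close>. As \<open>gh_space\<close> is the direct sum of the
  six summands, the components are uniquely determined.\<close>

definition torsion_type :: "'a su3 \<Rightarrow> torsion_class set \<Rightarrow> bool" where
  "torsion_type S U \<longleftrightarrow>
     (\<forall>c\<in>charts S. \<forall>p\<in>fst c.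
        (\<exists>C. (\<forall>k\<in>gh_classes. C k \<in> gh_module S c p k) \<and>
             (\<forall>x y z. nabla_omega S c p x y z = (\<Sum>k\<in>gh_classes. C k x y z)) \<and>
             (\<forall>k\<in>gh_classes - U. \<forall>x y z. C k x y z = 0)) \<and>
        (W5 \<notin> U \<longrightarrow> (\<forall>x. eta S c p x = 0)))"


section \<open>Hypersurfaces\<close>

definition immersion ::
  "('b, 'm::finite, 'y) manifold_scheme \<Rightarrow> ('a, 'n::finite, 'z) manifold_scheme \<Rightarrow> ('b \<Rightarrow> 'a) \<Rightarrow> bool" where
  "immersion M N \<iota> \<longleftrightarrow>
     continuous_map (topo M) (topo N) \<iota> \<and>
     (\<forall>c\<in>charts M. \<forall>d\<in>charts N.
        smooth_on (snd c ` (fst c \<inter> \<iota> -` fst d)) (snd d \<circ> \<iota> \<circ> cinv c) \<and>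
        (\<forall>p\<in>fst c \<inter> \<iota> -` fst d. inj (tangent_map c d \<iota> p)))"

text \<open>A vector field along \<open>\<iota>\<close>, such as the unit normal, is given by its components \<open>n d p\<close> in the
  charts \<open>d\<close> of the ambient manifold around \<open>\<iota> p\<close>.\<close>

definition unit_normal ::
  "('a, 'n::finite, 'z) riemannian_scheme \<Rightarrow> ('b, 'm::finite, 'y) manifold_scheme \<Rightarrow> ('b \<Rightarrow> 'a)
     \<Rightarrow> (('a, 'n) chart \<Rightarrow> 'b \<Rightarrow> real ^ 'n) \<Rightarrow> bool" where
  "unit_normal N M \<iota> n \<longleftrightarrow>
     (\<forall>d\<in>charts N.
        (\<forall>c\<in>charts M.
           smooth_on (snd c ` (fst c \<inter> \<iota> -` fst d)) (\<lambda>u. n d (cinv c u)) \<and>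
           (\<forall>p\<in>fst c \<inter> \<iota> -` fst d.
              met N d (\<iota> p) [n d p, n d p] = 1 \<and>
              (\<forall>x. met N d (\<iota> p) [n d p, tangent_map c d \<iota> p x] = 0) \<and>
              (\<forall>d'\<in>charts N. \<iota> p \<in> fst d' \<longrightarrow> n d' p = tangent_map d d' id (\<iota> p) (n d p)))))"

text \<open>The objects below are computed in a chosen chart of the ambient manifold around \<open>\<iota> p\<close>; they do
  not depend on the choice.\<close>

definition pullback ::
  "('a, 'n::finite, 'z) manifold_scheme \<Rightarrow> ('b \<Rightarrow> 'a) \<Rightarrow> ('a, 'n) tensor \<Rightarrow> ('b, 'm::finite) tensor" where
  "pullback N \<iota> T c p vs =
     (let d = chart_at N (\<iota> p) in T d (\<iota> p) (map (tangent_map c d \<iota> p) vs))"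

text \<open>\<open>\<iota>\<^sup>*(n \<lrcorner> T)\<close> for a vector field \<open>n\<close> along \<open>\<iota>\<close>; if \<open>T\<close> is a one-form,
  then \<open>pullback_contr N \<iota> n T c p []\<close> is the function \<open>T(n)\<close>.\<close>

definition pullback_contr ::
  "('a, 'n::finite, 'z) manifold_scheme \<Rightarrow> ('b \<Rightarrow> 'a) \<Rightarrow> (('a, 'n) chart \<Rightarrow> 'b \<Rightarrow> real ^ 'n)
     \<Rightarrow> ('a, 'n) tensor \<Rightarrow> ('b, 'm::finite) tensor" where
  "pullback_contr N \<iota> n T c p vs =
     (let d = chart_at N (\<iota> p) in T d (\<iota> p) (n d p # map (tangent_map c d \<iota> p) vs))"

definition induced_acs ::
  "'a g2 \<Rightarrow> ('b \<Rightarrow> 'a) \<Rightarrow> (('a, 7) chart \<Rightarrow> 'b \<Rightarrow> real ^ 7)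
     \<Rightarrow> ('b, 6) chart \<Rightarrow> 'b \<Rightarrow> real ^ 6 \<Rightarrow> real ^ 6" where
  "induced_acs N \<iota> n c p x =
     (let d = chart_at N (\<iota> p) in
        THE y. tangent_map c d \<iota> p y = cross N d (\<iota> p) (n d p) (tangent_map c d \<iota> p x))"

definition induced_su3 ::
  "'a g2 \<Rightarrow> ('b, 6) manifold \<Rightarrow> ('b \<Rightarrow> 'a) \<Rightarrow> (('a, 7) chart \<Rightarrow> 'b \<Rightarrow> real ^ 7) \<Rightarrow> real \<Rightarrow> 'b su3" where
  "induced_su3 N M \<iota> n \<theta> =
     \<lparr> topo = topo M, charts = charts M,
       met = pullback N \<iota> (met N),
       acs = induced_acs N \<iota> n,
       psi_plus = (\<lambda>c p vs. cos \<theta> * pullback N \<iota> (phi N) c p vs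
                          - sin \<theta> * pullback_contr N \<iota> n (star_phi N) c p vs),
       psi_minus = (\<lambda>c p vs. sin \<theta> * pullback N \<iota> (phi N) c p vs
                           + cos \<theta> * pullback_contr N \<iota> n (star_phi N) c p vs) \<rparr>"

text \<open>\<open>B(x, y) = \<langle>\<nabla>\<^sub>x y, n\<rangle>\<close> for the ambient Levi-Civita connection, \<open>y\<close> being extended to a
  constant vector field of the chart \<open>c\<close>.\<close>

definition second_ff ::
  "('a, 'n::finite, 'z) riemannian_scheme \<Rightarrow> ('b \<Rightarrow> 'a) \<Rightarrow> (('a, 'n) chart \<Rightarrow> 'b \<Rightarrow> real ^ 'n)
     \<Rightarrow> ('b, 'm::finite) chart \<Rightarrow> 'b \<Rightarrow> real ^ 'm \<Rightarrow> real ^ 'm \<Rightarrow> real" where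
  "second_ff N \<iota> n c p x y =
     (let d = chart_at N (\<iota> p) in
        met N d (\<iota> p)
          [frechet_derivative
             (\<lambda>u. frechet_derivative (snd d \<circ> \<iota> \<circ> cinv c) (at u) y) (at (snd c p)) x
           + christoffel N d (\<iota> p) (tangent_map c d \<iota> p x) (tangent_map c d \<iota> p y),
           n d p])"

text \<open>\<open>h = Tr B / 6\<close>, the trace being taken with respect to the induced metric of \<open>S\<close>.\<close>

definition mean_curv ::
  "'a g2 \<Rightarrow> 'b su3 \<Rightarrow> ('b \<Rightarrow> 'a) \<Rightarrow> (('a, 7) chart \<Rightarrow> 'b \<Rightarrow> real ^ 7) \<Rightarrow> ('b, 6) chart \<Rightarrow> 'b \<Rightarrow> real" where
  "mean_curv N S \<iota> n c p =
     (\<Sum>i\<in>UNIV. second_ff N \<iota> n c p (onb S c p i) (onb S c p i)) / 6"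

definition totally_umbilic ::
  "'a g2 \<Rightarrow> 'b su3 \<Rightarrow> ('b \<Rightarrow> 'a) \<Rightarrow> (('a, 7) chart \<Rightarrow> 'b \<Rightarrow> real ^ 7) \<Rightarrow> bool" where
  "totally_umbilic N S \<iota> n \<longleftrightarrow>
     (\<forall>c\<in>charts S. \<forall>p\<in>fst c. \<forall>x y.
        second_ff N \<iota> n c p x y = mean_curv N S \<iota> n c p * met S c p [x, y])"

definition p_phi_normal ::
  "'a g2 \<Rightarrow> ('b, 6) manifold \<Rightarrow> ('b \<Rightarrow> 'a) \<Rightarrow> (('a, 7) chart \<Rightarrow> 'b \<Rightarrow> real ^ 7) \<Rightarrow> bool" where
  "p_phi_normal N M \<iota> n \<longleftrightarrow>
     (\<forall>p\<in>topspace (topo M).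
        let d = chart_at N (\<iota> p); v = p_phi N d (\<iota> p)
        in v - met N d (\<iota> p) [v, n d p] *\<^sub>R n d p = 0)"

end

theory Submission
  imports Defs
begin

text \<open>At a point of \<open>M\<close> choose an adapted frame \<open>e\<^sub>0, \<dots>, e\<^sub>6\<close> with \<open>e\<^sub>0 = n\<close>; the tangent space of \<open>M\<close>
  becomes \<open>{v. v\<^sub>0 = 0}\<close> and \<open>\<phi>\<close>, \<open>*\<phi>\<close>, \<open>I\<close>, \<open>\<psi>\<^sub>\<plusminus>\<close> get constant coefficients. Both \<open>\<phi>\<close> and \<open>*\<phi>\<close> are constant in a
  moving adapted frame, so \<open>\<nabla>\<^sub>x\<phi> = - k\<^sub>x \<cdot> \<phi>\<close> and \<open>\<nabla>\<^sub>x*\<phi> = - k\<^sub>x \<cdot> *\<phi>\<close> with the same skew \<open>k\<^sub>x\<close>. Only the component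
  of \<open>k\<^sub>x\<close> in the second summand of \<open>so(7) = g\<^sub>2 \<oplus> \<real>\<^sup>7\<close> acts, and type \<open>X\<^sub>4\<close> says that it is given by
  \<open>P(p, x)\<close>. The formulas of Gauss and Weingarten then yield
  \<open>\<nabla>\<omega>(x, y, z) = \<phi>(A x, y, z) + *\<phi>(P(p, x), n, y, z) / 12\<close> with the shape operator \<open>A\<close>. The last term
  is \<open>- (p\<^sub>0 / 12) \<phi>(x, y, z)\<close> plus an element of \<open>W\<^sub>4\<close> determined by the tangential part of \<open>p\<close>. The
  remaining part is \<open>\<phi>(b x, y, z)\<close> with \<open>b = A - p\<^sub>0 / 12\<close> symmetric; the multiples of the identity in
  \<open>b\<close> give \<open>W\<^sub>1\<close>, the trace-free endomorphisms commuting with \<open>I\<close> give \<open>W\<^sub>2\<close>, and those anticommuting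
  with \<open>I\<close> give \<open>W\<^sub>3\<close>. The parity is \<open>\<epsilon>\<close>, as \<open>\<psi>\<^sub>+\<close> is \<open>\<phi>\<close> or its composition with \<open>I\<close>.\<close>

section \<open>The model $G_2$-form on $R^7$\<close>

text \<open>Two choices in the definitions shape the argument. The Hodge dual is built from an
  adapted frame chosen separately at every point, so neither its chart independence nor its
  differentiability is visible. Writing it with the metric and the cross product gives the first, a
  moving adapted frame the second. Moreover an adapted frame need not start with n; this is repaired
  by moving \<open>e0\<close> to any unit vector by an automorphism of the model form. For the
  equivalences the torsion classes are separated by invariants. Under \<alpha>(x, y, z) |->
  \<alpha>(I x, I y, z) the classes W1 and W2 change sign while W3 and W4 are fixed, and the trace
  over the first two slots sees only W4. Telling W1 from W2 is a fact about Hermitian 3-by-3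
  matrices: acting as a derivation, such a matrix multiplies the complex volume form by its trace.
  The constants come from contracting the model form with its dual over two indices, which gives the
  factor -4; with the 1/4 in \<open>rbar\<close> and the 1/12 in type X4 it yields the vector - P(p,
  x) / 12 in \<open>skew_act_phi0_e0\<close>.\<close>

lemma UNIV_7: "(UNIV::7 set) = {0,1,2,3,4,5,6}"
proof -
  have "card {0,1,2,3,4,5,6::7} = CARD(7)" by simp
  then show ?thesis by (metis card_subset_eq finite subset_UNIV)
qed

lemma sum_7: "sum f (UNIV::7 set) = f 0 + f 1 + f 2 + f 3 + f 4 + f 5 + f 6"
  unfolding UNIV_7 by (simp add: add.assoc)

lemma reduce_7: "(7::7) = 0" "(8::7) = 1" "(9::7) = 2" "(10::7) = 3" "(11::7) = 4" "(12::7) = 5"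
  by simp_all

lemma num_7:
  "(1::7)+1=2" "(1::7)+2=3" "(1::7)+3=4" "(1::7)+4=5" "(1::7)+5=6" "(1::7)+6=0"
  "(2::7)+1=3" "(2::7)+2=4" "(2::7)+3=5" "(2::7)+4=6" "(2::7)+5=0" "(2::7)+6=1"
  "(3::7)+1=4" "(3::7)+2=5" "(3::7)+3=6" "(3::7)+4=0" "(3::7)+5=1" "(3::7)+6=2"
  "(4::7)+1=5" "(4::7)+2=6" "(4::7)+3=0" "(4::7)+4=1" "(4::7)+5=2" "(4::7)+6=3"
  "(5::7)+1=6" "(5::7)+2=0" "(5::7)+3=1" "(5::7)+4=2" "(5::7)+5=3" "(5::7)+6=4"
  "(6::7)+1=0" "(6::7)+2=1" "(6::7)+3=2" "(6::7)+4=3" "(6::7)+5=4" "(6::7)+6=5"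
  by simp_all

lemma forall_7: "(\<forall>i::7. P i) \<longleftrightarrow> P 0 \<and> P 1 \<and> P 2 \<and> P 3 \<and> P 4 \<and> P 5 \<and> P 6"
  by (metis UNIV_7 UNIV_I empty_iff insert_iff)

section \<open>The model three-form, its dual and the cross product in coordinates\<close>

definition phi0 :: "real^7 \<Rightarrow> real^7 \<Rightarrow> real^7 \<Rightarrow> real" where
  "phi0 x y z = (\<Sum>i\<in>UNIV.
      x $ i * (y $ (i+1) * z $ (i+3) - y $ (i+3) * z $ (i+1))
    + x $ (i+1) * (y $ (i+3) * z $ i - y $ i * z $ (i+3))
    + x $ (i+3) * (y $ i * z $ (i+1) - y $ (i+1) * z $ i))"

text \<open>Each summand is a 4-by-4 determinant in Laplace form, as products of 2-by-2 minors in
  \<open>x\<close>, \<open>y\<close> and in \<open>z\<close>, \<open>w\<close>. In this shape it can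
  be matched with the minors of the volume form in \<open>phi0_wedge_vol0\<close>.\<close>

definition star0 :: "real^7 \<Rightarrow> real^7 \<Rightarrow> real^7 \<Rightarrow> real^7 \<Rightarrow> real" where
  "star0 x y z w = - (\<Sum>i\<in>UNIV.
      (x $ (i+2) * y $ (i+4) - x $ (i+4) * y $ (i+2)) * (z $ (i+5) * w $ (i+6) - z $ (i+6) * w $ (i+5))
    - (x $ (i+2) * y $ (i+5) - x $ (i+5) * y $ (i+2)) * (z $ (i+4) * w $ (i+6) - z $ (i+6) * w $ (i+4))
    + (x $ (i+2) * y $ (i+6) - x $ (i+6) * y $ (i+2)) * (z $ (i+4) * w $ (i+5) - z $ (i+5) * w $ (i+4))
    + (x $ (i+4) * y $ (i+5) - x $ (i+5) * y $ (i+4)) * (z $ (i+2) * w $ (i+6) - z $ (i+6) * w $ (i+2))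
    - (x $ (i+4) * y $ (i+6) - x $ (i+6) * y $ (i+4)) * (z $ (i+2) * w $ (i+5) - z $ (i+5) * w $ (i+2))
    + (x $ (i+5) * y $ (i+6) - x $ (i+6) * y $ (i+5)) * (z $ (i+2) * w $ (i+4) - z $ (i+4) * w $ (i+2)))"

definition cross0 :: "real^7 \<Rightarrow> real^7 \<Rightarrow> real^7" where
  "cross0 x y = (\<chi> k. x $ (k+1) * y $ (k+3) - x $ (k+3) * y $ (k+1)
     + x $ (k+2) * y $ (k+6) - x $ (k+6) * y $ (k+2)
     + x $ (k+4) * y $ (k+5) - x $ (k+5) * y $ (k+4))"

abbreviation e0 :: "real^7" where "e0 \<equiv> axis 0 1"

lemma inner_7: "(x::real^7) \<bullet> y = x$0*y$0 + x$1*y$1 + x$2*y$2 + x$3*y$3 + x$4*y$4 + x$5*y$5 + x$6*y$6"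
  by (simp add: inner_vec_def sum_7)

lemma phi0_add: "phi0 (x + x') y z = phi0 x y z + phi0 x' y z"
  "phi0 x (y + y') z = phi0 x y z + phi0 x y' z"
  "phi0 x y (z + z') = phi0 x y z + phi0 x y z'"
  by (simp_all add: phi0_def algebra_simps sum.distrib sum_subtractf)

lemma phi0_scale: "phi0 (c *\<^sub>R x) y z = c * phi0 x y z"
  "phi0 x (c *\<^sub>R y) z = c * phi0 x y z"
  "phi0 x y (c *\<^sub>R z) = c * phi0 x y z"
  by (simp_all add: phi0_def algebra_simps sum_distrib_left)

lemma phi0_linear: "linear (\<lambda>x. phi0 x y z)" "linear (\<lambda>y. phi0 x y z)" "linear (phi0 x y)"
  by (auto intro!: linearI simp: phi0_add phi0_scale)

lemma phi0_swap: "phi0 y x z = - phi0 x y z" and phi0_cycle: "phi0 y z x = phi0 x y z"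
  by (simp_all add: phi0_def sum_7 reduce_7 algebra_simps)

lemma cross0_inner: "cross0 x y \<bullet> z = phi0 x y z"
  by (simp add: phi0_def sum_7 reduce_7 inner_7 cross0_def algebra_simps)

lemma cross0_add: "cross0 (x + x') y = cross0 x y + cross0 x' y"
  "cross0 x (y + y') = cross0 x y + cross0 x y'"
  by (simp_all add: cross0_def vec_eq_iff algebra_simps)

lemma cross0_scale: "cross0 (c *\<^sub>R x) y = c *\<^sub>R cross0 x y"
  "cross0 x (c *\<^sub>R y) = c *\<^sub>R cross0 x y"
  by (simp_all add: cross0_def vec_eq_iff algebra_simps)

text \<open>Polarises x \<times> (x \<times> z) = <x, z> x - |x|^2 z, a law of the imaginary
  octonions. It is the source of the multiplication rules in
  \<open>g2_automorphism_exists\<close>.\<close>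

lemma cross0_cross0:
  "cross0 x (cross0 y z) + cross0 y (cross0 x z)
    = (x \<bullet> z) *\<^sub>R y + (y \<bullet> z) *\<^sub>R x - (2 * (x \<bullet> y)) *\<^sub>R z"
  unfolding vec_eq_iff forall_7
  by (intro conjI; simp only: reduce_7 cross0_def inner_7 vec_lambda_beta vector_add_component
    vector_minus_component vector_scaleR_component real_scaleR_def; simp only: add_0 num_7; algebra)

text \<open>Metric and cross product alone determine the dual form; this later frees
  \<open>star_phi\<close> from the chosen frame.\<close>

lemma star0_cross0:
  "star0 x y z w = - (cross0 x y \<bullet> cross0 z w - (x \<bullet> z) * (y \<bullet> w) + (x \<bullet> w) * (y \<bullet> z))"
  by (simp only: reduce_7 star0_def sum_7 cross0_def inner_7 vec_lambda_beta num_7 add_0) algebra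

lemmas phi0_expand = phi0_def[unfolded sum_7 num_7 add_0]
lemmas star0_expand = star0_def[unfolded sum_7 num_7 add_0]
lemma cross0_nth:
  "cross0 x y $ 0 = x$1*y$3 - x$3*y$1 + x$2*y$6 - x$6*y$2 + x$4*y$5 - x$5*y$4"
  "cross0 x y $ 1 = x$2*y$4 - x$4*y$2 + x$3*y$0 - x$0*y$3 + x$5*y$6 - x$6*y$5"
  "cross0 x y $ 2 = x$3*y$5 - x$5*y$3 + x$4*y$1 - x$1*y$4 + x$6*y$0 - x$0*y$6"
  "cross0 x y $ 3 = x$4*y$6 - x$6*y$4 + x$5*y$2 - x$2*y$5 + x$0*y$1 - x$1*y$0"
  "cross0 x y $ 4 = x$5*y$0 - x$0*y$5 + x$6*y$3 - x$3*y$6 + x$1*y$2 - x$2*y$1"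
  "cross0 x y $ 5 = x$6*y$1 - x$1*y$6 + x$0*y$4 - x$4*y$0 + x$2*y$3 - x$3*y$2"
  "cross0 x y $ 6 = x$0*y$2 - x$2*y$0 + x$1*y$5 - x$5*y$1 + x$3*y$4 - x$4*y$3"
  by (simp_all add: cross0_def reduce_7)

lemma e0_nth [simp]: "e0 $ 0 = 1" "e0 $ 1 = 0" "e0 $ 2 = 0" "e0 $ 3 = 0" "e0 $ 4 = 0" "e0 $ 5 = 0" "e0 $ 6 = 0"
  by (simp_all add: axis_def)

text \<open>On basis vectors \<open>phi0\<close> is supported on the seven lines {i, i+1, i+3} of
  the Fano plane, so contracting two of its slots leaves six signed terms per line.\<close>

lemma sum_phi0_axis:
  "(\<Sum>j\<in>UNIV. \<Sum>k\<in>UNIV. phi0 u (axis j 1) (axis k 1) * V j k) =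
   (\<Sum>i\<in>UNIV. u $ i * (V (i+1) (i+3) - V (i+3) (i+1)) + u $ (i+1) * (V (i+3) i - V i (i+3))
      + u $ (i+3) * (V i (i+1) - V (i+1) i))"
proof -
  \<comment> \<open>The six Kronecker terms of the i-th wedge product, as nested conditionals over
    which the double sum evaluates directly.\<close>
  let ?t = "\<lambda>i j k.
       (if j = i+1 then if k = i+3 then u $ i * V j k else 0 else 0)
     - (if j = i+3 then if k = i+1 then u $ i * V j k else 0 else 0)
     + (if j = i+3 then if k = i then u $ (i+1) * V j k else 0 else 0)
     - (if j = i then if k = i+3 then u $ (i+1) * V j k else 0 else 0)
     + (if j = i then if k = i+1 then u $ (i+3) * V j k else 0 else 0)
     - (if j = i+1 then if k = i then u $ (i+3) * V j k else 0 else 0)"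
  have "(\<Sum>j\<in>UNIV. \<Sum>k\<in>UNIV. phi0 u (axis j 1) (axis k 1) * V j k) =
    (\<Sum>j\<in>UNIV. \<Sum>k\<in>UNIV. \<Sum>i\<in>UNIV. ?t i j k)"
    unfolding phi0_def sum_distrib_right
    by (intro sum.cong refl) (auto simp: axis_def algebra_simps)
  also have "\<dots> = (\<Sum>i\<in>UNIV. \<Sum>j\<in>UNIV. \<Sum>k\<in>UNIV. ?t i j k)"
    by (subst (2) sum.swap, subst sum.swap) (rule refl)
  also have "\<dots> = (\<Sum>i\<in>UNIV. u $ i * (V (i+1) (i+3) - V (i+3) (i+1)) + u $ (i+1) * (V (i+3) i - V i (i+3))
      + u $ (i+3) * (V i (i+1) - V (i+1) i))"
  proof (rule sum.cong[OF refl])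
    fix i :: 7
    have *: "(\<Sum>j\<in>UNIV. \<Sum>k\<in>UNIV. (if j = a then if k = b then f j k else 0 else 0)) = f a b"
      for a b :: 7 and f :: "7 \<Rightarrow> 7 \<Rightarrow> real"
    proof -
      have "(\<Sum>k\<in>UNIV. (if j = a then if k = b then f j k else 0 else 0)) = (if j = a then f a b else 0)" for j
        by simp
      then show ?thesis by simp
    qed
    show "(\<Sum>j\<in>UNIV. \<Sum>k\<in>UNIV. ?t i j k) =
      u $ i * (V (i+1) (i+3) - V (i+3) (i+1)) + u $ (i+1) * (V (i+3) i - V i (i+3))
      + u $ (i+3) * (V i (i+1) - V (i+1) i)"
      unfolding sum.distrib sum_subtractf * by (simp add: algebra_simps)
  qed
  finally show ?thesis .
qed

text \<open>The contraction identity from which the constants in \<open>trace_k\<close> and in the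
  value of \<open>eta\<close> descend.\<close>

lemma phi0_axis_sum_star0:
  "(\<Sum>j\<in>UNIV. \<Sum>k\<in>UNIV. phi0 u (axis j 1) (axis k 1) * star0 v w (axis j 1) (axis k 1)) = - 4 * phi0 u v w"
  unfolding sum_phi0_axis sum_7 num_7 add_0 phi0_expand star0_expand
  by (simp add: axis_def) algebra

lemma cross0_e0_e0: "x $ 0 = 0 \<Longrightarrow> cross0 e0 (cross0 e0 x) = - x"
  unfolding vec_eq_iff forall_7 by (simp add: cross0_nth)

lemma cross0_e0_nth0 [simp]: "cross0 e0 x $ 0 = 0"
  by (simp add: cross0_nth)

lemma cross0_e0_inner: "x $ 0 = 0 \<Longrightarrow> cross0 e0 x \<bullet> cross0 e0 y = x \<bullet> y"
  by (simp add: cross0_nth inner_7)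

lemma phi0_cross0_e0: "x $ 0 = 0 \<Longrightarrow> y $ 0 = 0 \<Longrightarrow> z $ 0 = 0 \<Longrightarrow>
   phi0 x (cross0 e0 y) z = phi0 (cross0 e0 x) y z"
  by (simp add: cross0_nth phi0_expand algebra_simps)

text \<open>With \<open>e0\<close> as the normal, this turns minus the contracted dual form into
  \<open>phi0\<close> composed with the complex structure, which is the shape of
  \<open>psi_plus\<close> for \<theta> = pi / 2.\<close>

lemma star0_e0: "x $ 0 = 0 \<Longrightarrow> y $ 0 = 0 \<Longrightarrow> z $ 0 = 0 \<Longrightarrow>
   star0 e0 x y z = - phi0 (cross0 e0 x) y z"
  by (simp add: cross0_nth phi0_expand star0_expand algebra_simps)

lemma star0_e0_e0 [simp]: "star0 e0 e0 y z = 0" "star0 e0 x e0 z = 0" "star0 e0 x y e0 = 0"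
  by (simp_all add: star0_expand)

text \<open>Splits the contribution of type X4 to the derivative of \<omega>: the normal component
  of \<open>p\<close> gives a multiple of \<open>phi0\<close>, hence a W1 term, and the tangential
  components give an expression of W4 shape.\<close>

lemma star0_cross0_e0:
  assumes "x $ 0 = 0" "y $ 0 = 0" "z $ 0 = 0"
  shows "star0 (cross0 p x) e0 y z = - p $ 0 * phi0 x y z
    - (x \<bullet> y) * (p \<bullet> cross0 e0 z) + (x \<bullet> z) * (p \<bullet> cross0 e0 y)
    - (x \<bullet> cross0 e0 y) * (p \<bullet> z) + (x \<bullet> cross0 e0 z) * (p \<bullet> y)"
  by (simp add: assms cross0_nth phi0_expand star0_expand inner_7) algebra

text \<open>Subtracting the \<open>e0\<close> term restricts the sum to the tangent space. There
  \<open>phi0\<close> is the real part of a complex volume form, which accounts for the terms with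
  \<open>cross0 e0\<close>.\<close>

lemma phi0_axis_sum_phi0':
  assumes "u $ 0 = 0" "x $ 0 = 0" "y $ 0 = 0" "v $ 0 = 0"
  shows "(\<Sum>k\<in>UNIV. phi0 u x (axis k 1) * phi0 y v (axis k 1)) - phi0 u x e0 * phi0 y v e0 =
     (u \<bullet> y) * (x \<bullet> v) - (u \<bullet> v) * (x \<bullet> y)
     - (u \<bullet> cross0 e0 y) * (x \<bullet> cross0 e0 v) + (u \<bullet> cross0 e0 v) * (x \<bullet> cross0 e0 y)"
  unfolding sum_7
  by (simp add: assms phi0_expand cross0_nth inner_7, simp add: axis_def) algebra

section \<open>Linear maps and traces in orthonormal bases\<close>

lemmas linear_simps = linear_add linear_scale

lemma linear_axis_expand:
  fixes f :: "real^'n \<Rightarrow> 'w::real_vector"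
  assumes "linear f"
  shows "f x = (\<Sum>j\<in>UNIV. x $ j *\<^sub>R f (axis j 1))"
proof -
  have "f x = f (\<Sum>j\<in>UNIV. x $ j *\<^sub>R axis j 1)"
    by (simp add: basis_expansion flip: scalar_mult_eq_scaleR)
  also have "\<dots> = (\<Sum>j\<in>UNIV. x $ j *\<^sub>R f (axis j 1))"
    by (simp add: linear_sum[OF assms] linear_scale[OF assms] o_def)
  finally show ?thesis .
qed

text \<open>Pairing with \<open>e j\<close> recovers the coefficients of a combination, so the
  vectors are independent and span by dimension.\<close>

lemma orthonormal_expand:
  fixes e :: "'n::finite \<Rightarrow> real^'n"
  assumes lin: "\<And>y. linear (\<lambda>x. g x y)"
    and on: "\<And>i j. g (e i) (e j) = (if i = j then 1 else (0::real))"
  shows "x = (\<Sum>i\<in>UNIV. g x (e i) *\<^sub>R e i)"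
proof -
  define f where "f c = (\<Sum>i\<in>UNIV. c $ i *\<^sub>R e i)" for c :: "real^'n"
  have linf: "linear f"
    by (auto intro!: linearI simp: f_def algebra_simps sum.distrib scaleR_sum_right)
  have gf: "g (f c) (e j) = c $ j" for c j
    unfolding f_def linear_sum[OF lin] linear_scale[OF lin] on by (simp add: if_distrib cong: if_cong)
  have "inj f"
    by (rule injI) (metis gf vec_eq_iff)
  then have "surj f" using linear_injective_imp_surjective[OF linf] by blast
  then obtain c where "x = f c" by blast
  then show ?thesis using gf[of c] by (simp add: f_def)
qed

text \<open>The definitions take traces in a basis picked by \<open>SOME\<close>; this puts any
  other orthonormal basis in its place.\<close>

lemma trace_orthonormal_eq:
  fixes e e' :: "'n::finite \<Rightarrow> real^'n"
  assumes b: "bilinear b" and lin: "\<And>y. linear (\<lambda>x. g x y)" and sym: "\<And>x y. g x y = g y x"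
    and on: "\<And>i j. g (e i) (e j) = (if i = j then 1 else (0::real))"
    and on': "\<And>i j. g (e' i) (e' j) = (if i = j then 1 else (0::real))"
  shows "(\<Sum>i\<in>UNIV. b (e i) (e i)) = (\<Sum>i\<in>UNIV. b (e' i) (e' i) :: real)"
proof -
  have l: "linear (\<lambda>x. b x y)" and r: "linear (b x)" for x y
    using b by (auto simp: bilinear_def)
  have "b (e i) (e i) = (\<Sum>j\<in>UNIV. g (e i) (e' j) * b (e' j) (e i))" for i
    by (subst orthonormal_expand[OF lin on', of "e i"]) (simp add: linear_sum[OF l] linear_scale[OF l])
  moreover have "b (e' j) (e' j) = (\<Sum>i\<in>UNIV. g (e' j) (e i) * b (e' j) (e i))" for j
    by (subst (2) orthonormal_expand[OF lin on, of "e' j"]) (simp add: linear_sum[OF r] linear_scale[OF r])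
  ultimately show ?thesis
    by (simp add: sym[of "e' _"]) (rule sum.swap)
qed

text \<open>In so(7) = g2 + R^7 the g2 part annihilates \<open>phi0\<close>, and contraction with
  \<open>phi0\<close> extracts the vector \<open>w\<close> of the other part. The case of
  \<open>e0\<close> in the first slot is the one that enters the derivative of \<omega>.\<close>

lemma skew_act_phi0_e0:
  assumes lin: "linear k" and skew: "\<And>x y. k x \<bullet> y = - (x \<bullet> k y)"
    and w: "\<And>v. 2 * (w \<bullet> v) = (\<Sum>i\<in>UNIV. phi0 (k (axis i 1)) v (axis i 1))"
  shows "phi0 (k e0) y z + phi0 e0 (k y) z + phi0 e0 y (k z) = - star0 w e0 y z"
proof -
  define K where "K i j = k (axis j 1) $ i" for i j
  have k: "k x $ i = (\<Sum>j\<in>UNIV. K i j * x $ j)" for x i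
    unfolding K_def by (subst linear_axis_expand[OF lin]) (simp add: mult.commute)
  have KK: "K j i = - K i j" for i j
    using skew[of "axis i 1" "axis j 1"] by (simp add: K_def inner_axis inner_axis')
  have K0: "K i i = 0" for i using KK[of i i] by simp
  have KO: "K 1 0 = - K 0 1" "K 2 0 = - K 0 2" "K 3 0 = - K 0 3" "K 4 0 = - K 0 4" "K 5 0 = - K 0 5" "K 6 0 = - K 0 6"
    "K 2 1 = - K 1 2" "K 3 1 = - K 1 3" "K 4 1 = - K 1 4" "K 5 1 = - K 1 5" "K 6 1 = - K 1 6"
    "K 3 2 = - K 2 3" "K 4 2 = - K 2 4" "K 5 2 = - K 2 5" "K 6 2 = - K 2 6"
    "K 4 3 = - K 3 4" "K 5 3 = - K 3 5" "K 6 3 = - K 3 6"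
    "K 5 4 = - K 4 5" "K 6 4 = - K 4 6" "K 6 5 = - K 5 6"
    by (rule KK)+
  have kax: "k (axis j 1) $ i = K i j" for i j by (simp add: K_def)
  have w': "2 * w $ l = (\<Sum>i\<in>UNIV. phi0 (k (axis i 1)) (axis l 1) (axis i 1))" for l
    using w[of "axis l 1"] by (simp add: inner_axis)
  have axn: "axis i 1 $ j = (if j = i then 1 else (0::real))" for i j :: 7 by (simp add: axis_def)
  \<comment> \<open>Each component of \<open>w\<close> collects the three entries of
    \<open>K\<close> at the pairs that form a line with its index.\<close>
  have w0: "w $ 0 = - K 1 3 - K 2 6 - K 4 5"
    using w'[of 0] unfolding sum_7 phi0_expand kax axn by (simp add: K0 KO)
  have w1: "w $ 1 = - K 2 4 + K 0 3 - K 5 6"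
    using w'[of 1] unfolding sum_7 phi0_expand kax axn by (simp add: K0 KO)
  have w2: "w $ 2 = - K 3 5 + K 1 4 + K 0 6"
    using w'[of 2] unfolding sum_7 phi0_expand kax axn by (simp add: K0 KO)
  have w3: "w $ 3 = - K 4 6 + K 2 5 - K 0 1"
    using w'[of 3] unfolding sum_7 phi0_expand kax axn by (simp add: K0 KO)
  have w4: "w $ 4 = K 0 5 + K 3 6 - K 1 2"
    using w'[of 4] unfolding sum_7 phi0_expand kax axn by (simp add: K0 KO)
  have w5: "w $ 5 = K 1 6 - K 0 4 - K 2 3"
    using w'[of 5] unfolding sum_7 phi0_expand kax axn by (simp add: K0 KO)
  have w6: "w $ 6 = - K 0 2 - K 1 5 - K 3 4"
    using w'[of 6] unfolding sum_7 phi0_expand kax axn by (simp add: K0 KO)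
  show ?thesis
    unfolding phi0_expand star0_expand k sum_7 w0 w1 w2 w3 w4 w5 w6
    by (simp only: K0 KO e0_nth) algebra
qed

text \<open>In the complex coordinates (1, 3), (2, 6), (4, 5) for \<open>cross0 e0\<close>, such an
  \<open>M\<close> is a Hermitian 3-by-3 matrix: real diagonal \<open>a\<close>, \<open>b\<close>,
  \<open>c\<close> and three complex entries off it. The real trace on the tangent space is twice
  the complex one.\<close>

lemma hermitian_coords:
  assumes lin: "linear M"
    and sym: "\<And>x y. x $ 0 = 0 \<Longrightarrow> y $ 0 = 0 \<Longrightarrow> M x \<bullet> y = x \<bullet> M y"
    and com: "\<And>x. x $ 0 = 0 \<Longrightarrow> M (cross0 e0 x) = cross0 e0 (M x)"
  obtains a b c d d' f f' h h' where
    "\<And>x. x $ 0 = 0 \<Longrightarrow> M x $ 1 = a * x$1 + d * x$2 + d' * x$6 + f * x$4 + f' * x$5"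
    "\<And>x. x $ 0 = 0 \<Longrightarrow> M x $ 3 = a * x$3 + d * x$6 - d' * x$2 + f * x$5 - f' * x$4"
    "\<And>x. x $ 0 = 0 \<Longrightarrow> M x $ 2 = b * x$2 + d * x$1 - d' * x$3 + h * x$4 + h' * x$5"
    "\<And>x. x $ 0 = 0 \<Longrightarrow> M x $ 6 = b * x$6 + d * x$3 + d' * x$1 + h * x$5 - h' * x$4"
    "\<And>x. x $ 0 = 0 \<Longrightarrow> M x $ 4 = c * x$4 + f * x$1 - f' * x$3 + h * x$2 - h' * x$6"
    "\<And>x. x $ 0 = 0 \<Longrightarrow> M x $ 5 = c * x$5 + f * x$3 + f' * x$1 + h * x$6 + h' * x$2"
    "(\<Sum>i\<in>UNIV. M (axis i 1) $ i) = M e0 $ 0 + 2 * (a + b + c)"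
proof -
  define m where "m i j = M (axis j 1) $ i" for i j
  have M: "M x $ i = m i 1 * x$1 + m i 2 * x$2 + m i 3 * x$3 + m i 4 * x$4 + m i 5 * x$5 + m i 6 * x$6"
    if "x $ 0 = 0" for x i
    unfolding m_def by (subst linear_axis_expand[OF lin]) (simp add: mult.commute sum_7 that)
  have s: "m j i = m i j" if "i \<noteq> 0" "j \<noteq> 0" for i j
  proof -
    have "axis i 1 $ 0 = (0::real)" "axis j 1 $ 0 = (0::real)" using that by (simp_all add: axis_def)
    then show ?thesis using sym[of "axis i 1" "axis j 1"] by (simp add: m_def inner_axis inner_axis')
  qed
  have s': "m 2 1 = m 1 2" "m 3 1 = m 1 3" "m 4 1 = m 1 4" "m 5 1 = m 1 5" "m 6 1 = m 1 6"
    "m 3 2 = m 2 3" "m 4 2 = m 2 4" "m 5 2 = m 2 5" "m 6 2 = m 2 6"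
    "m 4 3 = m 3 4" "m 5 3 = m 3 5" "m 6 3 = m 3 6" "m 5 4 = m 4 5" "m 6 4 = m 4 6" "m 6 5 = m 5 6"
    by (rule s; simp)+
  \<comment> \<open>The three lines through 0 pair the tangential basis vectors into complex
    lines.\<close>
  have ax: "cross0 e0 (axis 1 1) = axis 3 1" "cross0 e0 (axis 2 1) = axis 6 1" "cross0 e0 (axis 4 1) = axis 5 1"
    unfolding vec_eq_iff forall_7 by (simp_all add: cross0_nth, simp_all add: axis_def)
  have axis_0: "axis (1::7) 1 $ 0 = (0::real)" "axis (2::7) 1 $ 0 = (0::real)" "axis (4::7) 1 $ 0 = (0::real)"
    by (simp_all add: axis_def)
  have c: "m i 3 = cross0 e0 (M (axis 1 1)) $ i" "m i 6 = cross0 e0 (M (axis 2 1)) $ i" "m i 5 = cross0 e0 (M (axis 4 1)) $ i"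
    for i
    using com[of "axis 1 1"] com[of "axis 2 1"] com[of "axis 4 1"] by (simp_all add: m_def ax axis_0)
  have J: "m 3 3 = m 1 1" "m 6 6 = m 2 2" "m 5 5 = m 4 4" "m 1 3 = 0" "m 2 6 = 0" "m 4 5 = 0"
    "m 3 6 = m 1 2" "m 2 3 = - m 1 6" "m 3 5 = m 1 4" "m 3 4 = - m 1 5" "m 5 6 = m 2 4" "m 4 6 = - m 2 5"
    subgoal using c(1)[of 3] by (simp add: cross0_nth m_def)
    subgoal using c(2)[of 6] by (simp add: cross0_nth m_def)
    subgoal using c(3)[of 5] by (simp add: cross0_nth m_def)
    subgoal using c(1)[of 1] s'(2) by (simp add: cross0_nth m_def)
    subgoal using c(2)[of 2] s'(9) by (simp add: cross0_nth m_def)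
    subgoal using c(3)[of 4] s'(13) by (simp add: cross0_nth m_def)
    subgoal using c(2)[of 3] s'(1) by (simp add: cross0_nth m_def)
    subgoal using c(1)[of 2] s'(5) by (simp add: cross0_nth m_def)
    subgoal using c(3)[of 3] s'(3) by (simp add: cross0_nth m_def)
    subgoal using c(1)[of 4] s'(4) s'(10) by (simp add: cross0_nth m_def)
    subgoal using c(2)[of 5] s'(7) by (simp add: cross0_nth m_def)
    subgoal using c(2)[of 4] s'(8) by (simp add: cross0_nth m_def)
    done
  show thesis
    by (rule that[of "m 1 1" "m 1 2" "m 1 6" "m 1 4" "m 1 5" "m 2 2" "m 2 4" "m 2 5" "m 4 4"])
      (simp_all add: M s' J, simp_all add: sum_7 m_def[symmetric] J)
qed

text \<open>The cyclic sum is the derivation by \<open>M\<close> of the real part of the complex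
  volume form. A complex linear map acts on that form as multiplication by its complex trace, here
  \<open>a + b + c\<close>, which \<open>tr\<close> makes zero.\<close>

lemma hermitian_cyclic_phi0:
  assumes lin: "linear M" and tan: "\<And>x. x $ 0 = 0 \<Longrightarrow> M x $ 0 = 0"
    and sym: "\<And>x y. x $ 0 = 0 \<Longrightarrow> y $ 0 = 0 \<Longrightarrow> M x \<bullet> y = x \<bullet> M y"
    and com: "\<And>x. x $ 0 = 0 \<Longrightarrow> M (cross0 e0 x) = cross0 e0 (M x)"
    and tr: "(\<Sum>i\<in>UNIV. M (axis i 1) $ i) = M e0 $ 0"
    and xyz: "x $ 0 = 0" "y $ 0 = 0" "z $ 0 = 0"
  shows "phi0 (M x) y z + phi0 (M y) z x + phi0 (M z) x y = 0"
proof (rule hermitian_coords[OF lin sym com])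
  fix a b c d d' f f' h h' :: real
  assume M: "\<And>x. x $ 0 = 0 \<Longrightarrow> M x $ 1 = a * x$1 + d * x$2 + d' * x$6 + f * x$4 + f' * x$5"
    "\<And>x. x $ 0 = 0 \<Longrightarrow> M x $ 3 = a * x$3 + d * x$6 - d' * x$2 + f * x$5 - f' * x$4"
    "\<And>x. x $ 0 = 0 \<Longrightarrow> M x $ 2 = b * x$2 + d * x$1 - d' * x$3 + h * x$4 + h' * x$5"
    "\<And>x. x $ 0 = 0 \<Longrightarrow> M x $ 6 = b * x$6 + d * x$3 + d' * x$1 + h * x$5 - h' * x$4"
    "\<And>x. x $ 0 = 0 \<Longrightarrow> M x $ 4 = c * x$4 + f * x$1 - f' * x$3 + h * x$2 - h' * x$6"
    "\<And>x. x $ 0 = 0 \<Longrightarrow> M x $ 5 = c * x$5 + f * x$3 + f' * x$1 + h * x$6 + h' * x$2"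
    "(\<Sum>i\<in>UNIV. M (axis i 1) $ i) = M e0 $ 0 + 2 * (a + b + c)"
  have c: "c = - a - b" using M(7) tr by simp
  show ?thesis unfolding phi0_expand by (simp add: M(1-6) tan xyz c) algebra
qed

text \<open>Tested on basis triples, a repeated index isolates one off-diagonal entry, and
  exchanging two indices of a line compares two diagonal entries.\<close>

lemma hermitian_skew_phi0:
  assumes lin: "linear M" and tan: "\<And>x. x $ 0 = 0 \<Longrightarrow> M x $ 0 = 0"
    and sym: "\<And>x y. x $ 0 = 0 \<Longrightarrow> y $ 0 = 0 \<Longrightarrow> M x \<bullet> y = x \<bullet> M y"
    and com: "\<And>x. x $ 0 = 0 \<Longrightarrow> M (cross0 e0 x) = cross0 e0 (M x)"
    and skew: "\<And>x y z. x $ 0 = 0 \<Longrightarrow> y $ 0 = 0 \<Longrightarrow> z $ 0 = 0 \<Longrightarrow> phi0 (M x) y z = - phi0 (M y) x z"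
  obtains t where "\<And>x. x $ 0 = 0 \<Longrightarrow> M x = t *\<^sub>R x"
proof (rule hermitian_coords[OF lin sym com])
  fix a b c d d' f f' h h' :: real
  assume M: "\<And>x. x $ 0 = 0 \<Longrightarrow> M x $ 1 = a * x$1 + d * x$2 + d' * x$6 + f * x$4 + f' * x$5"
    "\<And>x. x $ 0 = 0 \<Longrightarrow> M x $ 3 = a * x$3 + d * x$6 - d' * x$2 + f * x$5 - f' * x$4"
    "\<And>x. x $ 0 = 0 \<Longrightarrow> M x $ 2 = b * x$2 + d * x$1 - d' * x$3 + h * x$4 + h' * x$5"
    "\<And>x. x $ 0 = 0 \<Longrightarrow> M x $ 6 = b * x$6 + d * x$3 + d' * x$1 + h * x$5 - h' * x$4"
    "\<And>x. x $ 0 = 0 \<Longrightarrow> M x $ 4 = c * x$4 + f * x$1 - f' * x$3 + h * x$2 - h' * x$6"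
    "\<And>x. x $ 0 = 0 \<Longrightarrow> M x $ 5 = c * x$5 + f * x$3 + f' * x$1 + h * x$6 + h' * x$2"
    "(\<Sum>i\<in>UNIV. M (axis i 1) $ i) = M e0 $ 0 + 2 * (a + b + c)"
  have s: "phi0 (M (axis i 1)) (axis j 1) (axis k 1) = - phi0 (M (axis j 1)) (axis i 1) (axis k 1)"
    if "i \<noteq> 0" "j \<noteq> 0" "k \<noteq> 0" for i j k :: 7
    by (rule skew) (use that in \<open>simp_all add: axis_def\<close>)
  have axn: "axis i 1 $ j = (if j = i then 1 else (0::real))" for i j :: 7 by (simp add: axis_def)
  have z1: "d = 0"
    using s[of 1 1 4] unfolding phi0_expand axn by (simp add: M(1-6) tan axn)
  have z2: "d' = 0"
    using s[of 1 1 5] unfolding phi0_expand axn by (simp add: M(1-6) tan axn)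
  have z3: "f = 0"
    using s[of 1 1 2] unfolding phi0_expand axn by (simp add: M(1-6) tan axn)
  have z4: "f' = 0"
    using s[of 1 1 6] unfolding phi0_expand axn by (simp add: M(1-6) tan axn)
  have z5: "h = 0"
    using s[of 2 2 1] unfolding phi0_expand axn by (simp add: M(1-6) tan axn)
  have z6: "h' = 0"
    using s[of 2 2 3] unfolding phi0_expand axn by (simp add: M(1-6) tan axn)
  have z7: "b = a"
    using s[of 1 2 4] unfolding phi0_expand axn by (simp add: M(1-6) tan axn)
  have z8: "c = a"
    using s[of 1 4 2] unfolding phi0_expand axn by (simp add: M(1-6) tan axn)
  have "M x = a *\<^sub>R x" if "x $ 0 = 0" for x
    unfolding vec_eq_iff forall_7 using that by (simp add: M(1-6) tan z1 z2 z3 z4 z5 z6 z7 z8)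
  then show ?thesis by (rule that)
qed

lemma sum_lists_length_0: "(\<Sum>is | length is = 0. f is) = f []"
proof -
  have "{is :: 'a list. length is = 0} = {[]}" by auto
  then show ?thesis by simp
qed

lemma sum_lists_length_Suc:
  fixes f :: "'i::finite list \<Rightarrow> 'w::comm_monoid_add"
  shows "(\<Sum>is | length is = Suc n. f is) = (\<Sum>i\<in>UNIV. \<Sum>is | length is = n. f (i # is))"
proof -
  have fin: "finite {is :: 'i list. length is = n}"
    using finite_lists_length_eq[of "UNIV :: 'i set" n] by simp
  have "{is :: 'i list. length is = Suc n} = (\<lambda>(i, is). i # is) ` (UNIV \<times> {is. length is = n})"
    by (auto simp: length_Suc_conv image_iff)
  then have "(\<Sum>is | length is = Suc n. f is) = (\<Sum>(i, is)\<in>UNIV \<times> {is. length is = n}. f (i # is))"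
    by (simp add: sum.reindex inj_on_def case_prod_beta' o_def)
  then show ?thesis by (simp add: sum.cartesian_product)
qed

lemma phi0_cross0_e0': "x $ 0 = 0 \<Longrightarrow> y $ 0 = 0 \<Longrightarrow> z $ 0 = 0 \<Longrightarrow>
   phi0 x y (cross0 e0 z) = phi0 (cross0 e0 x) y z"
  using phi0_cross0_e0[of z x y] phi0_cycle[where x="cross0 e0 z" and y=x and z=y]
    phi0_cycle[where x=z and y="cross0 e0 x" and z=y] by simp

lemma phi0_swap': "phi0 x z y = - phi0 x y z"
  by (simp add: phi0_expand algebra_simps)

section \<open>Torsion at a point\<close>

text \<open>\<open>T\<close> is the differential of \<open>\<iota>\<close> in the coordinates of an adapted frame with \<open>e\<^sub>0 = n\<close>; \<open>A\<close> is the
  shape operator and \<open>P\<close> the vector \<open>p\<^sub>\<phi>\<close> in these coordinates.\<close>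

locale hypersurface_point =
  fixes S :: "'b su3" and c :: "('b, 6) chart" and p :: 'b and \<epsilon> :: parity
    and T A :: "real^6 \<Rightarrow> real^7" and P :: "real^7"
  assumes linT: "linear T" and injT: "inj T" and T0 [simp]: "T x $ 0 = 0"
    and surjT: "v $ 0 = 0 \<Longrightarrow> \<exists>x. v = T x"
    and met: "met S c p [x, y] = T x \<bullet> T y"
    and acs: "T (acs S c p x) = cross0 e0 (T x)"
    and psi_plus: "psi_plus S c p [x, y, z] =
      phi0 (case \<epsilon> of Plus \<Rightarrow> T x | Minus \<Rightarrow> cross0 e0 (T x)) (T y) (T z)"
    and linA: "linear A" and A0 [simp]: "A x $ 0 = 0" and symA: "A x \<bullet> T y = T x \<bullet> A y"
    and nabla_omega: "nabla_omega S c p x y z =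
      phi0 (A x) (T y) (T z) + star0 (cross0 P (T x)) e0 (T y) (T z) / 12"
begin

section \<open>The complex structure and traces over the tangent space\<close>

abbreviation "J \<equiv> cross0 e0"
abbreviation "I \<equiv> acs S c p"
abbreviation "ob \<equiv> onb S c p"

lemma cross0_e0_skew: "cross0 e0 x \<bullet> y = - (x \<bullet> cross0 e0 y)"
  by (simp add: cross0_nth inner_7)

lemma linear_J: "linear J"
  by (auto intro!: linearI simp: cross0_add cross0_scale)

lemma I_I: "I (I x) = - x"
  by (rule injD[OF injT]) (simp add: acs cross0_e0_e0 linear_neg[OF linT])

lemma linear_I: "linear I"
  by (rule linearI; rule injD[OF injT])
    (simp_all add: acs linear_simps[OF linT] cross0_add cross0_scale)

text \<open>The choice in \<open>onb\<close> needs an orthonormal basis to exist; one is obtained by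
  pulling back the six basis vectors other than \<open>e0\<close> along \<open>T\<close>.\<close>

lemma orthonormal_onb: "T (ob i) \<bullet> T (ob j) = (if i = j then 1 else 0)"
proof -
  have "card (UNIV :: 6 set) = card (UNIV - {0 :: 7})" by simp
  then obtain h :: "6 \<Rightarrow> 7" where h: "bij_betw h UNIV (UNIV - {0})"
    using finite_same_card_bij[of "UNIV :: 6 set" "UNIV - {0 :: 7}"] by auto
  then have "axis (h i) (1::real) $ 0 = 0" for i
    by (auto simp: axis_def bij_betw_def)
  then have "\<forall>i. \<exists>x. axis (h i) 1 = T x" using surjT by blast
  then obtain e where e: "\<And>i. T (e i) = axis (h i) 1" by metis
  have "h i = h j \<longleftrightarrow> i = j" for i j
    using h by (auto simp: bij_betw_def inj_on_def)
  then have "orthonormal S c p e"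
    by (simp add: orthonormal_def met e inner_axis_axis)
  then have "orthonormal S c p ob" unfolding onb_def by (rule someI[of "orthonormal S c p"])
  then show ?thesis by (simp add: orthonormal_def met)
qed

lemma linear_inner_T: "linear (\<lambda>x. T x \<bullet> T y)"
  by (auto intro!: linearI simp: linear_simps[OF linT] inner_add_left)

lemma expand_onb: "x = (\<Sum>i\<in>UNIV. (T x \<bullet> T (ob i)) *\<^sub>R ob i)"
  by (rule orthonormal_expand[where g="\<lambda>x y. T x \<bullet> T y"]) (simp_all add: linear_inner_T orthonormal_onb)

lemma tangent_expand: "v = (\<Sum>i\<in>UNIV. (v \<bullet> T (ob i)) *\<^sub>R T (ob i))" if "v $ 0 = 0"
proof -
  from surjT[OF that] obtain x where v: "v = T x" by blast
  show ?thesis unfolding v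
    by (subst expand_onb[of x]) (simp add: linear_sum[OF linT] linear_scale[OF linT])
qed

lemma linear_onb_expand: "linear f \<Longrightarrow> f x = (\<Sum>i\<in>UNIV. (T x \<bullet> T (ob i)) * f (ob i))" for f :: "_ \<Rightarrow> real"
  by (subst expand_onb[of x]) (simp add: linear_sum linear_scale)

lemma inner_onb_sum:
  assumes "u $ 0 = 0" shows "(\<Sum>i\<in>UNIV. (u \<bullet> T (ob i)) * (T (ob i) \<bullet> v)) = u \<bullet> v"
proof -
  have "(\<Sum>i\<in>UNIV. (u \<bullet> T (ob i)) * (T (ob i) \<bullet> v)) = (\<Sum>i\<in>UNIV. (u \<bullet> T (ob i)) *\<^sub>R T (ob i)) \<bullet> v"
    by (simp add: inner_sum_left)
  then show ?thesis using tangent_expand[OF assms] by simp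
qed

text \<open>Turns traces over the tangent space into traces over the standard basis of R^7, where
  the coordinate identities for \<open>phi0\<close> apply.\<close>

lemma trace_onb:
  assumes "bilinear b"
  shows "(\<Sum>i\<in>UNIV. b (T (ob i)) (T (ob i))) = (\<Sum>a\<in>UNIV. b (axis a 1) (axis a 1)) - (b e0 e0 :: real)"
proof -
  have l: "linear (\<lambda>x. b x y)" and r: "linear (b x)" for x y
    using assms by (auto simp: bilinear_def)
  have v: "v = (\<Sum>i\<in>UNIV. (v \<bullet> T (ob i)) *\<^sub>R T (ob i)) + (v $ 0) *\<^sub>R e0" for v
  proof -
    have "v - (v $ 0) *\<^sub>R e0 = (\<Sum>i\<in>UNIV. ((v - (v $ 0) *\<^sub>R e0) \<bullet> T (ob i)) *\<^sub>R T (ob i))"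
      by (rule tangent_expand) simp
    also have "\<dots> = (\<Sum>i\<in>UNIV. (v \<bullet> T (ob i)) *\<^sub>R T (ob i))"
      by (simp add: inner_diff_left inner_axis')
    finally show ?thesis by (simp add: algebra_simps)
  qed
  have "b (axis a 1) (axis a 1) = (\<Sum>i\<in>UNIV. T (ob i) $ a * b (T (ob i)) (axis a 1)) + (axis a 1 $ 0) * b e0 (axis a 1)" for a :: 7
    by (subst v[of "axis a 1"])
      (simp add: linear_add[OF l] linear_sum[OF l] linear_scale[OF l] inner_axis')
  then have "(\<Sum>a\<in>UNIV. b (axis a 1) (axis a 1)) =
    (\<Sum>i\<in>UNIV. \<Sum>a\<in>UNIV. T (ob i) $ a * b (T (ob i)) (axis a 1)) + (\<Sum>a\<in>UNIV. (axis a 1 $ 0) * b e0 (axis a 1))"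
    by (simp add: sum.distrib) (rule sum.swap)
  moreover have "(\<Sum>a\<in>UNIV. (axis a 1 $ (0::7)) * b e0 (axis a 1)) = b e0 e0"
  proof -
    have "(axis a 1 $ 0) * b e0 (axis a 1) = (if a = 0 then b e0 e0 else 0)" for a :: 7
      by (simp add: axis_def)
    then show ?thesis by simp
  qed
  moreover have "b (T (ob i)) (T (ob i)) = (\<Sum>a\<in>UNIV. T (ob i) $ a * b (T (ob i)) (axis a 1))" for i
    by (subst linear_axis_expand[OF r]) simp
  ultimately show ?thesis by simp
qed

lemma trace_I:
  assumes "bilinear b" shows "(\<Sum>i\<in>UNIV. b (I (ob i)) (I (ob i))) = (\<Sum>i\<in>UNIV. b (ob i) (ob i) :: real)"
  by (rule trace_orthonormal_eq[OF assms linear_inner_T inner_commute])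
    (simp_all add: orthonormal_onb acs cross0_e0_inner)

text \<open>The 4 arises as 6 - 1 - 1: the trace of the identity, reduced by the projections onto
  \<open>x\<close> and onto \<open>J x\<close>.\<close>

lemma contract_phi0:
  assumes "u $ 0 = 0" "v $ 0 = 0"
  shows "(\<Sum>i\<in>UNIV. \<Sum>j\<in>UNIV. phi0 u (T (ob i)) (T (ob j)) * phi0 v (T (ob i)) (T (ob j))) = 4 * (u \<bullet> v)"
proof -
  have *: "(\<Sum>j\<in>UNIV. phi0 u x (T (ob j)) * phi0 v x (T (ob j))) =
      (u \<bullet> v) * (x \<bullet> x) - (u \<bullet> x) * (x \<bullet> v) - (u \<bullet> J v) * (x \<bullet> J x) + (u \<bullet> J x) * (x \<bullet> J v)"
    if "x $ 0 = 0" for x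
  proof -
    have "bilinear (\<lambda>y z. phi0 u x y * phi0 v x z)"
      by (auto simp: bilinear_def intro!: linearI simp: phi0_add phi0_scale algebra_simps)
    from trace_onb[OF this] show ?thesis
      using phi0_axis_sum_phi0'[of u x v x] assms that by simp
  qed
  have J0: "x \<bullet> J x = 0" for x using cross0_e0_skew[of x x] by (simp add: inner_commute)
  have "(\<Sum>i\<in>UNIV. (u \<bullet> J (T (ob i))) * (T (ob i) \<bullet> J v)) = - (\<Sum>i\<in>UNIV. (J u \<bullet> T (ob i)) * (T (ob i) \<bullet> J v))"
    by (simp add: cross0_e0_skew sum_negf)
  also have "\<dots> = - (u \<bullet> v)" by (subst inner_onb_sum) (simp_all add: assms cross0_e0_inner)
  finally show ?thesis
    by (simp add: * J0 orthonormal_onb sum.distrib sum_subtractf inner_onb_sum assms)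
qed

lemma phi0_nondegenerate:
  assumes "u $ 0 = 0" "\<And>y z. phi0 u (T y) (T z) = 0" shows "u = 0"
  using contract_phi0[of u u] assms by simp

text \<open>The map r recovers the endomorphism behind the tensor, since the 4 of
  \<open>contract_phi0\<close> cancels 2! and the 1/2 in \<open>r_form\<close>. Parity thus becomes
  symmetry or skew symmetry of a bilinear form built from \<open>C\<close>.\<close>

lemma r_form_phi0:
  assumes "\<And>x. C x $ 0 = 0"
  shows "r_form S c p (\<lambda>x y z. phi0 (C x) (T y) (T z)) x y = C x \<bullet> (case \<epsilon> of Plus \<Rightarrow> T y | Minus \<Rightarrow> J (T y))"
proof -
  have "(\<Sum>is | length is = 2. phi0 (C x) (T (map ob is ! 0)) (T (map ob is ! 1)) * psi_plus S c p (y # map ob is)) =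
    (\<Sum>i\<in>UNIV. \<Sum>j\<in>UNIV. phi0 (C x) (T (ob i)) (T (ob j)) *
      phi0 (case \<epsilon> of Plus \<Rightarrow> T y | Minus \<Rightarrow> J (T y)) (T (ob i)) (T (ob j)))"
    by (simp add: numeral_2_eq_2 sum_lists_length_Suc sum_lists_length_0[simplified] psi_plus)
  also have "\<dots> = 4 * (C x \<bullet> (case \<epsilon> of Plus \<Rightarrow> T y | Minus \<Rightarrow> J (T y)))"
    by (rule contract_phi0) (simp_all add: assms split: parity.split)
  finally show ?thesis
    by (simp add: r_form_def form_inner_def)
qed

section \<open>The Gray-Hervella modules and their behaviour under I\<close>

lemma gh_space_phi0:
  assumes "linear C" "\<And>x. C x $ 0 = 0"
  shows "(\<lambda>x y z. phi0 (C x) (T y) (T z)) \<in> gh_space S c p"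
proof -
  have "phi0 u (J (T y)) (J (T z)) = - phi0 u (T y) (T z)" if "u $ 0 = 0" for u y z
  proof -
    have "phi0 u (J (T y)) (J (T z)) = phi0 (J (J u)) (T y) (T z)"
      using that by (simp add: phi0_cross0_e0 phi0_cross0_e0')
    then show ?thesis using phi0_scale(1)[of "-1" u] that by (simp add: cross0_e0_e0)
  qed
  then have I: "phi0 (C x) (T (I y)) (T (I z)) = - phi0 (C x) (T y) (T z)" for x y z
    by (simp add: acs assms)
  show ?thesis unfolding gh_space_def mem_Collect_eq
  proof (intro conjI allI)
    fix x y z
    show "linear (\<lambda>x. phi0 (C x) (T y) (T z))"
      by (rule linearI) (simp_all add: linear_simps[OF assms(1)] phi0_add phi0_scale)
    show "linear (\<lambda>y. phi0 (C x) (T y) (T z))"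
      by (rule linearI) (simp_all add: linear_simps[OF linT] phi0_add phi0_scale)
    show "linear (\<lambda>z. phi0 (C x) (T y) (T z))"
      by (rule linearI) (simp_all add: linear_simps[OF linT] phi0_add phi0_scale)
    show "phi0 (C x) (T y) (T z) = - phi0 (C x) (T z) (T y)" by (rule phi0_swap')
    show "phi0 (C x) (T y) (T z) = - phi0 (C x) (T (I y)) (T (I z))" by (simp add: I)
  qed
qed

lemma gh_spaceD:
  assumes "\<alpha> \<in> gh_space S c p"
  shows "linear (\<lambda>x. \<alpha> x y z)" "linear (\<lambda>y. \<alpha> x y z)" "linear (\<alpha> x y)"
    "\<alpha> x y z = - \<alpha> x z y" "\<alpha> x (I y) z = \<alpha> x y (I z)" "\<alpha> x (I y) (I z) = - \<alpha> x y z"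
proof -
  from assms show l: "linear (\<lambda>x. \<alpha> x y z)" "linear (\<lambda>y. \<alpha> x y z)" "linear (\<alpha> x y)" for x y z
    unfolding gh_space_def mem_Collect_eq by blast+
  from assms show "\<alpha> x y z = - \<alpha> x z y" unfolding gh_space_def mem_Collect_eq by blast
  from assms have *: "\<alpha> x y z = - \<alpha> x (I y) (I z)" for x y z unfolding gh_space_def mem_Collect_eq by blast
  then show "\<alpha> x (I y) (I z) = - \<alpha> x y z" by (metis minus_minus)
  show "\<alpha> x (I y) z = \<alpha> x y (I z)"
    using *[of x y "I z"] linear_neg[OF l(3), of x "I y" z] by (simp add: I_I)
qed

lemma gh_module_subset: "gh_module S c p (W1 s) \<subseteq> gh_space S c p" "gh_module S c p (W2 s) \<subseteq> gh_space S c p"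
  unfolding gh_module.simps by (rule Collect_restrict)+

text \<open>Total skew symmetry allows cyclic shifts, which bring the two slots governed by
  \<open>gh_space\<close> into the first places. The sign, shared with W2, distinguishes these
  classes from W3.\<close>

lemma W1_I:
  assumes "\<alpha> \<in> gh_module S c p (W1 s)"
  shows "\<alpha> (I x) (I y) z = - \<alpha> x y z"
proof -
  have g: "\<alpha> \<in> gh_space S c p" and s1: "\<And>x y z. \<alpha> x y z = - \<alpha> y x z" and s2: "\<And>x y z. \<alpha> x y z = - \<alpha> x z y"
    using assms unfolding gh_module.simps mem_Collect_eq by blast+
  have cyc: "\<alpha> x y z = \<alpha> z x y" for x y z
    using s1[of z x y] s2[of x y z] by simp
  show ?thesis using cyc[of "I x" "I y" z] cyc[of x y z] gh_spaceD(6)[OF g, of z x y] by simp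
qed

text \<open>Four instances of the cyclic identity, with I in one slot or in all three, combine
  linearly; \<open>gh_space\<close> moves I between the last two slots.\<close>

lemma W2_I:
  assumes "\<alpha> \<in> gh_module S c p (W2 s)"
  shows "\<alpha> (I x) (I y) z = - \<alpha> x y z"
proof -
  have g: "\<alpha> \<in> gh_space S c p" and cyc: "\<And>x y z. \<alpha> x y z + \<alpha> y z x + \<alpha> z x y = 0"
    using assms unfolding gh_module.simps mem_Collect_eq by blast+
  have "\<alpha> (I x) y z = \<alpha> x (I y) z" for x y z
    using cyc[of "I x" y z] cyc[of x "I y" z] cyc[of x y "I z"] cyc[of "I x" "I y" "I z"]
      gh_spaceD(5)[OF g, of x y z] gh_spaceD(5)[OF g, of y z x] gh_spaceD(5)[OF g, of z x y]
      gh_spaceD(6)[OF g, of "I x" y z] gh_spaceD(6)[OF g, of "I y" z x] gh_spaceD(6)[OF g, of "I z" x y]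
    by linarith
  from this[of x "I y" z] show ?thesis
    using linear_neg[OF gh_spaceD(2)[OF g, where x=x and z=z], of y] by (simp add: I_I)
qed

text \<open>Applying I to an orthonormal basis preserves the trace, while \<open>a\<close> reverses
  its sign.\<close>

lemma trace_anti_I:
  assumes g: "\<alpha> \<in> gh_space S c p" and a: "\<And>x y z. \<alpha> (I x) (I y) z = - \<alpha> x y z"
  shows "(\<Sum>i\<in>UNIV. \<alpha> (ob i) (ob i) z) = 0"
proof -
  have "bilinear (\<lambda>x y. \<alpha> x y z)"
    using gh_spaceD(1,2)[OF g] by (simp add: bilinear_def)
  from trace_I[OF this] show ?thesis by (simp add: a sum_negf)
qed

definition W4_form :: "(real^6 \<Rightarrow> real) \<Rightarrow> trilin" where
  "W4_form \<tau> x y z = met S c p [x, y] * \<tau> z - met S c p [x, z] * \<tau> y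
     - met S c p [x, I y] * \<tau> (I z) + met S c p [x, I z] * \<tau> (I y)"

lemma W4_form_gh_module:
  assumes "linear \<tau>" shows "W4_form \<tau> \<in> gh_module S c p W4"
proof -
  have n: "\<tau> (- x) = - \<tau> x" "T (- x) = - T x" for x by (simp_all add: linear_neg assms linT)
  have "W4_form \<tau> \<in> gh_space S c p" unfolding gh_space_def mem_Collect_eq
  proof (intro conjI allI)
    fix x y z
    show "linear (\<lambda>x. W4_form \<tau> x y z)"
      by (rule linearI) (simp_all add: W4_form_def met linear_simps[OF linT] algebra_simps)
    show "linear (\<lambda>y. W4_form \<tau> x y z)" "linear (\<lambda>z. W4_form \<tau> x y z)"
      by (rule linearI; simp add: W4_form_def met linear_simps[OF linT]
        linear_simps[OF linear_I] linear_simps[OF assms] algebra_simps)+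
    show "W4_form \<tau> x y z = - W4_form \<tau> x z y" by (simp add: W4_form_def)
    show "W4_form \<tau> x y z = - W4_form \<tau> x (I y) (I z)" by (simp add: W4_form_def I_I n met)
  qed
  then show ?thesis using assms by (auto simp: W4_form_def fun_eq_iff)
qed

lemma W4_formE:
  assumes "\<alpha> \<in> gh_module S c p W4" obtains \<tau> where "linear \<tau>" "\<alpha> = W4_form \<tau>"
  using assms that by (auto simp: W4_form_def fun_eq_iff)

text \<open>The coefficient is again 6 - 1 - 1. As the other classes have trace zero, the trace of
  the torsion determines \<tau>.\<close>

lemma trace_W4_form:
  assumes "linear \<tau>" shows "(\<Sum>i\<in>UNIV. W4_form \<tau> (ob i) (ob i) z) = 4 * \<tau> z"
proof -
  have J0: "x \<bullet> J x = 0" for x using cross0_e0_skew[of x x] by (simp add: inner_commute)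
  have "(\<Sum>i\<in>UNIV. (T z \<bullet> T (ob i)) * \<tau> (ob i)) = \<tau> z"
    by (simp flip: linear_onb_expand[OF assms])
  moreover have "(\<Sum>i\<in>UNIV. (J (T z) \<bullet> T (ob i)) * \<tau> (I (ob i))) = - \<tau> z"
  proof -
    have "linear (\<lambda>x. \<tau> (I x))" using linear_compose[OF linear_I assms] by (simp add: o_def)
    from linear_onb_expand[OF this, of "I z"] show ?thesis
      by (simp add: I_I acs linear_neg[OF assms])
  qed
  ultimately show ?thesis
    by (simp add: W4_form_def met acs orthonormal_onb J0 sum.distrib sum_subtractf inner_commute)
qed

text \<open>The one-form of the \<open>W\<^sub>4\<close>-part.\<close>

definition tauP :: "real^6 \<Rightarrow> real" where "tauP z = - (P \<bullet> J (T z)) / 12"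

text \<open>The shift absorbs the multiple of \<open>phi0\<close> that the normal part of
  \<open>P\<close> contributes in \<open>star0_cross0_e0\<close>.\<close>

definition A' :: "real^6 \<Rightarrow> real^7" where "A' x = A x - (P $ 0 / 12) *\<^sub>R T x"

lemma linear_tauP: "linear tauP"
  by (rule linearI) (simp_all add: tauP_def linear_simps[OF linT] cross0_add cross0_scale inner_add_right field_simps)

lemma linear_A': "linear A'"
  by (rule linearI) (simp_all add: A'_def linear_simps[OF linT] linear_simps[OF linA] algebra_simps)

lemma A'_0 [simp]: "A' x $ 0 = 0"
  by (simp add: A'_def)

lemma A'_sym: "A' x \<bullet> T y = T x \<bullet> A' y"
  by (simp add: A'_def inner_diff_left inner_diff_right symA)

lemma nabla_omega_split: "nabla_omega S c p x y z = phi0 (A' x) (T y) (T z) + W4_form tauP x y z"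
proof -
  have "phi0 (A' x) (T y) (T z) = phi0 (A x) (T y) (T z) - P $ 0 / 12 * phi0 (T x) (T y) (T z)"
  proof -
    have A': "A' x = A x + (- (P $ 0 / 12)) *\<^sub>R T x" by (simp add: A'_def)
    show ?thesis unfolding A' phi0_add phi0_scale by simp
  qed
  then show ?thesis
    unfolding nabla_omega star0_cross0_e0[OF T0 T0 T0]
    by (simp add: W4_form_def met tauP_def acs cross0_e0_e0 inner_minus_right field_simps)
qed

text \<open>A symmetric endomorphism is contracted with two skew slots of \<open>phi0\<close>;
  exchanging the summation indices shows the sum to be its own negative.\<close>

lemma trace_A'_phi0: "(\<Sum>i\<in>UNIV. phi0 (A' (ob i)) (T (ob i)) z) = 0"
proof -
  have "phi0 (A' x) y z = (\<Sum>j\<in>UNIV. (A' x \<bullet> T (ob j)) * phi0 (T (ob j)) y z)" for x y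
    by (subst tangent_expand[OF A'_0, of x])
      (simp add: linear_sum[OF phi0_linear(1)] phi0_scale)
  then have *: "(\<Sum>i\<in>UNIV. phi0 (A' (ob i)) (T (ob i)) z)
    = (\<Sum>i\<in>UNIV. \<Sum>j\<in>UNIV. (A' (ob i) \<bullet> T (ob j)) * phi0 (T (ob j)) (T (ob i)) z)" by simp
  also have "\<dots> = (\<Sum>i\<in>UNIV. \<Sum>j\<in>UNIV. (A' (ob j) \<bullet> T (ob i)) * phi0 (T (ob i)) (T (ob j)) z)"
    by (rule sum.swap)
  also have "\<dots> = - (\<Sum>i\<in>UNIV. \<Sum>j\<in>UNIV. (A' (ob i) \<bullet> T (ob j)) * phi0 (T (ob j)) (T (ob i)) z)"
    unfolding sum_negf[symmetric]
  proof (intro sum.cong refl)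
    fix i j
    show "(A' (ob j) \<bullet> T (ob i)) * phi0 (T (ob i)) (T (ob j)) z = - ((A' (ob i) \<bullet> T (ob j)) * phi0 (T (ob j)) (T (ob i)) z)"
      using phi0_swap[of "T (ob i)" "T (ob j)" z] A'_sym[of "ob i" "ob j"] by (simp add: inner_commute)
  qed
  finally show ?thesis using * by simp
qed

text \<open>By \<open>trace_W4_form\<close> the codifferential is -4 times \<open>tauP\<close>, and
  3 * 4 cancels the denominator 12 of \<open>tauP\<close>.\<close>

lemma codiff_omega_eq: "3 * I_form S c p (codiff_omega S c p) x = P \<bullet> T x"
proof -
  have "(\<Sum>i\<in>UNIV. nabla_omega S c p (ob i) (ob i) (I x)) = 4 * tauP (I x)"
    by (simp add: nabla_omega_split sum.distrib trace_A'_phi0 trace_W4_form linear_tauP)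
  then show ?thesis
    by (simp add: I_form_def codiff_omega_def tauP_def acs cross0_e0_e0 inner_minus_right)
qed

text \<open>The body of the existential statement in \<open>torsion_type\<close> at one point, with
  the components exposed so that a given decomposition can be examined.\<close>

definition torsion_comps :: "torsion_class set \<Rightarrow> (torsion_class \<Rightarrow> trilin) \<Rightarrow> bool" where
  "torsion_comps U C \<longleftrightarrow> (\<forall>k\<in>gh_classes. C k \<in> gh_module S c p k) \<and>
     (\<forall>x y z. nabla_omega S c p x y z = (\<Sum>k\<in>gh_classes. C k x y z)) \<and>
     (\<forall>k\<in>gh_classes - U. \<forall>x y z. C k x y z = 0)"

text \<open>The trace over the first two slots kills W1, W2, W3 and the \<open>A'\<close> term, so
  it identifies the W4 component with \<open>W4_form tauP\<close>; cancelling this leaves the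
  identity.\<close>

lemma torsion_comps_split:
  assumes "torsion_comps U C"
  shows "phi0 (A' x) (T y) (T z) = C (W1 Plus) x y z + C (W1 Minus) x y z + C (W2 Plus) x y z + C (W2 Minus) x y z + C W3 x y z"
proof -
  have mem: "C (W1 s) \<in> gh_module S c p (W1 s)" "C (W2 s) \<in> gh_module S c p (W2 s)"
    "C W3 \<in> gh_module S c p W3" "C W4 \<in> gh_module S c p W4" for s
  proof -
    have *: "\<And>k. k \<in> gh_classes \<Longrightarrow> C k \<in> gh_module S c p k"
      using assms unfolding torsion_comps_def by blast
    show "C (W1 s) \<in> gh_module S c p (W1 s)" "C (W2 s) \<in> gh_module S c p (W2 s)"
      "C W3 \<in> gh_module S c p W3" "C W4 \<in> gh_module S c p W4" for s
      by (rule *; cases s; simp add: gh_classes_def)+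
  qed
  from W4_formE[OF mem(4)] obtain \<tau> where \<tau>: "linear \<tau>" and C4: "C W4 = W4_form \<tau>" .
  have eq: "phi0 (A' x) (T y) (T z) + W4_form tauP x y z =
     C (W1 Plus) x y z + C (W1 Minus) x y z + C (W2 Plus) x y z + C (W2 Minus) x y z + C W3 x y z + W4_form \<tau> x y z" for x y z
  proof -
    have "nabla_omega S c p x y z = (\<Sum>k\<in>gh_classes. C k x y z)"
      using assms unfolding torsion_comps_def by blast
    then show ?thesis by (simp add: gh_classes_def nabla_omega_split C4 add.assoc)
  qed
  have t12: "(\<Sum>i\<in>UNIV. C (W1 s) (ob i) (ob i) z) = 0" "(\<Sum>i\<in>UNIV. C (W2 s) (ob i) (ob i) z) = 0" for s z
    by (rule trace_anti_I[OF subsetD[OF gh_module_subset(1) mem(1)] W1_I[OF mem(1)]],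
        rule trace_anti_I[OF subsetD[OF gh_module_subset(2) mem(2)] W2_I[OF mem(2)]])
  have t3: "(\<Sum>i\<in>UNIV. C W3 (ob i) (ob i) z) = 0" for z
    using mem(3) unfolding gh_module.simps mem_Collect_eq by blast
  have "\<tau> z = tauP z" for z
  proof -
    have "(\<Sum>i\<in>UNIV. phi0 (A' (ob i)) (T (ob i)) (T z) + W4_form tauP (ob i) (ob i) z) =
      (\<Sum>i\<in>UNIV. C (W1 Plus) (ob i) (ob i) z + C (W1 Minus) (ob i) (ob i) z + C (W2 Plus) (ob i) (ob i) z
        + C (W2 Minus) (ob i) (ob i) z + C W3 (ob i) (ob i) z + W4_form \<tau> (ob i) (ob i) z)"
      by (simp only: eq)
    then show ?thesis
      by (simp add: sum.distrib t12 t3 trace_A'_phi0 trace_W4_form \<tau> linear_tauP)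
  qed
  then have "\<tau> = tauP" by auto
  with eq[of x y z] show ?thesis by simp
qed

text \<open>Twice the part of \<open>A'\<close> commuting with \<open>I\<close>.\<close>

definition D :: "real^6 \<Rightarrow> real^7" where "D x = A' x - J (A' (I x))"

definition H :: real where "H = (\<Sum>i\<in>UNIV. A (ob i) \<bullet> T (ob i)) / 6"

lemma linear_D: "linear D"
  by (rule linearI) (simp_all add: D_def linear_simps[OF linear_A']
    linear_simps[OF linear_I] cross0_add cross0_scale algebra_simps)

lemma D_0 [simp]: "D x $ 0 = 0"
  by (simp add: D_def)

lemma inner_D: "D x \<bullet> T y = A' x \<bullet> T y + A' (I x) \<bullet> T (I y)"
  by (simp add: D_def inner_diff_left acs cross0_e0_skew)

lemma D_sym: "D x \<bullet> T y = T x \<bullet> D y"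
  using inner_D[of x y] inner_D[of y x] A'_sym[of x y] A'_sym[of "I x" "I y"] by (simp add: inner_commute)

lemma D_I: "D (I x) = J (D x)"
proof -
  have "J (a - b) = J a - J b" for a b by (rule linear_diff[OF linear_J])
  moreover have "A' (- x) = - A' x" "J (- A' x) = - J (A' x)"
    by (simp_all add: linear_neg linear_A' linear_J)
  ultimately show ?thesis by (simp add: D_def I_I cross0_e0_e0)
qed

lemma phi0_D: "phi0 (D x) (T y) (T z) = phi0 (A' x) (T y) (T z) - phi0 (A' (I x)) (T (I y)) (T z)"
  by (simp add: D_def linear_diff[OF phi0_linear(1)] acs phi0_cross0_e0)

lemma inner_I: "T (I x) \<bullet> T (I y) = T x \<bullet> T y"
  by (simp add: acs cross0_e0_inner)

lemma inner_A': "A' x \<bullet> T y = A x \<bullet> T y - P $ 0 / 12 * (T x \<bullet> T y)"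
  by (simp add: A'_def inner_diff_left)

lemma trace_D: "(\<Sum>i\<in>UNIV. D (ob i) \<bullet> T (ob i)) = 12 * H - P $ 0"
proof -
  have "bilinear (\<lambda>x y. A' x \<bullet> T y)"
    by (auto simp: bilinear_def intro!: linearI simp: linear_simps[OF linear_A']
      linear_simps[OF linT] inner_add_left inner_add_right)
  from trace_I[OF this] have "(\<Sum>i\<in>UNIV. D (ob i) \<bullet> T (ob i)) = 2 * (\<Sum>i\<in>UNIV. A' (ob i) \<bullet> T (ob i))"
    by (simp add: inner_D sum.distrib)
  also have "\<dots> = 12 * H - P $ 0"
    by (simp add: inner_A' sum_subtractf H_def orthonormal_onb)
  finally show ?thesis .
qed

text \<open>The coordinate lemmas speak of endomorphisms of R^7. Composing \<open>D\<close> with a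
  left inverse of \<open>T\<close> produces one; its value at \<open>e0\<close> is arbitrary, so the
  trace is stated with that entry removed.\<close>

lemma D_hermitian:
  obtains M where "linear M" "\<And>x. M (T x) = D x" "\<And>x. x $ 0 = 0 \<Longrightarrow> M x $ 0 = 0"
    "\<And>x y. x $ 0 = 0 \<Longrightarrow> y $ 0 = 0 \<Longrightarrow> M x \<bullet> y = x \<bullet> M y"
    "\<And>x. x $ 0 = 0 \<Longrightarrow> M (J x) = J (M x)"
    "(\<Sum>i\<in>UNIV. M (axis i 1) $ i) - M e0 $ 0 = 12 * H - P $ 0"
proof -
  obtain U where U: "linear U" "U \<circ> T = id"
    using linear_injective_left_inverse[OF linT injT] by blast
  define M where "M v = D (U v)" for v
  have MT: "M (T x) = D x" for x using U(2) by (simp add: M_def o_def fun_eq_iff)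
  have lin: "linear M" using linear_compose[OF U(1) linear_D] by (simp add: M_def[abs_def] o_def)
  have "bilinear (\<lambda>x y. M x \<bullet> y)"
    by (auto simp: bilinear_def intro!: linearI simp: linear_simps[OF lin] inner_add_left inner_add_right)
  from trace_onb[OF this] have tr: "(\<Sum>i\<in>UNIV. M (axis i 1) $ i) - M e0 $ 0 = 12 * H - P $ 0"
    by (simp add: MT trace_D inner_axis)
  show thesis
  proof (rule that[OF lin MT _ _ _ tr])
    fix x :: "real^7" assume x: "x $ 0 = 0"
    then obtain x' where x': "x = T x'" using surjT by blast
    show "M x $ 0 = 0" by (simp add: x' MT)
    show "M (J x) = J (M x)" by (simp add: x' MT D_I flip: acs)
    fix y :: "real^7" assume "y $ 0 = 0"
    then obtain y' where "y = T y'" using surjT by blast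
    then show "M x \<bullet> y = x \<bullet> M y" by (simp add: x' MT D_sym)
  qed
qed

section \<open>What a decomposition of the torsion forces on the shape operator\<close>

lemma torsion_comps_mem:
  assumes "torsion_comps U C" "k \<in> gh_classes" shows "C k \<in> gh_module S c p k"
  using assms unfolding torsion_comps_def by blast

lemma torsion_comps_zero:
  assumes "torsion_comps U C" "k \<in> gh_classes" "k \<notin> U" shows "C k x y z = 0"
  using assms unfolding torsion_comps_def by blast

lemma in_gh_classes: "W1 s \<in> gh_classes" "W2 s \<in> gh_classes" "W3 \<in> gh_classes" "W4 \<in> gh_classes"
  by (cases s; simp add: gh_classes_def)+

text \<open>Passing from \<alpha>(x, y, z) to \<alpha>(x, y, z) - \<alpha>(I x, I y, z) doubles W1
  and W2 and cancels W3; applied to the tensor of \<open>A'\<close> it gives that of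
  \<open>D\<close>.\<close>

lemma torsion_comps_D:
  assumes C: "torsion_comps U C"
  shows "phi0 (D x) (T y) (T z) = 2 * (C (W1 Plus) x y z + C (W1 Minus) x y z + C (W2 Plus) x y z + C (W2 Minus) x y z)"
proof -
  note mem = torsion_comps_mem[OF C in_gh_classes(1)] torsion_comps_mem[OF C in_gh_classes(2)]
    torsion_comps_mem[OF C in_gh_classes(3)]
  have "C W3 (I x) (I y) z = C W3 x y z"
    using mem(3) unfolding gh_module.simps mem_Collect_eq by blast
  then show ?thesis
    unfolding phi0_D torsion_comps_split[OF C] by (simp add: W1_I[OF mem(1)] W2_I[OF mem(2)])
qed

text \<open>Without W3, \<open>D\<close> and twice \<open>A'\<close> define the same tensor and
  agree by nondegeneracy. Then \<open>A'\<close>, and with it \<open>A\<close>, commutes with the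
  complex structure.\<close>

lemma second_ff_I_if_no_W3:
  assumes C: "torsion_comps U C" and "W3 \<notin> U"
  shows "A (I x) \<bullet> T (I y) = A x \<bullet> T y"
proof -
  have "phi0 (D x - 2 *\<^sub>R A' x) (T y) (T z) = 0" for x y z
    using torsion_comps_D[OF C, of x y z] torsion_comps_split[OF C, of x y z]
      torsion_comps_zero[OF C in_gh_classes(3) assms(2), of x y z]
    by (simp add: linear_diff[OF phi0_linear(1)] phi0_scale)
  then have "D x - 2 *\<^sub>R A' x = 0" by (intro phi0_nondegenerate) auto
  then have "D x = 2 *\<^sub>R A' x" by simp
  then show ?thesis using inner_D[of x y] by (simp add: inner_A' inner_I)
qed

text \<open>Without W2 the tensor of \<open>D\<close> is skew in its first two slots as well, so the
  Hermitian endomorphism is a scalar, which \<open>trace_D\<close> computes.\<close>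

lemma second_ff_I_if_no_W2:
  assumes C: "torsion_comps U C" and "W2 Plus \<notin> U" "W2 Minus \<notin> U"
  shows "A x \<bullet> T y + A (I x) \<bullet> T (I y) = 2 * H * (T x \<bullet> T y)"
proof -
  have skew: "C (W1 s) x y z = - C (W1 s) y x z" for s x y z
    using torsion_comps_mem[OF C in_gh_classes(1), of s] unfolding gh_module.simps mem_Collect_eq by blast
  have D1: "phi0 (D x) (T y) (T z) = - phi0 (D y) (T x) (T z)" for x y z
    using torsion_comps_D[OF C, of x y z] torsion_comps_D[OF C, of y x z]
      torsion_comps_zero[OF C in_gh_classes(2) assms(2)] torsion_comps_zero[OF C in_gh_classes(2) assms(3)]
      skew[of Plus x y z] skew[of Minus x y z] by simp
  obtain M where M: "linear M" "\<And>x. M (T x) = D x" "\<And>x. x $ 0 = 0 \<Longrightarrow> M x $ 0 = 0"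
    "\<And>x y. x $ 0 = 0 \<Longrightarrow> y $ 0 = 0 \<Longrightarrow> M x \<bullet> y = x \<bullet> M y"
    "\<And>x. x $ 0 = 0 \<Longrightarrow> M (J x) = J (M x)"
    by (rule D_hermitian) blast
  have "phi0 (M x) y z = - phi0 (M y) x z" if "x $ 0 = 0" "y $ 0 = 0" "z $ 0 = 0" for x y z
  proof -
    from that obtain x' y' z' where "x = T x'" "y = T y'" "z = T z'" using surjT by metis
    then show ?thesis by (simp add: M(2) D1[of x'])
  qed
  then obtain t where "\<And>x. x $ 0 = 0 \<Longrightarrow> M x = t *\<^sub>R x"
    using hermitian_skew_phi0[OF M(1,3,4,5)] by metis
  then have t: "D x = t *\<^sub>R T x" for x using M(2)[of x] by simp
  have "6 * t = 12 * H - P $ 0"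
    using trace_D by (simp add: t orthonormal_onb)
  then show ?thesis using inner_D[of x y] by (simp add: t inner_A' inner_I field_simps) algebra
qed

text \<open>Without W1 the cyclic sums of the tensor of \<open>D\<close> vanish. Contracted with the
  cyclically invariant \<open>phi0\<close>, their three terms become equal, and each is four times
  the trace of \<open>D\<close>.\<close>

lemma mean_curv_if_no_W1:
  assumes C: "torsion_comps U C" and "W1 Plus \<notin> U" "W1 Minus \<notin> U"
  shows "P $ 0 = 12 * H"
proof -
  define F where "F i j k = phi0 (D (ob i)) (T (ob j)) (T (ob k))" for i j k
  define G where "G i j k = phi0 (T (ob i)) (T (ob j)) (T (ob k))" for i j k
  have cyc: "C (W2 s) x y z + C (W2 s) y z x + C (W2 s) z x y = 0" for s x y z
    using torsion_comps_mem[OF C in_gh_classes(2), of s] unfolding gh_module.simps mem_Collect_eq by blast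
  have F: "F i j k + F j k i + F k i j = 0" for i j k
    using torsion_comps_D[OF C, of "ob i" "ob j" "ob k"] torsion_comps_D[OF C, of "ob j" "ob k" "ob i"]
      torsion_comps_D[OF C, of "ob k" "ob i" "ob j"]
      torsion_comps_zero[OF C in_gh_classes(1) assms(2)] torsion_comps_zero[OF C in_gh_classes(1) assms(3)]
      cyc[of Plus "ob i" "ob j" "ob k"] cyc[of Minus "ob i" "ob j" "ob k"] by (simp add: F_def)
  have G: "G j k i = G i j k" "G k i j = G i j k" for i j k
    unfolding G_def by (rule phi0_cycle, rule phi0_cycle[symmetric])
  let ?X = "\<Sum>i\<in>UNIV. \<Sum>j\<in>UNIV. \<Sum>k\<in>UNIV. F i j k * G i j k"
  have "(\<Sum>i\<in>UNIV. \<Sum>j\<in>UNIV. \<Sum>k\<in>UNIV. F j k i * G j k i) = (\<Sum>j\<in>UNIV. \<Sum>i\<in>UNIV. \<Sum>k\<in>UNIV. F j k i * G j k i)"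
    by (rule sum.swap)
  also have "\<dots> = ?X" by (intro sum.cong refl sum.swap)
  finally have 1: "(\<Sum>i\<in>UNIV. \<Sum>j\<in>UNIV. \<Sum>k\<in>UNIV. F j k i * G j k i) = ?X" .
  have "(\<Sum>i\<in>UNIV. \<Sum>j\<in>UNIV. \<Sum>k\<in>UNIV. F k i j * G k i j) = (\<Sum>i\<in>UNIV. \<Sum>k\<in>UNIV. \<Sum>j\<in>UNIV. F k i j * G k i j)"
    by (intro sum.cong refl sum.swap)
  also have "\<dots> = ?X" by (rule sum.swap)
  finally have 2: "(\<Sum>i\<in>UNIV. \<Sum>j\<in>UNIV. \<Sum>k\<in>UNIV. F k i j * G k i j) = ?X" .
  have "(\<Sum>i\<in>UNIV. \<Sum>j\<in>UNIV. \<Sum>k\<in>UNIV. (F i j k + F j k i + F k i j) * G i j k) = 3 * ?X"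
    using 1 2 by (simp add: distrib_right sum.distrib G)
  then have "?X = 0" by (simp add: F)
  moreover have "?X = (\<Sum>i\<in>UNIV. 4 * (D (ob i) \<bullet> T (ob i)))"
    unfolding F_def G_def by (intro sum.cong refl contract_phi0) simp_all
  ultimately have "(\<Sum>i\<in>UNIV. D (ob i) \<bullet> T (ob i)) = 0" by (simp flip: sum_distrib_left)
  then show ?thesis using trace_D by simp
qed

section \<open>Construction of the torsion components\<close>

lemma tangent_eqI:
  assumes "u $ 0 = 0" "v $ 0 = 0" and eq: "\<And>y. u \<bullet> T y = v \<bullet> T y"
  shows "u = v"
proof -
  have "u = (\<Sum>i\<in>UNIV. (u \<bullet> T (ob i)) *\<^sub>R T (ob i))" by (rule tangent_expand) fact
  also have "\<dots> = (\<Sum>i\<in>UNIV. (v \<bullet> T (ob i)) *\<^sub>R T (ob i))" by (simp only: eq)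
  also have "\<dots> = v" by (rule tangent_expand[symmetric]) fact
  finally show ?thesis .
qed

text \<open>For \<open>C\<close> symmetric and commuting with J, the form <C x, y> is symmetric and
  <C x, J y> is skew; \<epsilon> decides which of them r produces.\<close>

lemma has_parity_r_form:
  assumes C0: "\<And>x. C x $ 0 = 0" and sym: "\<And>x y. C x \<bullet> T y = T x \<bullet> C y" and CI: "\<And>x. C (I x) = J (C x)"
  shows "has_parity \<epsilon> (r_form S c p (\<lambda>x y z. phi0 (C x) (T y) (T z)))"
proof -
  let ?R = "r_form S c p (\<lambda>x y z. phi0 (C x) (T y) (T z))"
  show ?thesis
  proof (cases \<epsilon>)
    case Plus
    have R: "?R x y = C x \<bullet> T y" for x y
      using r_form_phi0[where C=C, OF C0] Plus by simp
    have "?R x y = ?R y x" for x y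
      unfolding R using sym[of x y] by (simp add: inner_commute)
    then show ?thesis unfolding Plus has_parity.simps by blast
  next
    case Minus
    have R: "?R x y = C x \<bullet> J (T y)" for x y
      using r_form_phi0[where C=C, OF C0] Minus by simp
    have "?R x y = - ?R y x" for x y
      unfolding R using sym[of "I x" y] cross0_e0_skew[of "C x" "T y"] by (simp add: CI acs inner_commute)
    then show ?thesis unfolding Minus has_parity.simps by blast
  qed
qed

text \<open>Admits zero as the component of the parity opposite to \<epsilon> in
  \<open>torsion_compsI\<close>.\<close>

lemma zero_gh_module: "k \<in> gh_classes \<Longrightarrow> (\<lambda>x y z. 0) \<in> gh_module S c p k"
proof -
  have z: "(\<lambda>x y z. 0) \<in> gh_space S c p" by (simp add: gh_space_def linear_zero)
  have "r_form S c p (\<lambda>x y z. 0) = (\<lambda>x y. 0)" by (simp add: r_form_def form_inner_def fun_eq_iff)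
  then have "has_parity s (r_form S c p (\<lambda>x y z. 0))" for s by (cases s) simp_all
  moreover have "W4_form (\<lambda>x. 0) = (\<lambda>x y z. 0)" by (simp add: W4_form_def fun_eq_iff)
  ultimately show "k \<in> gh_classes \<Longrightarrow> (\<lambda>x y z. 0) \<in> gh_module S c p k"
    using z W4_form_gh_module[OF linear_zero] by (cases k) (simp_all add: gh_classes_def)
qed

text \<open>Each class is either allowed by \<open>U\<close> or made to vanish by its condition on
  \<open>A\<close> or \<open>P\<close>, so the same components serve every type in the
  theorem.\<close>

lemma torsion_compsI:
  assumes w1: "W1 \<epsilon> \<in> U \<or> P $ 0 = 12 * H"
    and w2: "W2 \<epsilon> \<in> U \<or> (\<forall>x y. A x \<bullet> T y + A (I x) \<bullet> T (I y) = 2 * H * (T x \<bullet> T y))"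
    and w3: "W3 \<in> U \<or> (\<forall>x y. A (I x) \<bullet> T (I y) = A x \<bullet> T y)"
    and w4: "W4 \<in> U \<or> (\<forall>x. P \<bullet> T x = 0)"
  shows "\<exists>C. torsion_comps U C"
proof -
  \<comment> \<open>One sixth of the trace of half of \<open>D\<close>; subtracting this multiple of
    the identity leaves a trace-free endomorphism.\<close>
  define t where "t = H - P $ 0 / 12"
  define C2 where "C2 x = (1/2) *\<^sub>R D x - t *\<^sub>R T x" for x
  define C3 where "C3 x = A' x - (1/2) *\<^sub>R D x" for x
  define C where "C k = (if k = W1 \<epsilon> then (\<lambda>x y z. phi0 (t *\<^sub>R T x) (T y) (T z))
     else if k = W2 \<epsilon> then (\<lambda>x y z. phi0 (C2 x) (T y) (T z))
     else if k = W3 then (\<lambda>x y z. phi0 (C3 x) (T y) (T z))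
     else if k = W4 then W4_form tauP else (\<lambda>x y z. 0))" for k
  have lin: "linear (\<lambda>x. t *\<^sub>R T x)" "linear C2" "linear C3"
    by (rule linearI; simp add: C2_def C3_def linear_simps[OF linT]
      linear_simps[OF linear_D] linear_simps[OF linear_A'] algebra_simps)+
  have C2_0 [simp]: "C2 x $ 0 = 0" and C3_0 [simp]: "C3 x $ 0 = 0" for x by (simp_all add: C2_def C3_def)
  have C2_sym: "C2 x \<bullet> T y = T x \<bullet> C2 y" for x y
    by (simp add: C2_def inner_diff_left inner_diff_right D_sym)
  have C2_I: "C2 (I x) = J (C2 x)" for x
    by (simp add: C2_def D_I acs linear_diff[OF linear_J] cross0_scale)
  have m1: "(\<lambda>x y z. phi0 (t *\<^sub>R T x) (T y) (T z)) \<in> gh_module S c p (W1 \<epsilon>)"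
  proof -
    have "has_parity \<epsilon> (r_form S c p (\<lambda>x y z. phi0 (t *\<^sub>R T x) (T y) (T z)))"
      by (rule has_parity_r_form) (simp_all add: acs cross0_scale)
    moreover have "(\<lambda>x y z. phi0 (t *\<^sub>R T x) (T y) (T z)) \<in> gh_space S c p"
      by (rule gh_space_phi0[OF lin(1)]) simp
    moreover have "phi0 (t *\<^sub>R T x) (T y) (T z) = - phi0 (t *\<^sub>R T y) (T x) (T z)" for x y z
      using phi0_swap[of "T x" "T y" "T z"] by (simp add: phi0_scale)
    moreover have "phi0 (t *\<^sub>R T x) (T y) (T z) = - phi0 (t *\<^sub>R T x) (T z) (T y)" for x y z
      by (rule phi0_swap')
    ultimately show ?thesis unfolding gh_module.simps mem_Collect_eq by blast
  qed
  have m2: "(\<lambda>x y z. phi0 (C2 x) (T y) (T z)) \<in> gh_module S c p (W2 \<epsilon>)"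
  proof -
    have "has_parity \<epsilon> (r_form S c p (\<lambda>x y z. phi0 (C2 x) (T y) (T z)))"
      by (rule has_parity_r_form) (simp_all add: C2_sym C2_I)
    moreover have "(\<lambda>x y z. phi0 (C2 x) (T y) (T z)) \<in> gh_space S c p"
      by (rule gh_space_phi0[OF lin(2)]) simp
    moreover have "phi0 (C2 x) (T y) (T z) + phi0 (C2 y) (T z) (T x) + phi0 (C2 z) (T x) (T y) = 0" for x y z
    proof (rule D_hermitian)
      fix M assume M: "linear M" "\<And>x. M (T x) = D x" "\<And>x. x $ 0 = 0 \<Longrightarrow> M x $ 0 = 0"
        "\<And>x y. x $ 0 = 0 \<Longrightarrow> y $ 0 = 0 \<Longrightarrow> M x \<bullet> y = x \<bullet> M y"
        "\<And>x. x $ 0 = 0 \<Longrightarrow> M (J x) = J (M x)"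
        "(\<Sum>i\<in>UNIV. M (axis i 1) $ i) - M e0 $ 0 = 12 * H - P $ 0"
      define M' where "M' v = (1/2) *\<^sub>R M v - t *\<^sub>R v" for v
      have "phi0 (M' (T x)) (T y) (T z) + phi0 (M' (T y)) (T z) (T x) + phi0 (M' (T z)) (T x) (T y) = 0"
      proof (rule hermitian_cyclic_phi0)
        show "linear M'"
          by (rule linearI) (simp_all add: M'_def linear_simps[OF M(1)] algebra_simps)
        show "(\<Sum>i\<in>UNIV. M' (axis i 1) $ i) = M' e0 $ 0"
        proof -
          \<comment> \<open>The identity of R^7 has trace 7; the surplus over the six tangential
            directions is matched by the \<open>e0\<close> entry on the other side.\<close>
          have "(\<Sum>i\<in>UNIV. M' (axis i 1) $ i) = (\<Sum>i\<in>UNIV. M (axis i 1) $ i) / 2 - 7 * t"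
            by (simp add: M'_def sum_subtractf sum_divide_distrib axis_def)
          then show ?thesis using M(6) by (simp add: M'_def t_def field_simps)
        qed
      qed (simp_all add: M'_def M(3,4,5) inner_diff_left inner_diff_right linear_diff[OF linear_J] cross0_scale)
      then show ?thesis by (simp add: M'_def M(2) C2_def)
    qed
    ultimately show ?thesis unfolding gh_module.simps mem_Collect_eq by blast
  qed
  have J_A'I: "J (A' (I x)) = A' x - D x" for x by (simp add: D_def)
  have C3_I: "J (C3 (I x)) = C3 x" for x
  proof -
    have "J (C3 (I x)) = A' x - D x + (1/2) *\<^sub>R D x"
      by (simp add: C3_def linear_diff[OF linear_J] cross0_scale J_A'I D_I cross0_e0_e0)
    also have "\<dots> = C3 x" by (simp add: C3_def vec_eq_iff)
    finally show ?thesis .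
  qed
  have C3_sym: "C3 x \<bullet> T y = T x \<bullet> C3 y" for x y
    by (simp add: C3_def inner_diff_left inner_diff_right D_sym A'_sym)
  have m3: "(\<lambda>x y z. phi0 (C3 x) (T y) (T z)) \<in> gh_module S c p W3"
  proof -
    have "(\<lambda>x y z. phi0 (C3 x) (T y) (T z)) \<in> gh_space S c p"
      by (rule gh_space_phi0[OF lin(3)]) simp
    moreover have I: "phi0 (C3 (I x)) (T (I y)) (T z) = phi0 (C3 x) (T y) (T z)" for x y z
      by (simp add: acs phi0_cross0_e0 C3_I)
    \<comment> \<open>The trace condition of W3 is obtained by difference, since the tensor of
      \<open>A'\<close> and its W1 and W2 parts all have trace zero.\<close>
    moreover have "(\<Sum>i\<in>UNIV. phi0 (C3 (ob i)) (T (ob i)) (T z)) = 0" for z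
    proof -
      have "(\<Sum>i\<in>UNIV. phi0 (C2 (ob i)) (T (ob i)) (T z)) = 0"
        using trace_anti_I[OF subsetD[OF gh_module_subset(2) m2] W2_I[OF m2]] .
      moreover have "(\<Sum>i\<in>UNIV. phi0 (t *\<^sub>R T (ob i)) (T (ob i)) (T z)) = 0"
        using trace_anti_I[OF subsetD[OF gh_module_subset(1) m1] W1_I[OF m1]] .
      moreover have "C3 x = A' x - C2 x - t *\<^sub>R T x" for x by (simp add: C2_def C3_def)
      ultimately show ?thesis
        using trace_A'_phi0[of "T z"] by (simp add: linear_diff[OF phi0_linear(1)] sum_subtractf)
    qed
    ultimately show ?thesis unfolding gh_module.simps mem_Collect_eq by blast
  qed
  have Ck: "C (W1 \<epsilon>) = (\<lambda>x y z. phi0 (t *\<^sub>R T x) (T y) (T z))"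
    "C (W2 \<epsilon>) = (\<lambda>x y z. phi0 (C2 x) (T y) (T z))"
    "C W3 = (\<lambda>x y z. phi0 (C3 x) (T y) (T z))" "C W4 = W4_form tauP"
    by (simp_all add: C_def)
  have "C k \<in> gh_module S c p k" if k: "k \<in> gh_classes" for k
  proof -
    consider "k = W1 \<epsilon>" | "k = W2 \<epsilon>" | "k = W3" | "k = W4" | "C k = (\<lambda>x y z. 0)"
      unfolding C_def by (metis (no_types))
    then show ?thesis
    proof cases
      case 1 show ?thesis unfolding 1 Ck by (rule m1)
    next
      case 2 show ?thesis unfolding 2 Ck by (rule m2)
    next
      case 3 show ?thesis unfolding 3 Ck by (rule m3)
    next
      case 4 show ?thesis unfolding 4 Ck by (rule W4_form_gh_module[OF linear_tauP])
    next
      case 5 then show ?thesis using zero_gh_module[OF k] by (simp only:)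
    qed
  qed
  moreover have "nabla_omega S c p x y z = (\<Sum>k\<in>gh_classes. C k x y z)" for x y z
  proof -
    have "A' x = t *\<^sub>R T x + C2 x + C3 x" by (simp add: C2_def C3_def)
    then have "phi0 (A' x) (T y) (T z) = phi0 (t *\<^sub>R T x) (T y) (T z) + phi0 (C2 x) (T y) (T z) + phi0 (C3 x) (T y) (T z)"
      by (simp only: phi0_add)
    then show ?thesis by (cases \<epsilon>) (simp_all add: gh_classes_def C_def nabla_omega_split)
  qed
  moreover have "C k x y z = 0" if k: "k \<in> gh_classes - U" for k x y z
  proof -
    consider "k = W1 \<epsilon>" | "k = W2 \<epsilon>" | "k = W3" | "k = W4" | "C k = (\<lambda>x y z. 0)"
      unfolding C_def by (metis (no_types))
    then show ?thesis
    proof cases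
      case 1 with k w1 have "t = 0" by (auto simp: t_def)
      then show ?thesis using 1 by (simp add: Ck linear_0[OF phi0_linear(1)])
    next
      case 2 with k w2 have *: "A x \<bullet> T y + A (I x) \<bullet> T (I y) = 2 * H * (T x \<bullet> T y)" for x y by auto
      have "C2 x = 0"
      proof (rule tangent_eqI)
        fix y
        show "C2 x \<bullet> T y = 0 \<bullet> T y"
          using *[of x y] by (simp add: C2_def inner_diff_left inner_D inner_A' inner_I t_def field_simps)
      qed simp_all
      then show ?thesis using 2 by (simp add: Ck linear_0[OF phi0_linear(1)])
    next
      case 3 with k w3 have *: "A (I x) \<bullet> T (I y) = A x \<bullet> T y" for x y by auto
      have "C3 x = 0"
        by (rule tangent_eqI) (simp_all add: C3_def inner_diff_left inner_D inner_A' inner_I *)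
      then show ?thesis using 3 by (simp add: Ck linear_0[OF phi0_linear(1)])
    next
      case 4 with k w4 have "P \<bullet> T x = 0" for x by auto
      then have "tauP x = 0" for x unfolding tauP_def by (simp flip: acs)
      then show ?thesis using 4 by (simp add: Ck W4_form_def)
    next
      case 5 then show ?thesis by simp
    qed
  qed
  ultimately show ?thesis unfolding torsion_comps_def by blast
qed
end

section \<open>Derivatives\<close>

lemma smooth_on_has_derivative:
  assumes "smooth_on S f" "open S" "x \<in> S"
  shows "(f has_derivative frechet_derivative f (at x)) (at x)"
proof -
  from assms(1) have "Ck_on (Suc 0) S f" unfolding smooth_on_def by blast
  then have "f differentiable at x"
    using assms(2,3) by (simp add: differentiable_on_eq_differentiable_at)
  then show ?thesis by (simp add: frechet_derivative_works)
qed

lemma smooth_on_frechet_derivative: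
  assumes "smooth_on S f" shows "smooth_on S (\<lambda>x. frechet_derivative f (at x) v)"
  using assms unfolding smooth_on_def by (metis Ck_on.simps(2))

lemma smooth_on_continuous_on: "smooth_on S f \<Longrightarrow> continuous_on S f"
  unfolding smooth_on_def by (metis Ck_on.simps(1))

lemma frechet_derivative_eqI: "(f has_derivative f') (at x) \<Longrightarrow> frechet_derivative f (at x) = f'"
  by (rule frechet_derivative_at[symmetric])

section \<open>Symmetry of second derivatives by second differences\<close>

lemma second_difference_mvt:
  fixes f :: "'a::real_normed_vector \<Rightarrow> real"
  assumes d1: "\<And>u. u \<in> U \<Longrightarrow> (f has_derivative f' u) (at u)"
    and d2: "\<And>u. u \<in> U \<Longrightarrow> ((\<lambda>u. f' u x) has_derivative fx u) (at u)"
    and U: "\<And>s t. 0 \<le> s \<Longrightarrow> s \<le> h \<Longrightarrow> 0 \<le> t \<Longrightarrow> t \<le> h \<Longrightarrow> a + s *\<^sub>R x + t *\<^sub>R y \<in> U"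
    and h: "h > 0"
  obtains s t where "0 \<le> s" "s \<le> h" "0 \<le> t" "t \<le> h"
    "f (a + h *\<^sub>R x + h *\<^sub>R y) - f (a + h *\<^sub>R x) - f (a + h *\<^sub>R y) + f a = h * h * fx (a + s *\<^sub>R x + t *\<^sub>R y) y"
proof -
  define g where "g s = f (a + s *\<^sub>R x + h *\<^sub>R y) - f (a + s *\<^sub>R x)" for s
  have "DERIV g s :> f' (a + s *\<^sub>R x + h *\<^sub>R y) x - f' (a + s *\<^sub>R x) x" if s: "0 \<le> s" "s \<le> h" for s
  proof -
    have "DERIV (\<lambda>s. f (a + s *\<^sub>R x + t *\<^sub>R y)) s :> f' (a + s *\<^sub>R x + t *\<^sub>R y) x" if t: "0 \<le> t" "t \<le> h" for t
    proof -
      have "((\<lambda>s. a + s *\<^sub>R x + t *\<^sub>R y) has_derivative (\<lambda>s. s *\<^sub>R x)) (at s)"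
        by (auto intro!: derivative_eq_intros)
      from has_derivative_compose[OF this d1[OF U[OF s t]]]
      have "((\<lambda>s. f (a + s *\<^sub>R x + t *\<^sub>R y)) has_derivative (\<lambda>r. f' (a + s *\<^sub>R x + t *\<^sub>R y) (r *\<^sub>R x))) (at s)" .
      moreover have "linear (f' (a + s *\<^sub>R x + t *\<^sub>R y))"
        using d1[OF U[OF s t]] has_derivative_linear by blast
      ultimately show ?thesis
        by (simp add: has_field_derivative_def linear_scale mult.commute[of _ "f' _ x"] fun_eq_iff mult_commute_abs)
    qed
    from DERIV_diff[OF this[of h] this[of 0]] h show ?thesis by (simp add: g_def[abs_def])
  qed
  from MVT2[OF h this] obtain s where s: "0 < s" "s < h"
    and 1: "g h - g 0 = h * (f' (a + s *\<^sub>R x + h *\<^sub>R y) x - f' (a + s *\<^sub>R x) x)" by auto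
  have "DERIV (\<lambda>t. f' (a + s *\<^sub>R x + t *\<^sub>R y) x) t :> fx (a + s *\<^sub>R x + t *\<^sub>R y) y" if t: "0 \<le> t" "t \<le> h" for t
  proof -
    have s': "0 \<le> s" "s \<le> h" using s by auto
    have "((\<lambda>t. a + s *\<^sub>R x + t *\<^sub>R y) has_derivative (\<lambda>t. t *\<^sub>R y)) (at t)"
      by (auto intro!: derivative_eq_intros)
    from has_derivative_compose[OF this d2[OF U[OF s' t]]]
    have "((\<lambda>t. f' (a + s *\<^sub>R x + t *\<^sub>R y) x) has_derivative (\<lambda>r. fx (a + s *\<^sub>R x + t *\<^sub>R y) (r *\<^sub>R y))) (at t)" .
    moreover have "linear (fx (a + s *\<^sub>R x + t *\<^sub>R y))"
      using d2[OF U[OF s' t]] has_derivative_linear by blast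
    ultimately show ?thesis
      by (simp add: has_field_derivative_def linear_scale mult_commute_abs)
  qed
  from MVT2[OF h this] obtain t where t: "0 < t" "t < h"
    and 2: "f' (a + s *\<^sub>R x + h *\<^sub>R y) x - f' (a + s *\<^sub>R x) x = h * fx (a + s *\<^sub>R x + t *\<^sub>R y) y" by auto
  show thesis
    by (rule that[of s t]) (use s t 1 2 in \<open>simp_all add: g_def\<close>)
qed

text \<open>One second difference equals \<open>h * h\<close> times either mixed derivative at
  suitable points near \<open>a\<close>; continuity then excludes different values at
  \<open>a\<close>.\<close>

lemma second_derivative_symmetric_real:
  fixes f :: "'a::real_normed_vector \<Rightarrow> real"
  assumes U: "open U" "a \<in> U" and d1: "\<And>u. u \<in> U \<Longrightarrow> (f has_derivative f' u) (at u)"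
    and dx: "\<And>u. u \<in> U \<Longrightarrow> ((\<lambda>u. f' u x) has_derivative fx u) (at u)"
    and dy: "\<And>u. u \<in> U \<Longrightarrow> ((\<lambda>u. f' u y) has_derivative fy u) (at u)"
    and cx: "continuous_on U (\<lambda>u. fx u y)" and cy: "continuous_on U (\<lambda>u. fy u x)"
  shows "fx a y = fy a x"
proof (rule ccontr)
  assume "fx a y \<noteq> fy a x"
  define e where "e = \<bar>fx a y - fy a x\<bar> / 2"
  have e: "e > 0" using \<open>fx a y \<noteq> fy a x\<close> by (simp add: e_def)
  have "isCont (\<lambda>u. fx u y) a" "isCont (\<lambda>u. fy u x) a"
    using cx cy U by (auto simp: continuous_on_eq_continuous_at)
  then obtain r1 r2 where r: "r1 > 0" "r2 > 0" "\<And>u. dist u a < r1 \<Longrightarrow> dist (fx u y) (fx a y) < e"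
     "\<And>u. dist u a < r2 \<Longrightarrow> dist (fy u x) (fy a x) < e"
    using e unfolding continuous_at_eps_delta by metis
  obtain r3 where r3: "r3 > 0" "ball a r3 \<subseteq> U" using U open_contains_ball by blast
  define r where "r = min r1 (min r2 r3)"
  \<comment> \<open>Small enough that the parallelogram spanned by \<open>h *\<^sub>R x\<close> and
    \<open>h *\<^sub>R y\<close> stays within distance \<open>r\<close> of \<open>a\<close>; the 1
    keeps the denominator positive.\<close>
  define h where "h = r / (2 * (norm x + norm y + 1))"
  have "r > 0" using r r3 by (simp add: r_def)
  have n: "norm x + norm y + 1 > 0" using norm_ge_zero[of x] norm_ge_zero[of y] by linarith
  then have h: "h > 0" using \<open>r > 0\<close> by (simp add: h_def)
  have near: "dist (a + s *\<^sub>R x + t *\<^sub>R y) a < r" if "0 \<le> s" "s \<le> h" "0 \<le> t" "t \<le> h" for s t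
  proof -
    have "dist (a + s *\<^sub>R x + t *\<^sub>R y) a \<le> s * norm x + t * norm y"
      using norm_triangle_ineq[of "s *\<^sub>R x" "t *\<^sub>R y"] that by (simp add: dist_norm add.assoc)
    also have "\<dots> \<le> h * norm x + h * norm y"
      using that by (intro add_mono mult_right_mono) auto
    also have "\<dots> < 2 * h * (norm x + norm y + 1)"
      using h norm_ge_zero[of x] norm_ge_zero[of y] by (simp add: algebra_simps add_strict_increasing2 add_pos_nonneg)
    also have "\<dots> = r"
    proof -
      have "2 * (r / (2 * N)) * N = r" if "N > 0" for N :: real using that by simp
      from this[OF n] show ?thesis by (simp only: h_def)
    qed
    finally show ?thesis .
  qed
  have inU: "a + s *\<^sub>R x + t *\<^sub>R y \<in> U" if "0 \<le> s" "s \<le> h" "0 \<le> t" "t \<le> h" for s t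
    using near[OF that] r3 by (auto simp: r_def dist_commute)
  have inU': "a + s *\<^sub>R y + t *\<^sub>R x \<in> U" if "0 \<le> s" "s \<le> h" "0 \<le> t" "t \<le> h" for s t
    using inU[OF that(3,4,1,2)] by (simp add: algebra_simps)
  obtain s t where st: "0 \<le> s" "s \<le> h" "0 \<le> t" "t \<le> h" and
    1: "f (a + h *\<^sub>R x + h *\<^sub>R y) - f (a + h *\<^sub>R x) - f (a + h *\<^sub>R y) + f a = h * h * fx (a + s *\<^sub>R x + t *\<^sub>R y) y"
    by (rule second_difference_mvt[OF d1 dx inU h])
  obtain s' t' where st': "0 \<le> s'" "s' \<le> h" "0 \<le> t'" "t' \<le> h" and
    2: "f (a + h *\<^sub>R y + h *\<^sub>R x) - f (a + h *\<^sub>R y) - f (a + h *\<^sub>R x) + f a = h * h * fy (a + s' *\<^sub>R y + t' *\<^sub>R x) x"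
    by (rule second_difference_mvt[OF d1 dy inU' h])
  have "h * h * fx (a + s *\<^sub>R x + t *\<^sub>R y) y = h * h * fy (a + s' *\<^sub>R y + t' *\<^sub>R x) x"
    using 1 2 by (simp add: algebra_simps)
  then have eq: "fx (a + s *\<^sub>R x + t *\<^sub>R y) y = fy (a + s' *\<^sub>R y + t' *\<^sub>R x) x" using h by simp
  have "dist (fx (a + s *\<^sub>R x + t *\<^sub>R y) y) (fx a y) < e"
    using near[OF st] by (intro r) (simp add: r_def)
  moreover have "dist (fy (a + s' *\<^sub>R y + t' *\<^sub>R x) x) (fy a x) < e"
  proof -
    have "a + s' *\<^sub>R y + t' *\<^sub>R x = a + t' *\<^sub>R x + s' *\<^sub>R y" by simp
    then show ?thesis using near[OF st'(3,4,1,2)] by (intro r) (simp only: r_def min_less_iff_conj)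
  qed
  ultimately show False using eq unfolding e_def dist_real_def by argo
qed

lemma smooth_on_second_derivative_symmetric:
  fixes f :: "'a::euclidean_space \<Rightarrow> 'b::euclidean_space"
  assumes f: "smooth_on U f" and U: "open U" "a \<in> U"
  shows "frechet_derivative (\<lambda>u. frechet_derivative f (at u) x) (at a) y
       = frechet_derivative (\<lambda>u. frechet_derivative f (at u) y) (at a) x"
proof (rule euclidean_eqI)
  fix b :: 'b
  let ?f2 = "\<lambda>x u. frechet_derivative (\<lambda>u. frechet_derivative f (at u) x) (at u)"
  have d: "((\<lambda>u. g u \<bullet> b) has_derivative (\<lambda>x. frechet_derivative g (at u) x \<bullet> b)) (at u)"
    if "smooth_on U g" "u \<in> U" for g :: "'a \<Rightarrow> 'b" and u
    by (rule has_derivative_inner_left[OF smooth_on_has_derivative[OF that(1) U(1) that(2)]])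
  have c: "continuous_on U (\<lambda>u. ?f2 x u y \<bullet> b)" for x y
    by (intro continuous_intros smooth_on_continuous_on smooth_on_frechet_derivative f)
  show "?f2 x a y \<bullet> b = ?f2 y a x \<bullet> b"
    by (rule second_derivative_symmetric_real[where f="\<lambda>u. f u \<bullet> b", OF U])
      (rule d f smooth_on_frechet_derivative c | assumption)+
qed

section \<open>The product rule for multilinear maps with moving arguments\<close>

lemma has_derivative_linear_slot:
  fixes F :: "'x::real_normed_vector \<Rightarrow> real^'n \<Rightarrow> real"
  assumes U: "open U" "a \<in> U" and lin: "\<And>u. u \<in> U \<Longrightarrow> linear (F u)"
    and dF: "\<And>v. ((\<lambda>u. F u v) has_derivative F' v) (at a)"
    and dV: "(V has_derivative V') (at a)"
  shows "((\<lambda>u. F u (V u)) has_derivative (\<lambda>h. F' (V a) h + F a (V' h))) (at a)"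
proof -
  have dVi: "((\<lambda>u. V u $ i) has_derivative (\<lambda>h. V' h $ i)) (at a)" for i
    by (rule bounded_linear.has_derivative[OF bounded_linear_vec_nth dV])
  have "((\<lambda>u. \<Sum>i\<in>UNIV. V u $ i * F u (axis i 1)) has_derivative
     (\<lambda>h. \<Sum>i\<in>UNIV. V a $ i * F' (axis i 1) h + V' h $ i * F a (axis i 1))) (at a)"
    by (intro has_derivative_sum has_derivative_mult dVi dF)
  then have 1: "((\<lambda>u. F u (V u)) has_derivative
     (\<lambda>h. \<Sum>i\<in>UNIV. V a $ i * F' (axis i 1) h + V' h $ i * F a (axis i 1))) (at a)"
    by (rule has_derivative_transform_within_open[OF _ U]) (subst linear_axis_expand[OF lin], simp_all)
  have "((\<lambda>u. \<Sum>i\<in>UNIV. V a $ i * F u (axis i 1)) has_derivative (\<lambda>h. \<Sum>i\<in>UNIV. V a $ i * F' (axis i 1) h)) (at a)"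
    by (intro has_derivative_sum has_derivative_mult_right dF)
  then have "((\<lambda>u. F u (V a)) has_derivative (\<lambda>h. \<Sum>i\<in>UNIV. V a $ i * F' (axis i 1) h)) (at a)"
    by (rule has_derivative_transform_within_open[OF _ U]) (subst linear_axis_expand[OF lin], simp_all)
  then have "F' (V a) = (\<lambda>h. \<Sum>i\<in>UNIV. V a $ i * F' (axis i 1) h)"
    by (rule has_derivative_unique[OF dF])
  moreover have "F a (V' h) = (\<Sum>i\<in>UNIV. V' h $ i * F a (axis i 1))" for h
    by (subst linear_axis_expand[OF lin[OF U(2)]]) simp
  ultimately show ?thesis using 1 by (simp add: sum.distrib)
qed

text \<open>The slots are released one at a time: at stage \<open>j\<close> the slots below
  \<open>j\<close> move and the others keep their value at \<open>a\<close>, and linearity in the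
  next slot permits \<open>has_derivative_linear_slot\<close>.\<close>

lemma multilinear_has_derivative:
  fixes G :: "'x::real_normed_vector \<Rightarrow> (real^'n) list \<Rightarrow> real"
  assumes U: "open U" "a \<in> U" and ml: "\<And>u. u \<in> U \<Longrightarrow> multilinear k (G u)"
    and dG: "\<And>vs. length vs = k \<Longrightarrow> ((\<lambda>u. G u vs) has_derivative G' vs) (at a)"
    and dV: "\<And>i. i < k \<Longrightarrow> (V i has_derivative V' i) (at a)"
  shows "((\<lambda>u. G u (map (\<lambda>i. V i u) [0..<k])) has_derivative
     (\<lambda>h. G' (map (\<lambda>i. V i a) [0..<k]) h + (\<Sum>i<k. G a ((map (\<lambda>i. V i a) [0..<k])[i := V' i h])))) (at a)"
proof -
  have "((\<lambda>u. G u (map (\<lambda>i. if i < j then V i u else V i a) [0..<k])) has_derivative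
     (\<lambda>h. G' (map (\<lambda>i. V i a) [0..<k]) h + (\<Sum>i<j. G a ((map (\<lambda>i. V i a) [0..<k])[i := V' i h])))) (at a)"
    if "j \<le> k" "\<And>i. i < k \<Longrightarrow> (V i has_derivative V' i) (at a)" for j and V :: "nat \<Rightarrow> 'x \<Rightarrow> real^'n" and V'
    using that
  proof (induction j arbitrary: V V')
    case 0
    then show ?case using dG by simp
  next
    case (Suc j)
    let ?vs = "\<lambda>u. map (\<lambda>i. if i < j then V i u else V i a) [0..<k]"
    \<comment> \<open>Freezing slot \<open>j\<close> at a constant \<open>v\<close> lets the
      induction hypothesis supply the derivative for each fixed argument of that slot.\<close>
    let ?W = "\<lambda>v. V(j := \<lambda>_. v)" and ?W' = "V'(j := \<lambda>_. 0)"
    have lin: "linear (\<lambda>v. G u ((?vs u)[j := v]))" if "u \<in> U" for u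
      using ml[OF that] Suc.prems(1) by (simp add: multilinear_def)
    have upd: "(map f [0..<k])[j := v] = map (f(j := v)) [0..<k]" for f :: "nat \<Rightarrow> real^'n" and v
      by (rule nth_equalityI) (auto simp: nth_list_update)
    have d: "((\<lambda>u. G u ((?vs u)[j := v])) has_derivative
       (\<lambda>h. G' (map (\<lambda>i. ?W v i a) [0..<k]) h + (\<Sum>i<j. G a ((map (\<lambda>i. ?W v i a) [0..<k])[i := ?W' i h])))) (at a)" for v
    proof -
      have "(?vs u)[j := v] = map (\<lambda>i. if i < j then ?W v i u else ?W v i a) [0..<k]" for u
        unfolding upd by (rule map_cong) auto
      moreover have "((\<lambda>u. G u (map (\<lambda>i. if i < j then ?W v i u else ?W v i a) [0..<k])) has_derivative
       (\<lambda>h. G' (map (\<lambda>i. ?W v i a) [0..<k]) h + (\<Sum>i<j. G a ((map (\<lambda>i. ?W v i a) [0..<k])[i := ?W' i h])))) (at a)"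
        by (rule Suc.IH) (use Suc.prems in auto)
      ultimately show ?thesis by simp
    qed
    have jk: "j < k" using Suc.prems by simp
    from has_derivative_linear_slot[OF U lin d Suc.prems(2)[OF jk]]
    have 1: "((\<lambda>u. G u ((?vs u)[j := V j u])) has_derivative
       (\<lambda>h. G' (map (\<lambda>i. ?W (V j a) i a) [0..<k]) h
         + (\<Sum>i<j. G a ((map (\<lambda>i. ?W (V j a) i a) [0..<k])[i := ?W' i h])) + G a ((?vs a)[j := V' j h]))) (at a)" .
    have e1: "map (\<lambda>i. ?W (V j a) i a) [0..<k] = map (\<lambda>i. V i a) [0..<k]" by (rule map_cong) auto
    have e2: "?vs a = map (\<lambda>i. V i a) [0..<k]" by (rule map_cong) auto
    have e3: "(?vs u)[j := V j u] = map (\<lambda>i. if i < Suc j then V i u else V i a) [0..<k]" for u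
      unfolding upd by (rule map_cong) auto
    have e4: "(\<Sum>i<j. G a ((map (\<lambda>i. V i a) [0..<k])[i := ?W' i h])) = (\<Sum>i<j. G a ((map (\<lambda>i. V i a) [0..<k])[i := V' i h]))" for h
      by (rule sum.cong) auto
    from 1 show ?case unfolding e1 e2 e3 e4 by (simp add: add.assoc)
  qed
  from this[of k V V'] dV have "((\<lambda>u. G u (map (\<lambda>i. if i < k then V i u else V i a) [0..<k])) has_derivative
     (\<lambda>h. G' (map (\<lambda>i. V i a) [0..<k]) h + (\<Sum>i<k. G a ((map (\<lambda>i. V i a) [0..<k])[i := V' i h])))) (at a)" by simp
  moreover have "map (\<lambda>i. if i < k then V i u else V i a) [0..<k] = map (\<lambda>i. V i u) [0..<k]" for u
    by (rule map_cong) auto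
  ultimately show ?thesis by simp
qed

section \<open>Exterior products and the Hodge dual\<close>

lemma wedge1_Nil: "wedge1 [] [] = 1"
  by (simp add: wedge1_def)

lemma wedge1_transpose:
  "wedge1 as vs = (\<Sum>\<sigma> | \<sigma> permutes {..<length vs}. of_int (sign \<sigma>) * (\<Prod>j<length vs. (as ! \<sigma> j) (vs ! j)))"
proof -
  let ?n = "length vs"
  have "wedge1 as vs = (\<Sum>\<sigma> | \<sigma> permutes {..<?n}. of_int (sign (inv \<sigma>)) * (\<Prod>j<?n. (as ! j) (vs ! inv \<sigma> j)))"
    unfolding wedge1_def by (rule sum_permutations_inverse)
  also have "\<dots> = (\<Sum>\<sigma> | \<sigma> permutes {..<?n}. of_int (sign \<sigma>) * (\<Prod>j<?n. (as ! \<sigma> j) (vs ! j)))"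
  proof (rule sum.cong[OF refl])
    fix \<sigma> assume "\<sigma> \<in> {\<sigma>. \<sigma> permutes {..<?n}}"
    then have \<sigma>: "\<sigma> permutes {..<?n}" by simp
    have "(\<Prod>j<?n. (as ! j) (vs ! inv \<sigma> j)) = (\<Prod>j<?n. (as ! \<sigma> j) (vs ! inv \<sigma> (\<sigma> j)))"
      by (rule prod.permute[OF \<sigma>, unfolded o_def])
    moreover have "sign (inv \<sigma>) = sign \<sigma>"
      using \<sigma> by (meson finite_lessThan permutation_permutes sign_inverse)
    ultimately show "of_int (sign (inv \<sigma>)) * (\<Prod>j<?n. (as ! j) (vs ! inv \<sigma> j)) =
      of_int (sign \<sigma>) * (\<Prod>j<?n. (as ! \<sigma> j) (vs ! j))"
      using \<sigma> by (simp add: permutes_inverses(2)[OF \<sigma>])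
  qed
  finally show ?thesis .
qed

text \<open>Laplace expansion in the last argument. Putting the last form in the place of the b-th
  one, rather than deleting the latter, costs exactly one transposition, so all terms of the sum
  have the same sign.\<close>

lemma wedge1_snoc:
  assumes as: "length as = n" and vs: "length vs = n"
  shows "wedge1 (as @ [a]) (vs @ [v]) = a v * wedge1 as vs - (\<Sum>b<n. (as ! b) v * wedge1 (as[b := a]) vs)"
proof -
  have n: "{..<Suc n} = insert n {..<n}" by auto
  let ?f = "\<lambda>\<sigma>. of_int (sign \<sigma>) * (\<Prod>j<Suc n. ((as @ [a]) ! \<sigma> j) ((vs @ [v]) ! j))"
  have "wedge1 (as @ [a]) (vs @ [v]) = (\<Sum>\<sigma> | \<sigma> permutes insert n {..<n}. ?f \<sigma>)"
    by (simp add: wedge1_transpose vs flip: n)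
  \<comment> \<open>A permutation of n + 1 indices is one of n indices followed by a transposition
    with the new index.\<close>
  also have "\<dots> = (\<Sum>b\<in>insert n {..<n}. \<Sum>q | q permutes {..<n}. ?f (Transposition.transpose n b \<circ> q))"
    by (rule sum_over_permutations_insert) auto
  also have "\<dots> = (\<Sum>q | q permutes {..<n}. ?f (Transposition.transpose n n \<circ> q)) + (\<Sum>b<n. \<Sum>q | q permutes {..<n}. ?f (Transposition.transpose n b \<circ> q))"
    by simp
  also have "(\<Sum>q | q permutes {..<n}. ?f (Transposition.transpose n n \<circ> q)) = a v * wedge1 as vs"
  proof -
    have "?f (Transposition.transpose n n \<circ> q) = a v * (of_int (sign q) * (\<Prod>j<n. (as ! q j) (vs ! j)))" if q: "q permutes {..<n}" for q
    proof -
      have "q n = n" using q by (simp add: permutes_def)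
      moreover have "(\<Prod>j<n. ((as @ [a]) ! q j) ((vs @ [v]) ! j)) = (\<Prod>j<n. (as ! q j) (vs ! j))"
        using permutes_in_image[OF q] by (intro prod.cong) (auto simp: nth_append as vs)
      ultimately show ?thesis by (simp add: as vs nth_append)
    qed
    then show ?thesis unfolding wedge1_transpose vs sum_distrib_left
      by (intro sum.cong refl) (simp only: mem_Collect_eq)
  qed
  also have "(\<Sum>b<n. \<Sum>q | q permutes {..<n}. ?f (Transposition.transpose n b \<circ> q)) = (\<Sum>b<n. - ((as ! b) v * wedge1 (as[b := a]) vs))"
  proof (rule sum.cong[OF refl])
    fix b assume "b \<in> {..<n}" then have b: "b < n" by simp
    have "?f (Transposition.transpose n b \<circ> q) = - ((as ! b) v * (of_int (sign q) * (\<Prod>j<n. (as[b := a] ! q j) (vs ! j))))"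
      if q: "q permutes {..<n}" for q
    proof -
      have pq: "permutation q" using q permutation_permutes by blast
      have "sign (Transposition.transpose n b \<circ> q) = - sign q"
        using b by (simp add: sign_compose[OF permutation_swap_id pq] sign_swap_id)
      moreover have "q n = n" using q by (simp add: permutes_def)
      moreover have "(\<Prod>j<n. ((as @ [a]) ! Transposition.transpose n b (q j)) ((vs @ [v]) ! j)) = (\<Prod>j<n. (as[b := a] ! q j) (vs ! j))"
      proof (rule prod.cong[OF refl])
        fix j assume "j \<in> {..<n}"
        then have j: "j < n" "q j < n" using permutes_in_image[OF q, of j] by auto
        then show "((as @ [a]) ! Transposition.transpose n b (q j)) ((vs @ [v]) ! j) = (as[b := a] ! q j) (vs ! j)"
          using b as vs by (cases "q j = b") (auto simp: nth_append Transposition.transpose_def)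
      qed
      ultimately show ?thesis using b by (simp add: as vs nth_append)
    qed
    then show "(\<Sum>q | q permutes {..<n}. ?f (Transposition.transpose n b \<circ> q)) = - ((as ! b) v * wedge1 (as[b := a]) vs)"
      unfolding wedge1_transpose vs sum_distrib_left sum_negf[symmetric]
      by (intro sum.cong refl) (simp only: mem_Collect_eq)
  qed
  finally show ?thesis by (simp add: sum_negf)
qed

lemma wedge1_swap:
  assumes ij: "i < length vs" "j < length vs" "i \<noteq> j"
  shows "wedge1 as (vs[i := vs ! j, j := vs ! i]) = - wedge1 as vs"
proof -
  let ?n = "length vs" and ?t = "Transposition.transpose i j"
  have t: "?t permutes {..<?n}" using ij by (intro permutes_swap_id) auto
  have nth: "vs[i := vs ! j, j := vs ! i] ! ?t k = vs ! k" if "k < ?n" for k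
    using that ij by (auto simp: Transposition.transpose_def nth_list_update)
  have "wedge1 as (vs[i := vs ! j, j := vs ! i]) =
    (\<Sum>\<sigma> | \<sigma> permutes {..<?n}. of_int (sign (?t \<circ> \<sigma>)) * (\<Prod>k<?n. (as ! k) (vs[i := vs ! j, j := vs ! i] ! (?t \<circ> \<sigma>) k)))"
    unfolding wedge1_def length_list_update by (rule setum_permutations_compose_left[OF t])
  also have "\<dots> = (\<Sum>\<sigma> | \<sigma> permutes {..<?n}. - (of_int (sign \<sigma>) * (\<Prod>k<?n. (as ! k) (vs ! \<sigma> k))))"
  proof (rule sum.cong[OF refl])
    fix \<sigma> assume "\<sigma> \<in> {\<sigma>. \<sigma> permutes {..<?n}}"
    then have \<sigma>: "\<sigma> permutes {..<?n}" by simp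
    have "sign (?t \<circ> \<sigma>) = - sign \<sigma>"
    proof -
      have "permutation \<sigma>" using \<sigma> permutation_permutes by blast
      then show ?thesis using ij by (simp add: sign_compose[OF permutation_swap_id] sign_swap_id)
    qed
    moreover have "(\<Prod>k<?n. (as ! k) (vs[i := vs ! j, j := vs ! i] ! (?t \<circ> \<sigma>) k)) = (\<Prod>k<?n. (as ! k) (vs ! \<sigma> k))"
      using permutes_in_image[OF \<sigma>] by (intro prod.cong) (auto simp: nth)
    ultimately show "of_int (sign (?t \<circ> \<sigma>)) * (\<Prod>k<?n. (as ! k) (vs[i := vs ! j, j := vs ! i] ! (?t \<circ> \<sigma>) k)) =
      - (of_int (sign \<sigma>) * (\<Prod>k<?n. (as ! k) (vs ! \<sigma> k)))" by simp
  qed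
  finally show ?thesis by (simp add: wedge1_def sum_negf)
qed

lemma wedge1_1: "wedge1 [a] [v] = a v"
  using wedge1_snoc[of "[]" 0 "[]" a v] by (simp add: wedge1_Nil)

lemma wedge1_2: "wedge1 [a0, a1] [v0, v1] = a1 v1 * wedge1 [a0] [v0]
    - a0 v1 * wedge1 [a1] [v0]"
  using wedge1_snoc[of "[a0]" "1" "[v0]" a1 v1]
  by (simp add: lessThan_Suc numeral_eq_Suc algebra_simps)

lemma wedge1_3: "wedge1 [a0, a1, a2] [v0, v1, v2] = a2 v2 * wedge1 [a0, a1] [v0, v1]
    - a0 v2 * wedge1 [a2, a1] [v0, v1]
    - a1 v2 * wedge1 [a0, a2] [v0, v1]"
  using wedge1_snoc[of "[a0, a1]" "2" "[v0, v1]" a2 v2]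
  by (simp add: lessThan_Suc numeral_eq_Suc algebra_simps)

lemma wedge1_4: "wedge1 [a0, a1, a2, a3] [v0, v1, v2, v3] = a3 v3 * wedge1 [a0, a1, a2] [v0, v1, v2]
    - a0 v3 * wedge1 [a3, a1, a2] [v0, v1, v2]
    - a1 v3 * wedge1 [a0, a3, a2] [v0, v1, v2]
    - a2 v3 * wedge1 [a0, a1, a3] [v0, v1, v2]"
  using wedge1_snoc[of "[a0, a1, a2]" "3" "[v0, v1, v2]" a3 v3]
  by (simp add: lessThan_Suc numeral_eq_Suc algebra_simps)

lemma wedge1_5: "wedge1 [a0, a1, a2, a3, a4] [v0, v1, v2, v3, v4] = a4 v4 * wedge1 [a0, a1, a2, a3] [v0, v1, v2, v3]
    - a0 v4 * wedge1 [a4, a1, a2, a3] [v0, v1, v2, v3]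
    - a1 v4 * wedge1 [a0, a4, a2, a3] [v0, v1, v2, v3]
    - a2 v4 * wedge1 [a0, a1, a4, a3] [v0, v1, v2, v3]
    - a3 v4 * wedge1 [a0, a1, a2, a4] [v0, v1, v2, v3]"
  using wedge1_snoc[of "[a0, a1, a2, a3]" "4" "[v0, v1, v2, v3]" a4 v4]
  by (simp add: lessThan_Suc numeral_eq_Suc algebra_simps)

lemma wedge1_6: "wedge1 [a0, a1, a2, a3, a4, a5] [v0, v1, v2, v3, v4, v5] = a5 v5 * wedge1 [a0, a1, a2, a3, a4] [v0, v1, v2, v3, v4]
    - a0 v5 * wedge1 [a5, a1, a2, a3, a4] [v0, v1, v2, v3, v4]
    - a1 v5 * wedge1 [a0, a5, a2, a3, a4] [v0, v1, v2, v3, v4]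
    - a2 v5 * wedge1 [a0, a1, a5, a3, a4] [v0, v1, v2, v3, v4]
    - a3 v5 * wedge1 [a0, a1, a2, a5, a4] [v0, v1, v2, v3, v4]
    - a4 v5 * wedge1 [a0, a1, a2, a3, a5] [v0, v1, v2, v3, v4]"
  using wedge1_snoc[of "[a0, a1, a2, a3, a4]" "5" "[v0, v1, v2, v3, v4]" a5 v5]
  by (simp add: lessThan_Suc numeral_eq_Suc algebra_simps)

lemma wedge1_7: "wedge1 [a0, a1, a2, a3, a4, a5, a6] [v0, v1, v2, v3, v4, v5, v6] = a6 v6 * wedge1 [a0, a1, a2, a3, a4, a5] [v0, v1, v2, v3, v4, v5]
    - a0 v6 * wedge1 [a6, a1, a2, a3, a4, a5] [v0, v1, v2, v3, v4, v5]
    - a1 v6 * wedge1 [a0, a6, a2, a3, a4, a5] [v0, v1, v2, v3, v4, v5]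
    - a2 v6 * wedge1 [a0, a1, a6, a3, a4, a5] [v0, v1, v2, v3, v4, v5]
    - a3 v6 * wedge1 [a0, a1, a2, a6, a4, a5] [v0, v1, v2, v3, v4, v5]
    - a4 v6 * wedge1 [a0, a1, a2, a3, a6, a5] [v0, v1, v2, v3, v4, v5]
    - a5 v6 * wedge1 [a0, a1, a2, a3, a4, a6] [v0, v1, v2, v3, v4, v5]"
  using wedge1_snoc[of "[a0, a1, a2, a3, a4, a5]" "6" "[v0, v1, v2, v3, v4, v5]" a6 v6]
  by (simp add: lessThan_Suc numeral_eq_Suc algebra_simps)

lemma axis_nth_if: "axis i a $ j = (if j = i then a else 0)"
  by (simp add: axis_def)

definition vol0 :: "(real^7) list \<Rightarrow> real" where
  "vol0 = wedge1 [\<lambda>v. v $ 0, \<lambda>v. v $ 1, \<lambda>v. v $ 2, \<lambda>v. v $ 3, \<lambda>v. v $ 4, \<lambda>v. v $ 5, \<lambda>v. v $ 6]"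

text \<open>Three transpositions give the sign. The basis vectors move to the end, where the
  expansions \<open>wedge1_7\<close>, \<open>wedge1_6\<close>, \<open>wedge1_5\<close> consume them
  first.\<close>

lemma vol0_swap3: "vol0 [i, j, k, x, y, z, w] = - vol0 [y, z, w, x, i, j, k]"
  using wedge1_swap[of 0 "[i, j, k, x, y, z, w]" 4] wedge1_swap[of 1 "[y, j, k, x, i, z, w]" 5]
    wedge1_swap[of 2 "[y, z, k, x, i, j, w]" 6] by (simp add: vol0_def numeral_eq_Suc)

lemma sum_phi0_axis3:
  "(\<Sum>i\<in>UNIV. \<Sum>j\<in>UNIV. \<Sum>k\<in>UNIV. phi0 (axis i 1) (axis j 1) (axis k 1) * V i j k) =
   (\<Sum>m\<in>UNIV. V m (m+1) (m+3) - V m (m+3) (m+1) + V (m+1) (m+3) m - V (m+1) m (m+3)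
      + V (m+3) m (m+1) - V (m+3) (m+1) m)"
  unfolding sum_phi0_axis unfolding sum_7 num_7 add_0 by (simp add: axis_nth_if)

text \<open>Links the model dual to the definition by the Hodge star. The 6 counts the orderings of
  a line and is cancelled by the factorial in \<open>hodge\<close>.\<close>

lemma phi0_wedge_vol0:
  "(\<Sum>i\<in>UNIV. \<Sum>j\<in>UNIV. \<Sum>k\<in>UNIV. phi0 (axis i 1) (axis j 1) (axis k 1) *
      vol0 [axis i 1, axis j 1, axis k 1, x, y, z, w]) = 6 * star0 x y z w"
proof -
  \<comment> \<open>All orderings of a line contribute equally, as the signs of \<open>phi0\<close>
    and of the volume form cancel.\<close>
  have red: "vol0 [y, z, w, x, axis m 1, axis (m+1) 1, axis (m+3) 1]
      - vol0 [y, z, w, x, axis m 1, axis (m+3) 1, axis (m+1) 1]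
      + vol0 [y, z, w, x, axis (m+1) 1, axis (m+3) 1, axis m 1]
      - vol0 [y, z, w, x, axis (m+1) 1, axis m 1, axis (m+3) 1]
      + vol0 [y, z, w, x, axis (m+3) 1, axis m 1, axis (m+1) 1]
      - vol0 [y, z, w, x, axis (m+3) 1, axis (m+1) 1, axis m 1]
     = 6 * vol0 [y, z, w, x, axis m 1, axis (m+1) 1, axis (m+3) 1]" for m
  proof -
    have s: "vol0 [y, z, w, x, a, c, b] = - vol0 [y, z, w, x, a, b, c]"
      "vol0 [y, z, w, x, b, a, c] = - vol0 [y, z, w, x, a, b, c]" for a b c
      using wedge1_swap[of 5 "[y, z, w, x, a, b, c]" 6] wedge1_swap[of 4 "[y, z, w, x, a, b, c]" 5]
      by (simp_all add: vol0_def numeral_eq_Suc)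
    let ?a = "axis m 1 :: real^7" and ?b = "axis (m+1) 1 :: real^7" and ?c = "axis (m+3) 1 :: real^7"
    show ?thesis
      using s(1)[of ?a ?c ?b] s(1)[of ?b ?c ?a] s(2)[of ?b ?a ?c] s(1)[of ?c ?a ?b] s(2)[of ?c ?a ?b]
        s(1)[of ?c ?b ?a] s(2)[of ?a ?c ?b] by linarith
  qed
  \<comment> \<open>Once the three basis vectors are used up, the complementary 4-by-4 minors
    remain, in the Laplace form of \<open>star0\<close>.\<close>
  have V:
    "vol0 [y, z, w, x, axis 0 1, axis 1 1, axis 3 1] =
      (x $ 2 * y $ 4 - x $ 4 * y $ 2) * (z $ 5 * w $ 6 - z $ 6 * w $ 5) - (x $ 2 * y $ 5 - x $ 5 * y $ 2) * (z $ 4 * w $ 6 - z $ 6 * w $ 4) + (x $ 2 * y $ 6 - x $ 6 * y $ 2) * (z $ 4 * w $ 5 - z $ 5 * w $ 4)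
      + (x $ 4 * y $ 5 - x $ 5 * y $ 4) * (z $ 2 * w $ 6 - z $ 6 * w $ 2) - (x $ 4 * y $ 6 - x $ 6 * y $ 4) * (z $ 2 * w $ 5 - z $ 5 * w $ 2) + (x $ 5 * y $ 6 - x $ 6 * y $ 5) * (z $ 2 * w $ 4 - z $ 4 * w $ 2)"
    "vol0 [y, z, w, x, axis 1 1, axis 2 1, axis 4 1] =
      (x $ 3 * y $ 5 - x $ 5 * y $ 3) * (z $ 6 * w $ 0 - z $ 0 * w $ 6) - (x $ 3 * y $ 6 - x $ 6 * y $ 3) * (z $ 5 * w $ 0 - z $ 0 * w $ 5) + (x $ 3 * y $ 0 - x $ 0 * y $ 3) * (z $ 5 * w $ 6 - z $ 6 * w $ 5)
      + (x $ 5 * y $ 6 - x $ 6 * y $ 5) * (z $ 3 * w $ 0 - z $ 0 * w $ 3) - (x $ 5 * y $ 0 - x $ 0 * y $ 5) * (z $ 3 * w $ 6 - z $ 6 * w $ 3) + (x $ 6 * y $ 0 - x $ 0 * y $ 6) * (z $ 3 * w $ 5 - z $ 5 * w $ 3)"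
    "vol0 [y, z, w, x, axis 2 1, axis 3 1, axis 5 1] =
      (x $ 4 * y $ 6 - x $ 6 * y $ 4) * (z $ 0 * w $ 1 - z $ 1 * w $ 0) - (x $ 4 * y $ 0 - x $ 0 * y $ 4) * (z $ 6 * w $ 1 - z $ 1 * w $ 6) + (x $ 4 * y $ 1 - x $ 1 * y $ 4) * (z $ 6 * w $ 0 - z $ 0 * w $ 6)
      + (x $ 6 * y $ 0 - x $ 0 * y $ 6) * (z $ 4 * w $ 1 - z $ 1 * w $ 4) - (x $ 6 * y $ 1 - x $ 1 * y $ 6) * (z $ 4 * w $ 0 - z $ 0 * w $ 4) + (x $ 0 * y $ 1 - x $ 1 * y $ 0) * (z $ 4 * w $ 6 - z $ 6 * w $ 4)"
    "vol0 [y, z, w, x, axis 3 1, axis 4 1, axis 6 1] =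
      (x $ 5 * y $ 0 - x $ 0 * y $ 5) * (z $ 1 * w $ 2 - z $ 2 * w $ 1) - (x $ 5 * y $ 1 - x $ 1 * y $ 5) * (z $ 0 * w $ 2 - z $ 2 * w $ 0) + (x $ 5 * y $ 2 - x $ 2 * y $ 5) * (z $ 0 * w $ 1 - z $ 1 * w $ 0)
      + (x $ 0 * y $ 1 - x $ 1 * y $ 0) * (z $ 5 * w $ 2 - z $ 2 * w $ 5) - (x $ 0 * y $ 2 - x $ 2 * y $ 0) * (z $ 5 * w $ 1 - z $ 1 * w $ 5) + (x $ 1 * y $ 2 - x $ 2 * y $ 1) * (z $ 5 * w $ 0 - z $ 0 * w $ 5)"
    "vol0 [y, z, w, x, axis 4 1, axis 5 1, axis 0 1] =
      (x $ 6 * y $ 1 - x $ 1 * y $ 6) * (z $ 2 * w $ 3 - z $ 3 * w $ 2) - (x $ 6 * y $ 2 - x $ 2 * y $ 6) * (z $ 1 * w $ 3 - z $ 3 * w $ 1) + (x $ 6 * y $ 3 - x $ 3 * y $ 6) * (z $ 1 * w $ 2 - z $ 2 * w $ 1)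
      + (x $ 1 * y $ 2 - x $ 2 * y $ 1) * (z $ 6 * w $ 3 - z $ 3 * w $ 6) - (x $ 1 * y $ 3 - x $ 3 * y $ 1) * (z $ 6 * w $ 2 - z $ 2 * w $ 6) + (x $ 2 * y $ 3 - x $ 3 * y $ 2) * (z $ 6 * w $ 1 - z $ 1 * w $ 6)"
    "vol0 [y, z, w, x, axis 5 1, axis 6 1, axis 1 1] =
      (x $ 0 * y $ 2 - x $ 2 * y $ 0) * (z $ 3 * w $ 4 - z $ 4 * w $ 3) - (x $ 0 * y $ 3 - x $ 3 * y $ 0) * (z $ 2 * w $ 4 - z $ 4 * w $ 2) + (x $ 0 * y $ 4 - x $ 4 * y $ 0) * (z $ 2 * w $ 3 - z $ 3 * w $ 2)
      + (x $ 2 * y $ 3 - x $ 3 * y $ 2) * (z $ 0 * w $ 4 - z $ 4 * w $ 0) - (x $ 2 * y $ 4 - x $ 4 * y $ 2) * (z $ 0 * w $ 3 - z $ 3 * w $ 0) + (x $ 3 * y $ 4 - x $ 4 * y $ 3) * (z $ 0 * w $ 2 - z $ 2 * w $ 0)"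
    "vol0 [y, z, w, x, axis 6 1, axis 0 1, axis 2 1] =
      (x $ 1 * y $ 3 - x $ 3 * y $ 1) * (z $ 4 * w $ 5 - z $ 5 * w $ 4) - (x $ 1 * y $ 4 - x $ 4 * y $ 1) * (z $ 3 * w $ 5 - z $ 5 * w $ 3) + (x $ 1 * y $ 5 - x $ 5 * y $ 1) * (z $ 3 * w $ 4 - z $ 4 * w $ 3)
      + (x $ 3 * y $ 4 - x $ 4 * y $ 3) * (z $ 1 * w $ 5 - z $ 5 * w $ 1) - (x $ 3 * y $ 5 - x $ 5 * y $ 3) * (z $ 1 * w $ 4 - z $ 4 * w $ 1) + (x $ 4 * y $ 5 - x $ 5 * y $ 4) * (z $ 1 * w $ 3 - z $ 3 * w $ 1)"
    by (unfold vol0_def; simp add: wedge1_7 axis_nth_if; simp add: wedge1_6 axis_nth_if;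
      simp add: wedge1_5 axis_nth_if; simp only: wedge1_4; simp only: wedge1_3; simp only: wedge1_2 wedge1_1; algebra)+
  have "(\<Sum>i\<in>UNIV. \<Sum>j\<in>UNIV. \<Sum>k\<in>UNIV. phi0 (axis i 1) (axis j 1) (axis k 1) *
      vol0 [axis i 1, axis j 1, axis k 1, x, y, z, w])
    = - (\<Sum>i\<in>UNIV. \<Sum>j\<in>UNIV. \<Sum>k\<in>UNIV. phi0 (axis i 1) (axis j 1) (axis k 1) *
      vol0 [y, z, w, x, axis i 1, axis j 1, axis k 1])"
    by (simp add: vol0_swap3[of "axis i 1" "axis j 1" "axis k 1" x y z w for i j k] sum_negf)
  also have "\<dots> = - (\<Sum>m\<in>UNIV. 6 * vol0 [y, z, w, x, axis m 1, axis (m+1) 1, axis (m+3) 1])"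
    unfolding sum_phi0_axis3 red ..
  also have "\<dots> = 6 * star0 x y z w"
    unfolding sum_7 num_7 add_0 star0_expand V by simp
  finally show ?thesis .
qed

section \<open>Slotwise linearity and metric duality\<close>

lemma multilinear2D:
  assumes "multilinear 2 T" shows "linear (\<lambda>x. T [x, y])" "linear (\<lambda>y. T [x, y])"
  using assms[unfolded multilinear_def, rule_format, of "[x, y]" 0 for x]
    assms[unfolded multilinear_def, rule_format, of "[x, y]" 1 for y] by simp_all

lemma multilinear3D:
  assumes "multilinear 3 T" shows "linear (\<lambda>x. T [x, y, z])" "linear (\<lambda>y. T [x, y, z])" "linear (\<lambda>z. T [x, y, z])"
  using assms[unfolded multilinear_def, rule_format, of "[x, y, z]" 0 for x]
    assms[unfolded multilinear_def, rule_format, of "[x, y, z]" 1 for y]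
    assms[unfolded multilinear_def, rule_format, of "[x, y, z]" 2 for z] by simp_all

text \<open>\<open>sharp\<close> applies the inverse Gram matrix; positivity makes this matrix
  injective, hence invertible.\<close>

lemma met_sharp:
  fixes M :: "('a, 'n::finite, 'z) riemannian_scheme"
  assumes ml: "multilinear 2 (met M c p)" and sym: "\<And>x y. met M c p [x, y] = met M c p [y, x]"
    and pos: "\<And>x. x \<noteq> 0 \<Longrightarrow> met M c p [x, x] > 0" and lin: "linear \<mu>"
  shows "met M c p [sharp M c p \<mu>, y] = \<mu> y"
proof -
  define G where "G = (\<chi> i j. met M c p [axis i 1, axis j 1])"
  have met: "met M c p [x, y] = (G *v x) \<bullet> y" for x y
  proof -
    have "met M c p [x, axis j 1] = (\<Sum>i\<in>UNIV. x $ i * G $ j $ i)" for j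
    proof -
      have "met M c p [x, axis j 1] = (\<Sum>i\<in>UNIV. x $ i *\<^sub>R met M c p [axis i 1, axis j 1])"
        by (rule linear_axis_expand[OF multilinear2D(1)[OF ml]])
      also have "\<dots> = (\<Sum>i\<in>UNIV. x $ i * G $ j $ i)"
        unfolding G_def by (intro sum.cong refl) (simp add: sym[of "axis j 1"])
      finally show ?thesis .
    qed
    then have "(\<Sum>j\<in>UNIV. y $ j *\<^sub>R met M c p [x, axis j 1]) = (G *v x) \<bullet> y"
      by (simp add: inner_vec_def matrix_vector_mult_def mult.commute)
    moreover have "met M c p [x, y] = (\<Sum>j\<in>UNIV. y $ j *\<^sub>R met M c p [x, axis j 1])"
      by (rule linear_axis_expand[OF multilinear2D(2)[OF ml]])
    ultimately show ?thesis by (simp only:)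
  qed
  have "inj ((*v) G)"
  proof (rule injI)
    fix x y assume "G *v x = G *v y"
    then have "G *v (x - y) = 0" by (simp add: matrix_vector_mult_diff_distrib)
    then have "met M c p [x - y, x - y] = 0" by (simp add: met)
    then show "x = y" using pos[of "x - y"] by (cases "x = y") auto
  qed
  then obtain B where "B ** G = mat 1" using matrix_left_invertible_injective by blast
  then have "invertible G" using matrix_left_right_inverse unfolding invertible_def by blast
  then have inv: "G ** matrix_inv G = mat 1"
    unfolding matrix_inv_def invertible_def by (rule someI2_ex) simp
  have "sharp M c p \<mu> = matrix_inv G *v (\<chi> j. \<mu> (axis j 1))"
    by (simp add: sharp_def G_def[symmetric] matrix_vector_mult_def)
  then have "G *v sharp M c p \<mu> = (\<chi> j. \<mu> (axis j 1))"
    by (simp add: matrix_vector_mul_assoc inv)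
  then have "met M c p [sharp M c p \<mu>, y] = (\<Sum>j\<in>UNIV. y $ j * \<mu> (axis j 1))"
    by (simp add: met inner_vec_def mult.commute)
  also have "\<dots> = \<mu> y" by (subst linear_axis_expand[OF lin]) simp
  finally show ?thesis .
qed

text \<open>Orthonormal vectors \<open>n\<close>, \<open>r1\<close>, \<open>r2\<close> with \<open>r2\<close> orthogonal to \<open>n \<times> r1\<close> generate the whole multiplication
  table of the cross product (Cayley--Dickson), so they are the images of \<open>e\<^sub>0\<close>, \<open>e\<^sub>1\<close>, \<open>e\<^sub>2\<close> under an automorphism.\<close>

lemma g2_automorphism_exists:
  assumes n: "n \<bullet> n = (1::real)"
  obtains R :: "real^7 \<Rightarrow> real^7" where "linear R" "R e0 = n" "\<And>x y. R x \<bullet> R y = x \<bullet> y"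
    "\<And>x y z. phi0 (R x) (R y) (R z) = phi0 x y z"
proof -
  have ex: "\<exists>x::real^7. x \<bullet> x = 1 \<and> (\<forall>y\<in>Y. x \<bullet> y = 0)" if "finite Y" "card Y < 7" for Y
  proof -
    have "dim Y < DIM(real^7)" using dim_le_card'[OF that(1)] that(2) by simp
    then obtain x where x: "x \<noteq> 0" "\<And>y. y \<in> span Y \<Longrightarrow> orthogonal x y"
      using orthogonal_to_subspace_exists[of Y] by blast
    then have "(x /\<^sub>R norm x) \<bullet> (x /\<^sub>R norm x) = 1"
      by (simp add: dot_square_norm power2_eq_square)
    moreover have "(x /\<^sub>R norm x) \<bullet> y = 0" if "y \<in> Y" for y
      using x(2)[OF span_base[OF that]] by (simp add: orthogonal_def)
    ultimately show ?thesis by blast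
  qed
  obtain r1 where r1: "r1 \<bullet> r1 = 1" "r1 \<bullet> n = 0" using ex[of "{n}"] by auto
  define r3 where "r3 = cross0 n r1"
  have "card {n, r1, r3} < 7" using card_insert_le_m1[of 4 "{r1,r3}" n] card_insert_le_m1[of 3 "{r3}" r1] by simp
  then obtain r2 where r2: "r2 \<bullet> r2 = 1" "r2 \<bullet> n = 0" "r2 \<bullet> r1 = 0" "r2 \<bullet> r3 = 0" using ex[of "{n, r1, r3}"] by auto
  define r4 where "r4 = cross0 r1 r2"
  define r6 where "r6 = cross0 n r2"
  define r5 where "r5 = cross0 n r4"
  have swap: "cross0 b a = - cross0 a b" for a b by (simp add: cross0_def vec_eq_iff)
  \<comment> \<open>The rules \<open>c2\<close> and \<open>c3\<close> are the cases of equal and of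
    pairwise orthogonal vectors in \<open>cross0_cross0\<close>. With the cyclic symmetry of the
    triple product they yield the products and inner products below.\<close>
  have c2: "cross0 a (cross0 a b) = - b" if "a \<bullet> a = 1" "a \<bullet> b = 0" for a b
  proof -
    have "2 *\<^sub>R cross0 a (cross0 a b) = 2 *\<^sub>R (- b)"
      using cross0_cross0[of a a b] that by (simp add: scaleR_2)
    then show ?thesis by (simp del: scaleR_minus_right)
  qed
  have c3: "cross0 a (cross0 b c) = - cross0 b (cross0 a c)" if "a \<bullet> b = 0" "a \<bullet> c = 0" "b \<bullet> c = 0" for a b c
    using cross0_cross0[of a b c] that by (simp add: eq_neg_iff_add_eq_0)
  have neg: "cross0 a (- b) = - cross0 a b" "cross0 (- a) b = - cross0 a b" for a b
    by (simp_all add: cross0_def vec_eq_iff)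
  have c2': "cross0 a (cross0 b a) = b" if "a \<bullet> a = 1" "a \<bullet> b = 0" for a b
    using c2[OF that] swap[of a b] neg(1)[of a "cross0 a b"] by simp
  have cyc: "cross0 a b \<bullet> c = cross0 c a \<bullet> b" "cross0 a b \<bullet> c = cross0 b c \<bullet> a" for a b c
    using phi0_cycle[of a b c] phi0_cycle[of b c a] by (simp_all add: cross0_inner)
  have self: "cross0 a b \<bullet> a = 0" "cross0 a b \<bullet> b = 0" for a b
    by (simp_all add: cross0_inner phi0_expand algebra_simps)
  note com = inner_commute
  have p01: "cross0 n r1 = r3" and p12: "cross0 r1 r2 = r4" and p02: "cross0 n r2 = r6" and p04: "cross0 n r4 = r5"
    by (simp_all add: r3_def r4_def r5_def r6_def)
  have i: "n \<bullet> r1 = 0" "n \<bullet> r2 = 0" "r1 \<bullet> r2 = 0" "r3 \<bullet> r2 = 0"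
    "n \<bullet> r3 = 0" "r1 \<bullet> r3 = 0" "r1 \<bullet> r4 = 0" "r2 \<bullet> r4 = 0" "n \<bullet> r6 = 0" "r2 \<bullet> r6 = 0" "n \<bullet> r5 = 0" "r4 \<bullet> r5 = 0"
    using r1 r2 self by (simp_all add: com r3_def r4_def r5_def r6_def)
  have p03: "cross0 n r3 = - r1" using c2[of n r1] n i p01 by simp
  have p06: "cross0 n r6 = - r2" using c2[of n r2] n i p02 by simp
  have p13: "cross0 r1 r3 = n" using c2'[of r1 n] r1 i p01 by (simp add: com)
  have p26: "cross0 r2 r6 = n" using c2'[of r2 n] r2 i p02 by (simp add: com)
  have p14: "cross0 r1 r4 = - r2" using c2[of r1 r2] r1 i p12 by simp
  have p24: "cross0 r2 r4 = r1" using c2'[of r2 r1] r2 i p12 by (simp add: com)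
  have i04: "n \<bullet> r4 = 0" using cyc(2)[of n r1 r2] p01 p12 i by (simp add: com)
  have i34: "r3 \<bullet> r4 = 0" using cyc(1)[of r1 r2 r3] p12 swap[of r1 r3] p13 i by (simp add: com)
  have n4: "r4 \<bullet> r4 = 1" using cyc(2)[of r1 r2 r4] p12 p24 r1 by simp
  have n3: "r3 \<bullet> r3 = 1" using cyc(2)[of n r1 r3] p01 p13 n by simp
  have n6: "r6 \<bullet> r6 = 1" using cyc(2)[of n r2 r6] p02 p26 n by simp
  have p05: "cross0 n r5 = - r4" using c2[of n r4] n i04 p04 by simp
  have p45: "cross0 r4 r5 = n" using c2'[of r4 n] n4 i04 p04 by (simp add: com)
  have n5: "r5 \<bullet> r5 = 1" using cyc(2)[of n r4 r5] p04 p45 n by simp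
  have i16: "r1 \<bullet> r6 = 0" using cyc(1)[of n r2 r1] p02 swap[of n r1] p01 i by (simp add: com)
  have i36: "r3 \<bullet> r6 = 0" using cyc(1)[of n r2 r3] p02 swap[of n r3] p03 i by (simp add: com)
  have i46: "r4 \<bullet> r6 = 0" using cyc(2)[of n r2 r4] p02 p24 i by (simp add: com)
  have i15: "r1 \<bullet> r5 = 0" using cyc(1)[of n r4 r1] p04 swap[of n r1] p01 i34 by (simp add: com)
  have i25: "r2 \<bullet> r5 = 0" using cyc(1)[of n r4 r2] p04 swap[of n r2] p02 i46 by (simp add: com)
  have i35: "r3 \<bullet> r5 = 0" using cyc(1)[of n r4 r3] p04 swap[of n r3] p03 i by (simp add: com)
  have i56: "r5 \<bullet> r6 = 0" using cyc(1)[of n r4 r6] p04 swap[of n r6] p06 i by (simp add: com)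
  have p15: "cross0 r1 r5 = r6" using c3[of r1 n r4] p04 p14 p02 i i04 neg[of n] by (simp add: com)
  have p16: "cross0 r1 r6 = - r5" using c3[of r1 n r2] p02 p12 p04 i by (simp add: com)
  have p23: "cross0 r2 r3 = r5" using c3[of r2 n r1] p01 swap[of r1 r2] p12 p04 i neg[of n] by (simp add: com)
  have p25: "cross0 r2 r5 = - r3" using c3[of r2 n r4] p04 p24 p01 i i04 by (simp add: com)
  have p43: "cross0 r4 r3 = - r6" using c3[of r4 n r1] p01 swap[of r1 r4] p14 p02 i i04 neg[of n] by (simp add: com)
  have p34: "cross0 r3 r4 = r6" using swap[of r4 r3] p43 by simp
  have p35: "cross0 r3 r5 = r2" using c3[of r3 n r4] p04 p34 p06 i i04 i34 by (simp add: com)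
  have p36: "cross0 r3 r6 = - r4" using c3[of r3 n r2] p02 swap[of r2 r3] p23 p05 i neg[of n] by (simp add: com)
  have p46: "cross0 r4 r6 = r3" using c3[of r4 n r2] p02 swap[of r2 r4] p24 p01 i i04 neg[of n] by (simp add: com)
  have p56: "cross0 r5 r6 = r1" using c3[of r5 n r2] p02 swap[of r2 r5] p25 p03 i i25 neg[of n] by (simp add: com)
  define R where "R x = x$0 *\<^sub>R n + x$1 *\<^sub>R r1 + x$2 *\<^sub>R r2 + x$3 *\<^sub>R r3 + x$4 *\<^sub>R r4 + x$5 *\<^sub>R r5 + x$6 *\<^sub>R r6" for x :: "real^7"
  have linR: "linear R" by (rule linearI) (simp_all add: R_def algebra_simps)
  have Rax: "R (axis 0 1) = n" "R (axis 1 1) = r1" "R (axis 2 1) = r2" "R (axis 3 1) = r3" "R (axis 4 1) = r4"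
    "R (axis 5 1) = r5" "R (axis 6 1) = r6" by (simp_all add: R_def axis_nth_if)
  note ip = n r1 r2 i n3 n4 n5 n6 i04 i34 i16 i36 i46 i15 i25 i35 i56
  have inner: "R x \<bullet> R y = x \<bullet> y" for x y
    using ip by (simp add: R_def inner_add_left inner_add_right com inner_7[of x y])
  have c0: "cross0 a a = 0" for a by (simp add: cross0_def vec_eq_iff)
  note pp = p01 p12 p02 p04 p03 p06 p13 p26 p14 p24 p05 p45 p15 p16 p23 p25 p34 p35 p36 p46 p56
  have sw: "cross0 r1 n = - r3" "cross0 r2 n = - r6" "cross0 r3 n = r1" "cross0 r4 n = - r5" "cross0 r5 n = r4" "cross0 r6 n = r2"
    "cross0 r2 r1 = - r4" "cross0 r3 r1 = - n" "cross0 r4 r1 = r2" "cross0 r5 r1 = - r6" "cross0 r6 r1 = r5"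
    "cross0 r3 r2 = - r5" "cross0 r4 r2 = - r1" "cross0 r5 r2 = r3" "cross0 r6 r2 = - n"
    "cross0 r4 r3 = - r6" "cross0 r5 r3 = - r2" "cross0 r6 r3 = r4" "cross0 r5 r4 = - n" "cross0 r6 r4 = - r3" "cross0 r6 r5 = - r1"
    by (subst swap, simp add: pp)+
  have "cross0 (R x) (R y) = R (cross0 x y)" for x y
    by (simp add: R_def cross0_add cross0_scale pp sw c0) (simp add: cross0_nth algebra_simps)
  then have "phi0 (R x) (R y) (R z) = phi0 x y z" for x y z
    by (simp add: inner flip: cross0_inner)
  then show thesis using that[OF linR] Rax(1) inner by blast
qed

section \<open>Charts and pullbacks\<close>

context
  fixes M :: "('a, 'n::finite, 'z) manifold_scheme" and c :: "('a, 'n) chart"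
  assumes M: "smooth_manifold M" and c: "c \<in> charts M"
begin

lemma openin_chart: "openin (topo M) (fst c)"
  and open_cimg: "open (cimg c)"
  and homeomorphic_chart: "homeomorphic_map (subtopology (topo M) (fst c)) (top_of_set (cimg c)) (snd c)"
  using M c by (auto simp: smooth_manifold_def)

lemma chart_subset: "fst c \<subseteq> topspace (topo M)"
  using openin_chart by (rule openin_subset)

lemma inj_on_chart: "inj_on (snd c) (fst c)"
  using homeomorphic_imp_injective_map[OF homeomorphic_chart] chart_subset
  by (simp add: Int_absorb1 topspace_subtopology_subset)

lemma cinv_snd: "q \<in> fst c \<Longrightarrow> cinv c (snd c q) = q"
  unfolding cinv_def by (rule inv_into_f_f[OF inj_on_chart])

lemma snd_in_cimg: "q \<in> fst c \<Longrightarrow> snd c q \<in> cimg c"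
  by (simp add: cimg_def)

lemma open_chart_image: "openin (topo M) W \<Longrightarrow> open (snd c ` (fst c \<inter> W))"
proof -
  assume "openin (topo M) W"
  then have "openin (subtopology (topo M) (fst c)) (fst c \<inter> W)"
    by (rule openin_subtopology_Int2)
  then have "openin (top_of_set (cimg c)) (snd c ` (fst c \<inter> W))"
    using homeomorphic_imp_open_map[OF homeomorphic_chart] by (simp add: open_map_def)
  then show ?thesis using openin_open_eq[OF open_cimg] by blast
qed

end

lemma snd_cinv: "w \<in> cimg c \<Longrightarrow> snd c (cinv c w) = w"
  and cinv_in: "w \<in> cimg c \<Longrightarrow> cinv c w \<in> fst c"
  unfolding cimg_def cinv_def by (rule f_inv_into_f, assumption) (rule inv_into_into)

lemma chart_at:
  assumes "smooth_manifold N" "q \<in> topspace (topo N)"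
  shows "chart_at N q \<in> charts N" "q \<in> fst (chart_at N q)"
proof -
  from assms have "\<exists>c. c \<in> charts N \<and> q \<in> fst c"
    unfolding smooth_manifold_def by blast
  from someI_ex[OF this] show "chart_at N q \<in> charts N" "q \<in> fst (chart_at N q)"
    by (auto simp: chart_at_def)
qed

text \<open>Covers both immersions and the identity of a manifold, so that \<iota> and changes of
  charts obey the same chain rule.\<close>

definition smooth_map ::
  "('b, 'm::finite, 'y) manifold_scheme \<Rightarrow> ('a, 'n::finite, 'z) manifold_scheme \<Rightarrow> ('b \<Rightarrow> 'a) \<Rightarrow> bool" where
  "smooth_map M N \<iota> \<longleftrightarrow> continuous_map (topo M) (topo N) \<iota> \<and>
     (\<forall>c\<in>charts M. \<forall>d\<in>charts N. smooth_on (snd c ` (fst c \<inter> \<iota> -` fst d)) (snd d \<circ> \<iota> \<circ> cinv c))"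

lemma immersion_imp_smooth_map: "immersion M N \<iota> \<Longrightarrow> smooth_map M N \<iota>"
  by (simp add: immersion_def smooth_map_def)

lemma smooth_map_id: "smooth_manifold N \<Longrightarrow> smooth_map N N id"
  by (simp add: smooth_manifold_def smooth_map_def vimage_def)

context
  fixes M :: "('b, 'm::finite, 'y) manifold_scheme" and N :: "('a, 'n::finite, 'z) manifold_scheme" and \<iota>
  assumes M: "smooth_manifold M" and N: "smooth_manifold N" and \<iota>: "smooth_map M N \<iota>"
begin

lemma open_overlap:
  assumes c: "c \<in> charts M" and d: "d \<in> charts N"
  shows "open (snd c ` (fst c \<inter> \<iota> -` fst d))"
proof -
  have "openin (topo M) {x \<in> topspace (topo M). \<iota> x \<in> fst d}"
    using \<iota> openin_chart[OF N d] by (simp add: smooth_map_def continuous_map_def)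
  moreover have "fst c \<inter> {x \<in> topspace (topo M). \<iota> x \<in> fst d} = fst c \<inter> \<iota> -` fst d"
    using chart_subset[OF M c] by auto
  ultimately show ?thesis using open_chart_image[OF M c] by metis
qed

lemma smooth_map_has_derivative:
  assumes c: "c \<in> charts M" and d: "d \<in> charts N" and p: "p \<in> fst c" "\<iota> p \<in> fst d"
  shows "((snd d \<circ> \<iota> \<circ> cinv c) has_derivative tangent_map c d \<iota> p) (at (snd c p))"
  unfolding tangent_map_def
proof (rule smooth_on_has_derivative[OF _ open_overlap[OF c d]])
  show "smooth_on (snd c ` (fst c \<inter> \<iota> -` fst d)) (snd d \<circ> \<iota> \<circ> cinv c)"
    using \<iota> c d by (simp add: smooth_map_def)
  show "snd c p \<in> snd c ` (fst c \<inter> \<iota> -` fst d)" using p by simp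
qed

lemma tangent_map_linear:
  "c \<in> charts M \<Longrightarrow> d \<in> charts N \<Longrightarrow> p \<in> fst c \<Longrightarrow> \<iota> p \<in> fst d \<Longrightarrow> linear (tangent_map c d \<iota> p)"
  using smooth_map_has_derivative has_derivative_linear by blast

end

lemma tangent_map_chain:
  fixes M :: "('b, 'm::finite, 'y) manifold_scheme" and N :: "('a, 'n::finite, 'z) manifold_scheme"
  assumes M: "smooth_manifold M" and N: "smooth_manifold N" and \<iota>: "smooth_map M N \<iota>"
    and c: "c \<in> charts M" and d: "d \<in> charts N" "d' \<in> charts N" and p: "p \<in> fst c" "\<iota> p \<in> fst d" "\<iota> p \<in> fst d'"
  shows "tangent_map c d' \<iota> p x = tangent_map d d' id (\<iota> p) (tangent_map c d \<iota> p x)"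
proof -
  let ?U = "snd c ` (fst c \<inter> \<iota> -` fst d)"
  have at: "(snd d \<circ> \<iota> \<circ> cinv c) (snd c p) = snd d (\<iota> p)"
    by (simp add: cinv_snd[OF M c p(1)])
  have "((snd d' \<circ> id \<circ> cinv d) has_derivative tangent_map d d' id (\<iota> p)) (at ((snd d \<circ> \<iota> \<circ> cinv c) (snd c p)))"
    unfolding at using smooth_map_has_derivative[OF N N smooth_map_id[OF N] d] p by simp
  from diff_chain_at[OF smooth_map_has_derivative[OF M N \<iota> c d(1) p(1,2)] this]
  have "((snd d' \<circ> \<iota> \<circ> cinv c) has_derivative (tangent_map d d' id (\<iota> p) \<circ> tangent_map c d \<iota> p)) (at (snd c p))"
  proof (rule has_derivative_transform_within_open[OF _ open_overlap[OF M N \<iota> c d(1)]])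
    show "snd c p \<in> ?U" using p by simp
    fix u assume "u \<in> ?U"
    then obtain q where "q \<in> fst c" "\<iota> q \<in> fst d" "u = snd c q" by auto
    then show "((snd d' \<circ> id \<circ> cinv d) \<circ> (snd d \<circ> \<iota> \<circ> cinv c)) u = (snd d' \<circ> \<iota> \<circ> cinv c) u"
      by (simp add: cinv_snd[OF M c] cinv_snd[OF N d(1)])
  qed
  then show ?thesis
    using has_derivative_unique smooth_map_has_derivative[OF M N \<iota> c d(2) p(1,3)] by (metis comp_apply)
qed

lemma tangent_map_id:
  assumes N: "smooth_manifold N" and d: "d \<in> charts N" and q: "q \<in> fst d"
  shows "tangent_map d d id q x = x"
proof -
  have "((\<lambda>x. x) has_derivative (\<lambda>x. x)) (at (snd d q))" by (rule has_derivative_ident)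
  then have "((snd d \<circ> id \<circ> cinv d) has_derivative (\<lambda>x. x)) (at (snd d q))"
    by (rule has_derivative_transform_within_open[OF _ open_cimg[OF N d] snd_in_cimg[OF N d q]])
      (simp add: snd_cinv)
  then show ?thesis unfolding tangent_map_def by (simp add: frechet_derivative_eqI)
qed

lemma tangent_map_inverse:
  assumes N: "smooth_manifold N" and d: "d \<in> charts N" "d' \<in> charts N" and q: "q \<in> fst d" "q \<in> fst d'"
  shows "tangent_map d' d id q (tangent_map d d' id q x) = x"
  using tangent_map_chain[OF N N smooth_map_id[OF N] d(1) d(2,1) q(1), of x] q tangent_map_id[OF N d(1) q(1)] by simp

text \<open>The transformation law by itself: for \<open>star_phi\<close>, given by pointwise
  choices, it is established before any differentiability.\<close>

definition tensorial :: "('a, 'n::finite, 'z) manifold_scheme \<Rightarrow> nat \<Rightarrow> ('a, 'n) tensor \<Rightarrow> bool" where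
  "tensorial N k T \<longleftrightarrow> (\<forall>d\<in>charts N. \<forall>d'\<in>charts N. \<forall>q\<in>fst d \<inter> fst d'. \<forall>vs. length vs = k \<longrightarrow>
     T d q vs = T d' q (map (tangent_map d d' id q) vs))"

lemma tensor_field_tensorial: "tensor_field N k T \<Longrightarrow> tensorial N k T"
  unfolding tensor_field_def tensorial_def by blast

lemma tensorialD: "tensorial N k T \<Longrightarrow> d \<in> charts N \<Longrightarrow> d' \<in> charts N \<Longrightarrow> q \<in> fst d \<Longrightarrow> q \<in> fst d' \<Longrightarrow>
   length vs = k \<Longrightarrow> T d q vs = T d' q (map (tangent_map d d' id q) vs)"
  unfolding tensorial_def by blast

text \<open>\<open>pullback\<close> may switch the ambient chart from point to point. To
  differentiate it, one chart has to be kept near the point, which the transformation law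
  permits.\<close>

lemma pullback_eq:
  fixes M :: "('b, 'm::finite, 'y) manifold_scheme" and N :: "('a, 'n::finite, 'z) manifold_scheme"
  assumes M: "smooth_manifold M" and N: "smooth_manifold N" and \<iota>: "smooth_map M N \<iota>"
    and c: "c \<in> charts M" and d: "d \<in> charts N" and p: "p \<in> fst c" "\<iota> p \<in> fst d"
    and T: "tensorial N k T" and vs: "length vs = k"
  shows "pullback N \<iota> T c p vs = T d (\<iota> p) (map (tangent_map c d \<iota> p) vs)"
proof -
  let ?d = "chart_at N (\<iota> p)"
  have q: "\<iota> p \<in> topspace (topo N)" using chart_subset[OF N d] p by blast
  note ch = chart_at[OF N q]
  have "pullback N \<iota> T c p vs = T d (\<iota> p) (map (tangent_map ?d d id (\<iota> p)) (map (tangent_map c ?d \<iota> p) vs))"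
    unfolding pullback_def Let_def using tensorialD[OF T ch(1) d ch(2) p(2)] vs by simp
  also have "map (tangent_map ?d d id (\<iota> p)) (map (tangent_map c ?d \<iota> p) vs) = map (tangent_map c d \<iota> p) vs"
    using tangent_map_chain[OF M N \<iota> c ch(1) d p(1) ch(2) p(2)] by simp
  finally show ?thesis .
qed

lemma pullback_contr_eq:
  fixes M :: "('b, 'm::finite, 'y) manifold_scheme" and N :: "('a, 'n::finite, 'z) riemannian_scheme"
  assumes M: "smooth_manifold M" and N: "smooth_manifold N" and \<iota>: "smooth_map M N \<iota>"
    and c: "c \<in> charts M" and d: "d \<in> charts N" and p: "p \<in> fst c" "\<iota> p \<in> fst d"
    and T: "tensorial N (Suc k) T" and vs: "length vs = k" and n: "unit_normal N M \<iota> n"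
  shows "pullback_contr N \<iota> n T c p vs = T d (\<iota> p) (n d p # map (tangent_map c d \<iota> p) vs)"
proof -
  let ?d = "chart_at N (\<iota> p)"
  have q: "\<iota> p \<in> topspace (topo N)" using chart_subset[OF N d] p by blast
  note ch = chart_at[OF N q]
  have nd: "n d p = tangent_map ?d d id (\<iota> p) (n ?d p)"
    using n ch c p d unfolding unit_normal_def by blast
  have "pullback_contr N \<iota> n T c p vs =
    T d (\<iota> p) (map (tangent_map ?d d id (\<iota> p)) (n ?d p # map (tangent_map c ?d \<iota> p) vs))"
    unfolding pullback_contr_def Let_def using tensorialD[OF T ch(1) d ch(2) p(2)] vs by simp
  also have "map (tangent_map ?d d id (\<iota> p)) (n ?d p # map (tangent_map c ?d \<iota> p) vs) = n d p # map (tangent_map c d \<iota> p) vs"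
    using tangent_map_chain[OF M N \<iota> c ch(1) d p(1) ch(2) p(2)] nd by simp
  finally show ?thesis .
qed

section \<open>The $G_2$-structure at a point of a chart\<close>

definition g2_iso :: "'a g2 \<Rightarrow> ('a, 7) chart \<Rightarrow> 'a \<Rightarrow> (real^7 \<Rightarrow> real^7) \<Rightarrow> bool" where
  "g2_iso N d q F \<longleftrightarrow> linear F \<and> (\<forall>x y. met N d q [F x, F y] = x \<bullet> y) \<and>
     (\<forall>x y z. phi N d q [F x, F y, F z] = phi0 x y z)"

lemma wedge1_compose:
  assumes "length fs = length vs"
  shows "wedge1 (map (\<lambda>f v. f (h v)) fs) vs = wedge1 fs (map h vs)"
proof -
  have "(\<Prod>j<length vs. (map (\<lambda>f v. f (h v)) fs ! j) (vs ! \<sigma> j)) = (\<Prod>j<length vs. (fs ! j) (map h vs ! \<sigma> j))"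
    if "\<sigma> permutes {..<length vs}" for \<sigma>
    using assms permutes_in_image[OF that] by (intro prod.cong) auto
  then show ?thesis by (simp add: wedge1_def)
qed

locale g2_chart =
  fixes N :: "'a g2" and d :: "('a, 7) chart" and q :: 'a
  assumes N: "g2_manifold N" and d: "d \<in> charts N" and q: "q \<in> fst d"
begin

lemma smooth: "smooth_manifold N" and tensor_met: "tensor_field N 2 (met N)" and tensor_phi: "tensor_field N 3 (phi N)"
  using N by (auto simp: g2_manifold_def riemannian_manifold_def form_field_def)

lemma ml_met: "multilinear 2 (met N d q)" and ml_phi: "multilinear 3 (phi N d q)"
  using tensor_met tensor_phi d q by (auto simp: tensor_field_def)

lemma met_sym: "met N d q [x, y] = met N d q [y, x]" and met_pos: "x \<noteq> 0 \<Longrightarrow> met N d q [x, x] > 0"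
  using N d q by (auto simp: g2_manifold_def riemannian_manifold_def)

lemmas met_lin = multilinear2D[OF ml_met]
lemmas phi_lin = multilinear3D[OF ml_phi]

lemma sharp: "linear \<mu> \<Longrightarrow> met N d q [sharp N d q \<mu>, y] = \<mu> y"
  by (rule met_sharp[OF ml_met met_sym met_pos])

lemma met_eqI: "(\<And>z. met N d q [x, z] = met N d q [y, z]) \<Longrightarrow> x = y"
  using met_pos[of "x - y"] linear_diff[OF met_lin(1), of x y] by (metis eq_iff_diff_eq_0 less_irrefl)

lemma met_cross: "met N d q [cross N d q x y, z] = phi N d q [x, y, z]"
  unfolding cross_def by (rule sharp[OF phi_lin(3)])

lemma adapted_g2_iso:
  assumes "adapted N d q e" shows "g2_iso N d q (\<lambda>x. \<Sum>i\<in>UNIV. x $ i *\<^sub>R e i)"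
proof -
  let ?F = "\<lambda>x. \<Sum>i\<in>UNIV. x $ i *\<^sub>R e i"
  have flat: "flat N d q (e i) (?F x) = x $ i" for i x
  proof -
    have on: "met N d q [e i, e j] = (if i = j then 1 else 0)" for i j
      using assms unfolding adapted_def orthonormal_def by blast
    show ?thesis
      by (simp add: flat_def linear_sum[OF met_lin(2)] linear_scale[OF met_lin(2)] on if_distrib cong: if_cong)
  qed
  have "linear ?F" by (rule linearI) (simp_all add: algebra_simps sum.distrib scaleR_sum_right)
  moreover have "met N d q [?F x, ?F y] = x \<bullet> y" for x y
    using flat[of _ y, unfolded flat_def]
    by (simp add: linear_sum[OF met_lin(1)] linear_scale[OF met_lin(1)] inner_vec_def)
  moreover have "phi N d q [?F x, ?F y, ?F z] = phi0 x y z" for x y z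
    using assms by (simp add: adapted_def wedge1_3 wedge1_2 wedge1_1 flat phi0_def algebra_simps)
  ultimately show ?thesis unfolding g2_iso_def by blast
qed

lemma g2_iso_surj: assumes "g2_iso N d q F" obtains x where "v = F x"
proof -
  have lin: "linear F" and met: "\<And>x y. met N d q [F x, F y] = x \<bullet> y" using assms by (auto simp: g2_iso_def)
  have "inj F"
  proof (rule injI)
    fix x y assume "F x = F y"
    then have "x \<bullet> z = y \<bullet> z" for z using met[of x z] met[of y z] by simp
    then show "x = y" using vector_eq_rdot by blast
  qed
  then have "surj F" using linear_injective_imp_surjective[OF lin] by blast
  then show ?thesis using that by blast
qed

lemma cross_g2_iso:
  assumes F: "g2_iso N d q F" shows "cross N d q (F x) (F y) = F (cross0 x y)"
proof (rule met_eqI)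
  fix z
  obtain z' where "z = F z'" by (rule g2_iso_surj[OF F])
  then show "met N d q [cross N d q (F x) (F y), z] = met N d q [F (cross0 x y), z]"
    using F by (simp add: met_cross g2_iso_def cross0_inner)
qed

end

text \<open>\<open>g2_manifold\<close> provides frames in some suitable chart; this carries them to
  any other chart around the point.\<close>

lemma adapted_chart:
  assumes N: "g2_manifold N" and c: "c \<in> charts N" and d: "d \<in> charts N" and cd: "q \<in> fst c" "q \<in> fst d"
    and e: "adapted N c q e"
  shows "adapted N d q (\<lambda>i. tangent_map c d id q (e i))"
proof -
  interpret g2_chart N d q using N d cd(2) by unfold_locales
  let ?t = "tangent_map c d id q" and ?s = "tangent_map d c id q"
  have met: "met N c q [x, y] = met N d q [?t x, ?t y]" for x y
    using tensorialD[OF tensor_field_tensorial[OF tensor_met] c d cd] by simp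
  have ts: "?t (?s x) = x" for x
    by (rule tangent_map_inverse[OF smooth d c cd(2,1)])
  have "orthonormal N d q (\<lambda>i. ?t (e i))"
    using e by (simp add: adapted_def orthonormal_def flip: met)
  moreover have "phi N d q vs = (\<Sum>i\<in>UNIV. wedge1 [flat N d q (?t (e i)), flat N d q (?t (e (i + 1))), flat N d q (?t (e (i + 3)))] vs)"
    if vs: "length vs = 3" for vs
  proof -
    have flat: "flat N d q (?t x) = (\<lambda>v. flat N c q x (?s v))" for x
      by (simp add: flat_def met ts)
    have "phi N d q vs = phi N c q (map ?s vs)"
      using tensorialD[OF tensor_field_tensorial[OF tensor_phi] d c cd(2,1)] vs by simp
    also have "\<dots> = (\<Sum>i\<in>UNIV. wedge1 [flat N c q (e i), flat N c q (e (i + 1)), flat N c q (e (i + 3))] (map ?s vs))"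
      using e vs by (simp add: adapted_def)
    also have "\<dots> = (\<Sum>i\<in>UNIV. wedge1 [flat N d q (?t (e i)), flat N d q (?t (e (i + 1))), flat N d q (?t (e (i + 3)))] vs)"
      using wedge1_compose[of "[f, g, h]" vs ?s for f g h] vs by (simp add: flat)
    finally show ?thesis .
  qed
  ultimately show ?thesis unfolding adapted_def by blast
qed

context g2_chart begin

lemma adapted_exists: obtains e where "adapted N d q e"
proof -
  have "q \<in> topspace (topo N)" using chart_subset[OF smooth d] q by blast
  then obtain c W e where "c \<in> charts N" "q \<in> W" "W \<subseteq> fst c" "\<forall>q'\<in>W. adapted N c q' (e q')"
    using N unfolding g2_manifold_def by metis
  then show ?thesis using that adapted_chart[OF N _ d _ q] by blast
qed

text \<open>Unlike the definition by an adapted frame, this expression of \<open>*\<phi>\<close> shows that it is a tensor.\<close>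

lemma star_phi_cross:
  "star_phi N d q [x, y, z, w] = - (met N d q [cross N d q x y, cross N d q z w]
     - met N d q [x, z] * met N d q [y, w] + met N d q [x, w] * met N d q [y, z])"
proof -
  let ?e = "g2_frame N d q"
  obtain e where "adapted N d q e" by (rule adapted_exists)
  then have e: "adapted N d q ?e" unfolding g2_frame_def by (rule someI[of "adapted N d q"])
  define F where "F = (\<lambda>x. \<Sum>i\<in>UNIV. x $ i *\<^sub>R ?e i)"
  have F: "g2_iso N d q F" unfolding F_def by (rule adapted_g2_iso[OF e])
  have met: "met N d q [F x, F y] = x \<bullet> y" and phi: "phi N d q [F x, F y, F z] = phi0 x y z" for x y z
    using F by (auto simp: g2_iso_def)
  have Fax: "F (axis i 1) = ?e i" for i
    by (simp add: F_def axis_nth_if if_distrib[of "\<lambda>a. a *\<^sub>R _"] cong: if_cong)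
  have flat: "flat N d q (?e i) (F x) = x $ i" for i x
    using met[of "axis i 1" x] by (simp add: flat_def Fax inner_axis')
  have vol: "g2_vol N d q (map F vs) = vol0 vs" if "length vs = 7" for vs
    using wedge1_compose[of "map (\<lambda>i. flat N d q (?e i)) [0, 1, 2, 3, 4, 5, 6]" vs F] that
    by (simp add: g2_vol_def vol0_def flat)
  have star: "star_phi N d q [F x, F y, F z, F w] = star0 x y z w" for x y z w
  proof -
    have "star_phi N d q [F x, F y, F z, F w] =
      (\<Sum>i\<in>UNIV. \<Sum>j\<in>UNIV. \<Sum>k\<in>UNIV. phi N d q [?e i, ?e j, ?e k] * g2_vol N d q [?e i, ?e j, ?e k, F x, F y, F z, F w]) / 6"
      by (simp add: star_phi_def hodge_def numeral_3_eq_3 sum_lists_length_Suc sum_lists_length_0[simplified] fact_Suc)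
    also have "\<dots> = (\<Sum>i\<in>UNIV. \<Sum>j\<in>UNIV. \<Sum>k\<in>UNIV. phi0 (axis i 1) (axis j 1) (axis k 1) *
      vol0 [axis i 1, axis j 1, axis k 1, x, y, z, w]) / 6"
      using vol[of "[axis i 1, axis j 1, axis k 1, x, y, z, w]" for i j k] by (simp add: phi Fax[symmetric])
    finally show ?thesis by (simp add: phi0_wedge_vol0)
  qed
  obtain x' y' z' w' where "x = F x'" "y = F y'" "z = F z'" "w = F w'"
    using g2_iso_surj[OF F] by metis
  then show ?thesis by (simp add: star cross_g2_iso[OF F] met star0_cross0)
qed

lemma star_phi_g2_iso: "g2_iso N d q F \<Longrightarrow> star_phi N d q [F x, F y, F z, F w] = star0 x y z w"
  by (simp add: star_phi_cross cross_g2_iso star0_cross0) (simp add: g2_iso_def)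

lemma linear_mult_const: "linear f \<Longrightarrow> linear (\<lambda>x. f x * a)" for f :: "'v::real_vector \<Rightarrow> real"
  by (auto intro!: linearI simp: linear_add linear_scale algebra_simps)

lemma linear_wedge1_last:
  assumes "\<And>f. f \<in> set fs \<Longrightarrow> linear f" "length fs = Suc (length vs)"
  shows "linear (\<lambda>v. wedge1 fs (vs @ [v]))"
proof -
  obtain as a where fs: "fs = as @ [a]" using assms(2) by (cases fs rule: rev_cases) auto
  have lin: "linear a" "\<And>b. b < length as \<Longrightarrow> linear (as ! b)" using assms(1) by (auto simp: fs)
  have "linear (\<lambda>v. a v * wedge1 as vs - (\<Sum>b<length vs. (as ! b) v * wedge1 (as[b := a]) vs))"
    using assms(2) by (intro linear_compose_sub linear_compose_sum ballI linear_mult_const lin) (auto simp: fs)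
  then show ?thesis using assms(2) by (simp add: fs wedge1_snoc)
qed

text \<open>A Hodge star that produces a one-form feeds its argument into the last slot of the
  volume form, which is linear whatever form is dualised. By linearity, \<open>p_phi\<close>
  represents this one-form.\<close>

lemma linear_pdstar_phi: "linear (\<lambda>x. pdstar_phi N d q [x])"
proof -
  have flat: "linear (flat N d q v)" for v unfolding flat_def by (rule met_lin(2))
  have "linear (\<lambda>x. g2_vol N d q (us @ [x]))" if "length us = 6" for us
    unfolding g2_vol_def by (rule linear_wedge1_last) (use flat that in auto)
  then have "linear (\<lambda>x. \<Sum>is | length is = 6. g2_vol N d q (map (g2_frame N d q) is @ [x]) * (\<alpha> is / fact 6))" for \<alpha>
    by (intro linear_compose_sum ballI linear_mult_const) simp
  moreover have "hodge N d q \<beta> [x] = (\<Sum>is | length is = 6. g2_vol N d q (map (g2_frame N d q) is @ [x])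
      * (\<beta> (map (g2_frame N d q) is) / fact 6))" for \<beta> x
    by (simp add: hodge_def sum_divide_distrib mult.commute)
  ultimately show ?thesis by (simp only: pdstar_phi_def)
qed

lemma met_p_phi: "met N d q [p_phi N d q, x] = pdstar_phi N d q [x]"
  unfolding p_phi_def by (rule sharp[OF linear_pdstar_phi])

end

lemma multilinear4I:
  assumes "\<And>y z w. linear (\<lambda>x. T [x, y, z, w])" "\<And>x z w. linear (\<lambda>y. T [x, y, z, w])"
    "\<And>x y w. linear (\<lambda>z. T [x, y, z, w])" "\<And>x y z. linear (\<lambda>w. T [x, y, z, w])"
  shows "multilinear 4 T"
  unfolding multilinear_def
proof (intro allI impI)
  fix vs :: "'a list" and i :: nat assume *: "length vs = 4 \<and> i < 4"
  then obtain x y z w where vs: "vs = [x, y, z, w]"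
    by (auto simp: numeral_eq_Suc length_Suc_conv)
  from * consider "i = 0" | "i = 1" | "i = 2" | "i = 3" by linarith
  then show "linear (\<lambda>v. T (vs[i := v]))"
    by cases (simp_all add: vs assms numeral_eq_Suc)
qed

context g2_chart begin

lemma linear_cross: "linear (\<lambda>x. cross N d q x y)" "linear (cross N d q x)"
  by (rule linearI; rule met_eqI; simp add: met_cross linear_simps[OF met_lin(1)]
    linear_simps[OF phi_lin(1)] linear_simps[OF phi_lin(2)])+

lemma ml_star: "multilinear 4 (star_phi N d q)"
  by (rule multilinear4I; rule linearI; simp add: star_phi_cross linear_simps[OF met_lin(1)]
    linear_simps[OF met_lin(2)]
    linear_simps[OF linear_cross(1)] linear_simps[OF linear_cross(2)]
    algebra_simps)

end

lemma cross_tangent_map: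
  assumes N: "g2_manifold N" and dd: "d \<in> charts N" "d' \<in> charts N" and qq: "q \<in> fst d" "q \<in> fst d'"
  shows "cross N d' q (tangent_map d d' id q x) (tangent_map d d' id q y) = tangent_map d d' id q (cross N d q x y)"
proof -
  interpret d: g2_chart N d q using N dd qq by unfold_locales
  interpret d': g2_chart N d' q using N dd qq by unfold_locales
  let ?t = "tangent_map d d' id q"
  have met: "met N d q [x, y] = met N d' q [?t x, ?t y]" for x y
    using tensorialD[OF tensor_field_tensorial[OF d.tensor_met] dd qq] by simp
  have phi: "phi N d q [x, y, z] = phi N d' q [?t x, ?t y, ?t z]" for x y z
    using tensorialD[OF tensor_field_tensorial[OF d.tensor_phi] dd qq] by simp
  show ?thesis
  proof (rule d'.met_eqI)
    fix z
    have z: "z = ?t (tangent_map d' d id q z)"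
      by (rule tangent_map_inverse[OF d.smooth dd(2,1) qq(2,1), symmetric])
    show "met N d' q [cross N d' q (?t x) (?t y), z] = met N d' q [?t (cross N d q x y), z]"
      by (subst (1 2) z) (simp add: d'.met_cross d.met_cross flip: met phi)
  qed
qed

lemma tensorial_star_phi:
  assumes N: "g2_manifold N" shows "tensorial N 4 (star_phi N)"
  unfolding tensorial_def
proof (intro ballI allI impI)
  fix d d' q and vs :: "(real^7) list"
  assume dd: "d \<in> charts N" "d' \<in> charts N" and "q \<in> fst d \<inter> fst d'" and "length vs = 4"
  then obtain x y z w where vs: "vs = [x, y, z, w]" and qq: "q \<in> fst d" "q \<in> fst d'"
    by (auto simp: numeral_eq_Suc length_Suc_conv)
  interpret d: g2_chart N d q using N dd qq by unfold_locales
  interpret d': g2_chart N d' q using N dd qq by unfold_locales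
  let ?t = "tangent_map d d' id q"
  have met: "met N d' q [?t x, ?t y] = met N d q [x, y]" for x y
    using tensorialD[OF tensor_field_tensorial[OF d.tensor_met] dd qq] by simp
  show "star_phi N d q vs = star_phi N d' q (map ?t vs)"
    by (simp add: vs d.star_phi_cross d'.star_phi_cross cross_tangent_map[OF N dd qq] met)
qed

section \<open>Differentiability of an adapted frame and of the dual form\<close>

context g2_chart begin

text \<open>The smooth frame lives in a chart \<open>c\<close> of its own; transporting it to
  \<open>d\<close> applies the derivative of the change of charts, which is itself
  differentiable.\<close>

lemma moving_frame:
  obtains W E where "open W" "snd d q \<in> W" "W \<subseteq> cimg d" "\<And>w. w \<in> W \<Longrightarrow> adapted N d (cinv d w) (E w)"
    "\<And>i. (\<lambda>w. E w i) differentiable (at (snd d q))"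
proof -
  have "q \<in> topspace (topo N)" using chart_subset[OF smooth d] q by blast
  then obtain c W0 e where c: "c \<in> charts N" and W0: "openin (topo N) W0" "q \<in> W0" "W0 \<subseteq> fst c"
    and e: "\<And>i. smooth_on (snd c ` W0) (\<lambda>u. e (cinv c u) i)" "\<And>q'. q' \<in> W0 \<Longrightarrow> adapted N c q' (e q')"
    using N unfolding g2_manifold_def by metis
  have qc: "q \<in> fst c" using W0 by blast
  define W where "W = snd d ` (fst d \<inter> W0)"
  define E where "E w i = tangent_map c d id (cinv d w) (e (cinv d w) i)" for w i
  note id = smooth_map_id[OF smooth]
  have W: "open W" "snd d q \<in> W" "W \<subseteq> cimg d"
    using open_chart_image[OF smooth d W0(1)] W0(2) q by (auto simp: W_def cimg_def)
  have in_W: "cinv d w \<in> fst d" "cinv d w \<in> W0" "cinv d w \<in> fst c" if "w \<in> W" for w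
    using that W0(3) cinv_snd[OF smooth d] by (auto simp: W_def)
  have "adapted N d (cinv d w) (E w)" if "w \<in> W" for w
    using adapted_chart[OF N c d in_W(3)[OF that] in_W(1)[OF that] e(2)[OF in_W(2)[OF that]]]
    by (simp add: E_def[abs_def])
  moreover have "(\<lambda>w. E w i) differentiable (at (snd d q))" for i
  proof -
    define \<tau> where "\<tau> = snd d \<circ> id \<circ> cinv c"
    define \<sigma> where "\<sigma> = snd c \<circ> id \<circ> cinv d"
    \<comment> \<open>The transported frame as a function on the chart \<open>c\<close>; composition
      with the change of charts \<open>\<sigma>\<close> gives \<open>E\<close>.\<close>
    define h where "h u = frechet_derivative \<tau> (at u) (e (cinv c u) i)" for u
    let ?S = "snd c ` (fst c \<inter> id -` fst d)"
    have S: "open ?S" "snd c q \<in> ?S" using open_overlap[OF smooth smooth id c d] q qc by auto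
    have \<tau>: "smooth_on ?S \<tau>" using id c d by (simp add: smooth_map_def \<tau>_def)
    have oW0: "open (snd c ` W0)" using open_chart_image[OF smooth c W0(1)] W0(3) by (simp add: Int_absorb1)
    have dh: "h differentiable (at (snd c q))"
      unfolding differentiable_componentwise_within[of h]
    proof
      fix b :: "real^7" assume "b \<in> Basis"
      have 1: "linear (\<lambda>v. frechet_derivative \<tau> (at u) v \<bullet> b)" if "u \<in> ?S" for u
        using linear_compose[OF has_derivative_linear[OF smooth_on_has_derivative[OF \<tau> S(1) that]]
            bounded_linear.linear[OF bounded_linear_inner_left[of b]]] by (simp add: o_def)
      have 2: "((\<lambda>u. frechet_derivative \<tau> (at u) v \<bullet> b) has_derivative
          (\<lambda>x. frechet_derivative (\<lambda>u. frechet_derivative \<tau> (at u) v) (at (snd c q)) x \<bullet> b)) (at (snd c q))" for v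
        by (rule has_derivative_inner_left[OF smooth_on_has_derivative[OF smooth_on_frechet_derivative[OF \<tau>] S]])
      have 3: "((\<lambda>u. e (cinv c u) i) has_derivative frechet_derivative (\<lambda>u. e (cinv c u) i) (at (snd c q))) (at (snd c q))"
        by (rule smooth_on_has_derivative[OF e(1) oW0]) (use W0(2) in simp)
      show "(\<lambda>x. h x \<bullet> b) differentiable (at (snd c q))"
        using has_derivative_linear_slot[OF S 1 2 3] unfolding differentiable_def h_def by blast
    qed
    have d\<sigma>: "\<sigma> differentiable (at (snd d q))"
      using smooth_map_has_derivative[OF smooth smooth id d c q] qc unfolding \<sigma>_def differentiable_def by auto
    have "\<sigma> (snd d q) = snd c q" by (simp add: \<sigma>_def cinv_snd[OF smooth d q])
    with dh d\<sigma> have "(h \<circ> \<sigma>) differentiable (at (snd d q))"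
      by (intro differentiable_chain_at) simp_all
    then obtain D where "((h \<circ> \<sigma>) has_derivative D) (at (snd d q))" unfolding differentiable_def by blast
    then have "((\<lambda>w. E w i) has_derivative D) (at (snd d q))"
    proof (rule has_derivative_transform_within_open[OF _ W(1,2)])
      fix w assume w: "w \<in> W"
      have "cinv c (snd c (cinv d w)) = cinv d w" by (rule cinv_snd[OF smooth c in_W(3)[OF w]])
      then show "(h \<circ> \<sigma>) w = E w i"
        by (simp add: h_def \<sigma>_def E_def tangent_map_def \<tau>_def)
    qed
    then show ?thesis unfolding differentiable_def by blast
  qed
  ultimately show ?thesis using that W by blast
qed

lemma met_has_derivative:
  "length vs = 2 \<Longrightarrow> (\<lambda>w. met N d (cinv d w) vs) differentiable (at (snd d q))"
  and phi_has_derivative: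
  "length vs' = 3 \<Longrightarrow> (\<lambda>w. phi N d (cinv d w) vs') differentiable (at (snd d q))"
proof -
  have *: "(\<lambda>w. T d (cinv d w) vs) differentiable (at (snd d q))" if "tensor_field N k T" "length vs = k" for T k vs
  proof -
    have "smooth_on (cimg d) (\<lambda>w. T d (cinv d w) vs)" using that d by (auto simp: tensor_field_def)
    from smooth_on_has_derivative[OF this open_cimg[OF smooth d] snd_in_cimg[OF smooth d q]]
    show ?thesis unfolding differentiable_def by blast
  qed
  show "length vs = 2 \<Longrightarrow> (\<lambda>w. met N d (cinv d w) vs) differentiable (at (snd d q))" by (rule *[OF tensor_met])
  show "length vs' = 3 \<Longrightarrow> (\<lambda>w. phi N d (cinv d w) vs') differentiable (at (snd d q))" by (rule *[OF tensor_phi])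
qed

text \<open>The frames chosen in \<open>star_phi\<close> may jump from point to point. In a
  differentiable adapted frame the arguments have differentiable coordinates, and
  \<open>star_phi\<close> is the polynomial \<open>star0\<close> in them.\<close>

lemma star_has_derivative:
  assumes "length vs = 4" shows "(\<lambda>w. star_phi N d (cinv d w) vs) differentiable (at (snd d q))"
proof -
  obtain x y z v where vs: "vs = [x, y, z, v]" using assms by (auto simp: numeral_eq_Suc length_Suc_conv)
  obtain W E where W: "open W" "snd d q \<in> W" "W \<subseteq> cimg d" "\<And>w. w \<in> W \<Longrightarrow> adapted N d (cinv d w) (E w)"
    and E: "\<And>i. (\<lambda>w. E w i) differentiable (at (snd d q))" by (rule moving_frame) blast
  define X where "X a w = (\<chi> i. met N d (cinv d w) [a, E w i])" for a w
  have dX: "(\<lambda>w. X a w $ i) differentiable (at (snd d q))" for a i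
  proof -
    have 1: "linear (\<lambda>b. met N d (cinv d w) [a, b])" if "w \<in> cimg d" for w
    proof -
      interpret w: g2_chart N d "cinv d w" using N d cinv_in[OF that] by unfold_locales
      show ?thesis by (rule w.met_lin)
    qed
    have 2: "((\<lambda>w. met N d (cinv d w) [a, b]) has_derivative frechet_derivative (\<lambda>w. met N d (cinv d w) [a, b]) (at (snd d q))) (at (snd d q))" for b
      using met_has_derivative[of "[a, b]"] by (simp add: frechet_derivative_works)
    have 3: "((\<lambda>w. E w i) has_derivative frechet_derivative (\<lambda>w. E w i) (at (snd d q))) (at (snd d q))"
      using E[of i] by (simp add: frechet_derivative_works)
    show ?thesis
      using has_derivative_linear_slot[OF open_cimg[OF smooth d] snd_in_cimg[OF smooth d q] 1 2 3]
      unfolding differentiable_def X_def by auto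
  qed
  have "(\<lambda>w. star0 (X x w) (X y w) (X z w) (X v w)) differentiable (at (snd d q))"
    unfolding star0_expand by (intro derivative_intros dX)
  then obtain D where "((\<lambda>w. star0 (X x w) (X y w) (X z w) (X v w)) has_derivative D) (at (snd d q))"
    unfolding differentiable_def by blast
  then have "((\<lambda>w. star_phi N d (cinv d w) vs) has_derivative D) (at (snd d q))"
  proof (rule has_derivative_transform_within_open[OF _ W(1,2)])
    fix w assume w: "w \<in> W"
    interpret w: g2_chart N d "cinv d w" using N d cinv_in[OF subsetD[OF W(3) w]] by unfold_locales
    let ?F = "\<lambda>x. \<Sum>i\<in>UNIV. x $ i *\<^sub>R E w i"
    have F: "g2_iso N d (cinv d w) ?F" by (rule w.adapted_g2_iso[OF W(4)[OF w]])
    have "?F (X a w) = a" for a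
      using orthonormal_expand[of "\<lambda>x y. met N d (cinv d w) [x, y]" "E w" a] w.met_lin(1) W(4)[OF w]
      unfolding X_def adapted_def orthonormal_def by simp
    then show "star0 (X x w) (X y w) (X z w) (X v w) = star_phi N d (cinv d w) vs"
      using w.star_phi_g2_iso[OF F, of "X x w" "X y w" "X z w" "X v w"] by (simp add: vs)
  qed
  then show ?thesis unfolding differentiable_def by blast
qed

end

text \<open>The Koszul formula, with an abstract derivative \<open>D\<close> of the metric, so that
  it applies to the ambient and to the induced metric.\<close>

lemma met_christoffel:
  fixes M :: "('a, 'n::finite, 'z) riemannian_scheme"
  assumes ml: "multilinear 2 (met M c p)" and sym: "\<And>x y. met M c p [x, y] = met M c p [y, x]"
    and pos: "\<And>x. x \<noteq> 0 \<Longrightarrow> met M c p [x, x] > 0"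
    and D: "\<And>x y z. deriv_along c (\<lambda>q. met M c q [y, z]) p x = D x y z"
    and lin: "\<And>x y. linear (D x y)" "\<And>y z. linear (\<lambda>x. D x y z)"
  shows "met M c p [christoffel M c p x y, z] = (D x y z + D y x z - D z x y) / 2"
  unfolding christoffel_def D
proof (rule met_sharp[OF ml sym pos])
  show "linear (\<lambda>z. (D x y z + D y x z - D z x y) / 2)"
    by (rule linearI) (simp_all add: linear_simps[OF lin(1)] linear_simps[OF lin(2)] field_simps)
qed

lemma frechet_derivative_cong_open:
  assumes "open U" "x \<in> U" "\<And>y. y \<in> U \<Longrightarrow> f y = g y"
  shows "frechet_derivative f (at x) = frechet_derivative g (at x)"
proof -
  have "(f has_derivative D) (at x) \<longleftrightarrow> (g has_derivative D) (at x)" for D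
    using has_derivative_transform_within_open[OF _ assms(1,2), of f D UNIV g]
      has_derivative_transform_within_open[OF _ assms(1,2), of g D UNIV f] assms(3) by auto
  then show ?thesis unfolding frechet_derivative_def by simp
qed

lemma multilinear_update:
  assumes "multilinear k T" "length vs = k" "i < k"
  shows "T (vs[i := a + b]) = T (vs[i := a]) + T (vs[i := b])" "T (vs[i := r *\<^sub>R a]) = r * T (vs[i := a])"
    "T (vs[i := a - b]) = T (vs[i := a]) - T (vs[i := b])" "T (vs[i := 0]) = 0"
proof -
  have lin: "linear (\<lambda>v. T (vs[i := v]))" using assms by (simp add: multilinear_def)
  show "T (vs[i := a + b]) = T (vs[i := a]) + T (vs[i := b])" "T (vs[i := r *\<^sub>R a]) = r * T (vs[i := a])"
    "T (vs[i := a - b]) = T (vs[i := a]) - T (vs[i := b])" "T (vs[i := 0]) = 0"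
    using linear_add[OF lin, of a b] linear_scale[OF lin, of r a] linear_diff[OF lin, of a b] linear_0[OF lin] by simp_all
qed

section \<open>Hypersurfaces in a $G_2$-manifold\<close>

locale hypersurface =
  fixes N :: "'a g2" and M :: "('b, 6) manifold" and \<iota> :: "'b \<Rightarrow> 'a"
    and n :: "('a, 7) chart \<Rightarrow> 'b \<Rightarrow> real^7" and \<theta> :: real and S :: "'b su3" and c :: "('b, 6) chart" and p :: 'b
  assumes N: "g2_manifold N" and M: "smooth_manifold M" and imm: "immersion M N \<iota>"
    and n: "unit_normal N M \<iota> n" and S: "S = induced_su3 N M \<iota> n \<theta>" and c: "c \<in> charts M" and p: "p \<in> fst c"
begin

abbreviation "d \<equiv> chart_at N (\<iota> p)"
abbreviation "q \<equiv> \<iota> p"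
abbreviation "L \<equiv> tangent_map c d \<iota> p"

lemma \<iota>: "smooth_map M N \<iota>"
  using imm by (rule immersion_imp_smooth_map)

lemma smooth_N: "smooth_manifold N"
  using N by (simp add: g2_manifold_def riemannian_manifold_def)

lemma point_image: "p' \<in> fst c \<Longrightarrow> \<iota> p' \<in> topspace (topo N)"
  using \<iota> chart_subset[OF M c] unfolding smooth_map_def by (meson continuous_map_image_subset_topspace image_subset_iff subsetD)

sublocale amb: g2_chart N "chart_at N (\<iota> p)" "\<iota> p"
  using N chart_at[OF smooth_N point_image[OF p]] by unfold_locales

lemma normal:
  assumes "p' \<in> fst c" "d' \<in> charts N" "\<iota> p' \<in> fst d'"
  shows "met N d' (\<iota> p') [n d' p', n d' p'] = 1" "met N d' (\<iota> p') [n d' p', tangent_map c d' \<iota> p' x] = 0"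
  using n assms c unfolding unit_normal_def by blast+

text \<open>Adding the normal direction turns the differential into an injective linear map between
  spaces of dimension 7, hence a surjective one.\<close>

lemma tangent_image:
  assumes p': "p' \<in> fst c" "d' \<in> charts N" "\<iota> p' \<in> fst d'" and v: "met N d' (\<iota> p') [n d' p', v] = 0"
  shows "\<exists>!x. tangent_map c d' \<iota> p' x = v"
proof -
  interpret a: g2_chart N d' "\<iota> p'" using N p' by unfold_locales
  let ?L = "tangent_map c d' \<iota> p'"
  have inj: "inj ?L" using imm c p' by (auto simp: immersion_def)
  have lin: "linear ?L" by (rule tangent_map_linear[OF M smooth_N \<iota> c p'(2,1,3)])
  let ?f = "\<lambda>(x, t). ?L x + t *\<^sub>R n d' p'"
  have linf: "linear ?f"
    by (rule linearI) (auto simp: linear_simps[OF lin] algebra_simps)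
  have nf: "met N d' (\<iota> p') [n d' p', ?f z] = snd z" for z
    using normal[OF p'] by (cases z) (simp add: linear_simps[OF a.met_lin(2)])
  have "inj ?f"
  proof (rule injI)
    fix y z assume eq: "?f y = ?f z"
    have sn: "snd y = snd z" unfolding nf[symmetric] eq by (rule refl)
    obtain y1 y2 z1 z2 where yz: "y = (y1, y2)" "z = (z1, z2)" by (cases y, cases z) auto
    have "?L y1 = ?L z1" using eq sn by (simp add: yz)
    then show "y = z" using injD[OF inj] sn by (simp add: yz)
  qed
  then have "dim (range ?f) = dim (UNIV :: ((real^6) \<times> real) set)"
    by (intro dim_image_eq[OF linf]) simp
  then have "dim (range ?f) = DIM(real^7)" by simp
  then have "span (range ?f) = UNIV" by (simp only: dim_eq_full)
  moreover have "span (range ?f) = range ?f"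
    using linear_subspace_image[OF linf subspace_UNIV] by (simp only: span_eq_iff)
  ultimately obtain z where z: "v = ?f z" by blast
  have "v = ?L (fst z)" using nf[of z] v unfolding z[symmetric] by (simp add: z case_prod_beta)
  then show ?thesis using injD[OF inj] by blast
qed

lemma induced_simps: "charts S = charts M" "met S = pullback N \<iota> (met N)" "acs S = induced_acs N \<iota> n"
  "psi_plus S = (\<lambda>c p vs. cos \<theta> * pullback N \<iota> (phi N) c p vs - sin \<theta> * pullback_contr N \<iota> n (star_phi N) c p vs)"
  "psi_minus S = (\<lambda>c p vs. sin \<theta> * pullback N \<iota> (phi N) c p vs + cos \<theta> * pullback_contr N \<iota> n (star_phi N) c p vs)"
  by (simp_all add: S induced_su3_def)

text \<open>The product of the normal with a tangent vector is orthogonal to the normal, so the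
  \<open>THE\<close> in \<open>induced_acs\<close> has a unique witness.\<close>

lemma tangent_map_acs:
  assumes "p' \<in> fst c"
  defines "d' \<equiv> chart_at N (\<iota> p')"
  shows "tangent_map c d' \<iota> p' (acs S c p' x) = cross N d' (\<iota> p') (n d' p') (tangent_map c d' \<iota> p' x)"
proof -
  have d': "d' \<in> charts N" "\<iota> p' \<in> fst d'" unfolding d'_def using chart_at[OF smooth_N point_image[OF assms(1)]] .
  interpret a: g2_chart N d' "\<iota> p'" using N d' by unfold_locales
  let ?v = "cross N d' (\<iota> p') (n d' p') (tangent_map c d' \<iota> p' x)"
  obtain e where "adapted N d' (\<iota> p') e" by (rule a.adapted_exists)
  then have F: "g2_iso N d' (\<iota> p') (\<lambda>x. \<Sum>i\<in>UNIV. x $ i *\<^sub>R e i)" (is "g2_iso _ _ _ ?F") by (rule a.adapted_g2_iso)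
  obtain y where y: "n d' p' = ?F y" by (rule a.g2_iso_surj[OF F])
  obtain z where z: "tangent_map c d' \<iota> p' x = ?F z" by (rule a.g2_iso_surj[OF F])
  note yz = y z
  have "met N d' (\<iota> p') [n d' p', ?v] = phi0 y z y"
    unfolding yz
    using a.met_sym[of "?F y" "cross N d' (\<iota> p') (?F y) (?F z)"] a.met_cross[of "?F y" "?F z" "?F y"] F[unfolded g2_iso_def, THEN conjunct2, THEN conjunct2, rule_format, of y z y] by (simp only:)
  also have "\<dots> = 0" by (simp add: phi0_expand algebra_simps)
  finally have "\<exists>!y. tangent_map c d' \<iota> p' y = ?v" by (rule tangent_image[OF assms(1) d'])
  from theI'[OF this] show ?thesis by (simp add: induced_simps(3) induced_acs_def d'_def Let_def)
qed

text \<open>The arguments are exchanged because <y, P(n, z)> = phi(n, z, y). Derivatives of \<omega>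
  thus become derivatives of a contracted pullback.\<close>

lemma omega_eq:
  assumes p': "p' \<in> fst c" shows "omega S c p' [y, z] = pullback_contr N \<iota> n (phi N) c p' [z, y]"
proof -
  let ?d = "chart_at N (\<iota> p')"
  interpret a: g2_chart N ?d "\<iota> p'" using N chart_at[OF smooth_N point_image[OF p']] by unfold_locales
  show ?thesis
    using a.met_sym[of "tangent_map c ?d \<iota> p' y" "cross N ?d (\<iota> p') (n ?d p') (tangent_map c ?d \<iota> p' z)"]
    by (simp add: omega_def induced_simps(2) pullback_def Let_def tangent_map_acs[OF p'] pullback_contr_def a.met_cross)
qed

section \<open>Derivatives of tensors and fields along the immersion\<close>

abbreviation "\<Gamma> \<equiv> christoffel N d q"
abbreviation "U \<equiv> snd c ` (fst c \<inter> \<iota> -` fst d)"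
abbreviation "u0 \<equiv> snd c p"

lemma U: "open U" "u0 \<in> U"
  using open_overlap[OF M smooth_N \<iota> c amb.d] p amb.q by auto

lemma in_U:
  assumes "u \<in> U"
  shows "cinv c u \<in> fst c" "\<iota> (cinv c u) \<in> fst d" "snd c (cinv c u) = u"
    "cinv d ((snd d \<circ> \<iota> \<circ> cinv c) u) = \<iota> (cinv c u)"
  using assms cinv_snd[OF M c] cinv_snd[OF smooth_N amb.d] by auto

lemma cinv_u0: "cinv c u0 = p"
  by (rule cinv_snd[OF M c p])

definition dL :: "real^6 \<Rightarrow> real^6 \<Rightarrow> real^7" where
  "dL y x = frechet_derivative (\<lambda>u. frechet_derivative (snd d \<circ> \<iota> \<circ> cinv c) (at u) y) (at u0) x"

lemma smooth_\<iota>: "smooth_on U (snd d \<circ> \<iota> \<circ> cinv c)"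
  using \<iota> c amb.d by (simp add: smooth_map_def)

lemma L_has_derivative: "((\<lambda>u. tangent_map c d \<iota> (cinv c u) y) has_derivative dL y) (at u0)"
proof (rule has_derivative_transform_within_open[OF _ U])
  show "((\<lambda>u. frechet_derivative (snd d \<circ> \<iota> \<circ> cinv c) (at u) y) has_derivative dL y) (at u0)"
    unfolding dL_def[abs_def] by (rule smooth_on_has_derivative[OF smooth_on_frechet_derivative[OF smooth_\<iota>] U])
qed (use in_U in \<open>simp add: tangent_map_def\<close>)

lemma dL_sym: "dL y x = dL x y"
  unfolding dL_def by (rule smooth_on_second_derivative_symmetric[OF smooth_\<iota> U])

definition dn :: "real^6 \<Rightarrow> real^7" where "dn = frechet_derivative (\<lambda>u. n d (cinv c u)) (at u0)"

lemma n_has_derivative: "((\<lambda>u. n d (cinv c u)) has_derivative dn) (at u0)"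
  unfolding dn_def using n c amb.d by (intro smooth_on_has_derivative[OF _ U]) (auto simp: unit_normal_def)

lemma linear_L: "linear L"
  by (rule tangent_map_linear[OF M smooth_N \<iota> c amb.d p amb.q])

text \<open>The Levi-Civita derivative along \<open>\<iota>\<close> of a vector field with value \<open>v\<close> and component derivative \<open>V'\<close>.\<close>

definition DD :: "(real^6 \<Rightarrow> real^7) \<Rightarrow> real^7 \<Rightarrow> real^6 \<Rightarrow> real^7" where
  "DD V' v x = V' x + \<Gamma> (L x) v"

text \<open>The Leibniz rule along \<iota>: the Christoffel terms subtracted in \<open>nabla\<close>
  are those added in \<open>DD\<close>.\<close>

lemma tensor_along:
  assumes ml: "\<And>q'. q' \<in> fst d \<Longrightarrow> multilinear k (T d q')"
    and diff: "\<And>vs. length vs = k \<Longrightarrow> (\<lambda>w. T d (cinv d w) vs) differentiable (at (snd d q))"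
    and len: "\<And>u. length (V u) = k" and V: "\<And>i. i < k \<Longrightarrow> ((\<lambda>u. V u ! i) has_derivative V' i) (at u0)"
  shows "((\<lambda>u. T d (\<iota> (cinv c u)) (V u)) has_derivative
     (\<lambda>x. nabla N T d q (L x) (V u0) + (\<Sum>i<k. T d q ((V u0)[i := DD (V' i) (V u0 ! i) x])))) (at u0)"
proof -
  have V_map: "map (\<lambda>i. V u ! i) [0..<k] = V u" for u using len[of u] map_nth by metis
  have dG: "((\<lambda>u. T d (\<iota> (cinv c u)) vs) has_derivative (\<lambda>x. deriv_along d (\<lambda>q. T d q vs) q (L x))) (at u0)"
    if "length vs = k" for vs
  proof -
    have at: "(snd d \<circ> \<iota> \<circ> cinv c) u0 = snd d q" by (simp add: cinv_u0)
    have "((\<lambda>w. T d (cinv d w) vs) has_derivative deriv_along d (\<lambda>q. T d q vs) q) (at ((snd d \<circ> \<iota> \<circ> cinv c) u0))"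
      unfolding at using diff[OF that] by (simp add: deriv_along_def frechet_derivative_works o_def)
    from diff_chain_at[OF smooth_map_has_derivative[OF M smooth_N \<iota> c amb.d p amb.q] this]
    have "(((\<lambda>w. T d (cinv d w) vs) \<circ> (snd d \<circ> \<iota> \<circ> cinv c)) has_derivative (\<lambda>x. deriv_along d (\<lambda>q. T d q vs) q (L x))) (at u0)"
      by (simp add: o_def)
    then show ?thesis
      by (rule has_derivative_transform_within_open[OF _ U]) (use in_U(4) in \<open>simp add: o_def\<close>)
  qed
  have "((\<lambda>u. T d (\<iota> (cinv c u)) (map (\<lambda>i. V u ! i) [0..<k])) has_derivative
    (\<lambda>x. deriv_along d (\<lambda>q. T d q (map (\<lambda>i. V u0 ! i) [0..<k])) q (L x)
      + (\<Sum>i<k. T d (\<iota> (cinv c u0)) ((map (\<lambda>i. V u0 ! i) [0..<k])[i := V' i x])))) (at u0)"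
    by (rule multilinear_has_derivative[OF U ml dG V]) (use in_U in auto)
  then have "((\<lambda>u. T d (\<iota> (cinv c u)) (V u)) has_derivative
    (\<lambda>x. deriv_along d (\<lambda>q. T d q (V u0)) q (L x) + (\<Sum>i<k. T d q ((V u0)[i := V' i x])))) (at u0)"
    unfolding V_map cinv_u0 .
  moreover have "deriv_along d (\<lambda>q. T d q (V u0)) q (L x) + (\<Sum>i<k. T d q ((V u0)[i := V' i x])) =
     nabla N T d q (L x) (V u0) + (\<Sum>i<k. T d q ((V u0)[i := DD (V' i) (V u0 ! i) x]))" for x
    by (simp add: nabla_def len DD_def multilinear_update[OF ml[OF amb.q] len] sum.distrib)
  ultimately show ?thesis by simp
qed

lemma ml_on:
  assumes "q' \<in> fst d"
  shows "multilinear 2 (met N d q')" "multilinear 3 (phi N d q')" "multilinear 4 (star_phi N d q')"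
proof -
  interpret a: g2_chart N d q' using N amb.d assms by unfold_locales
  show "multilinear 2 (met N d q')" "multilinear 3 (phi N d q')" "multilinear 4 (star_phi N d q')"
    by (rule a.ml_met a.ml_phi a.ml_star)+
qed

text \<open>All four facts follow from the Koszul formula once \<open>D\<close> is symmetric and
  linear in its last two arguments, properties inherited from the metric by uniqueness of
  derivatives.\<close>

lemma
  shows christoffel_N_sym: "\<Gamma> x y = \<Gamma> y x"
    and nabla_met: "nabla N (met N) d q x [y, z] = 0"
    and linear_christoffel_N: "linear (\<Gamma> x)" "linear (\<lambda>x. \<Gamma> x y)"
proof -
  define D where "D x y z = deriv_along d (\<lambda>q. met N d q [y, z]) q x" for x y z
  have der: "((\<lambda>w. met N d (cinv d w) [y, z]) has_derivative (\<lambda>x. D x y z)) (at (snd d q))" for y z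
    using amb.met_has_derivative[of "[y, z]"] by (simp add: D_def deriv_along_def frechet_derivative_works o_def)
  have met_at: "g2_chart N d (cinv d w)" if "w \<in> cimg d" for w
    using N amb.d cinv_in[OF that] by unfold_locales
  note open_d = open_cimg[OF smooth_N amb.d] snd_in_cimg[OF smooth_N amb.d amb.q]
  have Dsym: "D x y z = D x z y" for x y z
  proof -
    have "((\<lambda>w. met N d (cinv d w) [y, z]) has_derivative (\<lambda>x. D x z y)) (at (snd d q))"
      by (rule has_derivative_transform_within_open[OF der open_d]) (rule g2_chart.met_sym[OF met_at])
    from has_derivative_unique[OF this der] show ?thesis by (simp add: fun_eq_iff)
  qed
  have lin1: "linear (D x y)" for x y
  proof (rule linearI)
    fix z z' and r
    have "((\<lambda>w. met N d (cinv d w) [y, z + z']) has_derivative (\<lambda>x. D x y z + D x y z')) (at (snd d q))"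
      by (rule has_derivative_transform_within_open[OF has_derivative_add[OF der der] open_d])
        (simp add: linear_add[OF g2_chart.met_lin(2)[OF met_at]])
    from has_derivative_unique[OF this der] show "D x y (z + z') = D x y z + D x y z'" by (simp add: fun_eq_iff)
    have "((\<lambda>w. met N d (cinv d w) [y, r *\<^sub>R z]) has_derivative (\<lambda>x. r * D x y z)) (at (snd d q))"
      by (rule has_derivative_transform_within_open[OF has_derivative_mult_right[OF der] open_d])
        (simp add: linear_scale[OF g2_chart.met_lin(2)[OF met_at]])
    from has_derivative_unique[OF this der] show "D x y (r *\<^sub>R z) = r *\<^sub>R D x y z" by (simp add: fun_eq_iff)
  qed
  have lin2: "linear (\<lambda>x. D x y z)" for y z using der has_derivative_linear by blast
  have kz: "met N d q [\<Gamma> x y, z] = (D x y z + D y x z - D z x y) / 2" for x y z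
    by (rule met_christoffel[OF amb.ml_met amb.met_sym amb.met_pos D_def[symmetric] lin1 lin2])
  show "\<Gamma> x y = \<Gamma> y x" for x y
    by (rule amb.met_eqI) (simp add: kz Dsym[of _ y x])
  show "nabla N (met N) d q x [y, z] = 0"
  proof -
    have "met N d q [y, \<Gamma> x z] = met N d q [\<Gamma> x z, y]" by (rule amb.met_sym)
    then show ?thesis
      by (simp add: nabla_def D_def[symmetric] numeral_2_eq_2 lessThan_Suc kz Dsym[of x z y] Dsym[of y z x] Dsym[of z y x] field_simps)
  qed
  have lin3: "linear (\<lambda>y. D x y z)" for x z using lin1[of x z] Dsym[of x _ z] by simp
  show "linear (\<Gamma> x)" "linear (\<lambda>x. \<Gamma> x y)"
    by (rule linearI; rule amb.met_eqI; simp add: kz linear_simps[OF amb.met_lin(1)]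
      linear_simps[OF lin1] linear_simps[OF lin2] linear_simps[OF lin3] field_simps)+
qed

lemma met_along:
  assumes "(V has_derivative V') (at u0)" "(W has_derivative W') (at u0)"
  shows "((\<lambda>u. met N d (\<iota> (cinv c u)) [V u, W u]) has_derivative
     (\<lambda>x. met N d q [DD V' (V u0) x, W u0] + met N d q [V u0, DD W' (W u0) x])) (at u0)"
proof -
  have "((\<lambda>u. met N d (\<iota> (cinv c u)) [V u, W u]) has_derivative
     (\<lambda>x. nabla N (met N) d q (L x) [V u0, W u0] +
       (\<Sum>i<2. met N d q ([V u0, W u0][i := DD ([V', W'] ! i) ([V u0, W u0] ! i) x])))) (at u0)"
  proof (rule tensor_along[where k=2 and T="met N" and V="\<lambda>u. [V u, W u]" and V'="\<lambda>i. [V', W'] ! i"])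
    fix i :: nat assume "i < 2"
    then show "((\<lambda>u. [V u, W u] ! i) has_derivative [V', W'] ! i) (at u0)"
      using assms by (auto simp: numeral_2_eq_2 less_Suc_eq)
  qed (simp_all add: ml_on amb.met_has_derivative)
  then show ?thesis by (simp add: nabla_met numeral_2_eq_2)
qed

section \<open>The shape operator and the formulas of Gauss and Weingarten\<close>

abbreviation "B \<equiv> second_ff N \<iota> n c p"
abbreviation "nn \<equiv> n d p"
abbreviation "DL y \<equiv> DD (dL y) (L y)"
abbreviation "Dn \<equiv> DD dn nn"

lemma B_eq: "B x y = met N d q [DL y x, nn]"
  by (simp add: second_ff_def Let_def dL_def DD_def)

lemma DL_sym: "DL y x = DL x y"
  by (simp add: DD_def dL_sym[of y] christoffel_N_sym[of "L x"])

lemma B_sym: "B x y = B y x"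
  by (simp add: B_eq DL_sym[of y])

lemma Dn_normal: "met N d q [Dn x, nn] = 0"
proof -
  have "((\<lambda>u. 1) has_derivative (\<lambda>x. met N d q [Dn x, nn] + met N d q [nn, Dn x])) (at u0)"
    using has_derivative_transform_within_open[OF met_along[OF n_has_derivative n_has_derivative] U, where g="\<lambda>_. 1"]
      normal(1)[OF _ amb.d] in_U by (simp add: cinv_u0)
  from has_derivative_unique[OF this has_derivative_const] have "met N d q [Dn x, nn] + met N d q [nn, Dn x] = 0"
    by (simp add: fun_eq_iff)
  then show ?thesis using amb.met_sym[of "Dn x" nn] by simp
qed

text \<open>Obtained by differentiating <n, L y> = 0 along \<iota>.\<close>

lemma Dn_tangent: "met N d q [Dn x, L y] = - B x y"
proof -
  have "((\<lambda>u. 0) has_derivative (\<lambda>x. met N d q [Dn x, L y] + met N d q [nn, DL y x])) (at u0)"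
    using has_derivative_transform_within_open[OF met_along[OF n_has_derivative L_has_derivative[of y]] U, where g="\<lambda>_. 0"]
      normal(2)[OF _ amb.d] in_U by (simp add: cinv_u0)
  from has_derivative_unique[OF this has_derivative_const] have "met N d q [Dn x, L y] + met N d q [nn, DL y x] = 0"
    by (simp add: fun_eq_iff)
  then show ?thesis using amb.met_sym[of nn "DL y x"] by (simp add: B_eq)
qed

lemma normal_decomp:
  assumes "\<And>y. met N d q [v, L y] = 0" "met N d q [v, nn] = 0" shows "v = 0"
proof -
  have "met N d q [nn, v] = 0" using assms(2) amb.met_sym by simp
  from tangent_image[OF p amb.d amb.q this] obtain x where "L x = v" by blast
  with assms(1)[of x] amb.met_pos[of v] show ?thesis by force
qed

lemma met_S: "met S c p [x, y] = met N d q [L x, L y]"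
  by (simp add: induced_simps(2) pullback_def Let_def)

lemma L_inj: "L x = L y \<Longrightarrow> x = y"
  using imm c p amb.d amb.q by (auto simp: immersion_def inj_def)

text \<open>The tangential part of the ambient derivative satisfies the Koszul formula of the
  induced metric, since by symmetry of \<open>DL\<close> four of its six terms cancel in pairs. What
  is removed is the normal part \<open>B\<close>.\<close>

lemma gauss: "L (christoffel S c p x y) = DL y x - B x y *\<^sub>R nn"
proof -
  have tens: "tensorial N 2 (met N)" by (rule tensor_field_tensorial[OF amb.tensor_met])
  have ml: "multilinear 2 (met S c p)"
    unfolding multilinear_def
  proof (intro allI impI)
    fix vs :: "(real^6) list" and i :: nat assume *: "length vs = 2 \<and> i < 2"
    then obtain x y where vs: "vs = [x, y]" by (auto simp: numeral_eq_Suc length_Suc_conv)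
    from * consider "i = 0" | "i = 1" by linarith
    then show "linear (\<lambda>v. met S c p (vs[i := v]))"
      by cases (auto simp: vs met_S intro!: linearI simp: linear_simps[OF linear_L]
        linear_simps[OF amb.met_lin(1)] linear_simps[OF amb.met_lin(2)])
  qed
  have sym: "met S c p [x, y] = met S c p [y, x]" for x y by (simp add: met_S amb.met_sym[of "L x"])
  have pos: "met S c p [x, x] > 0" if "x \<noteq> 0" for x
    unfolding met_S by (rule amb.met_pos) (use that L_inj[of x 0] linear_0[OF linear_L] in auto)
  define E where "E y x = DL y x" for y x
  define D where "D x y z = met N d q [E y x, L z] + met N d q [L y, E z x]" for x y z
  have "deriv_along c (\<lambda>q. met S c q [y, z]) p x = D x y z" for x y z
  proof -
    have "((\<lambda>u. met S c (cinv c u) [y, z]) has_derivative (\<lambda>x. D x y z)) (at u0)"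
    proof (rule has_derivative_transform_within_open[OF _ U])
      show "((\<lambda>u. met N d (\<iota> (cinv c u)) [tangent_map c d \<iota> (cinv c u) y, tangent_map c d \<iota> (cinv c u) z]) has_derivative (\<lambda>x. D x y z)) (at u0)"
        using met_along[OF L_has_derivative[of y] L_has_derivative[of z]] by (simp add: D_def[abs_def] E_def cinv_u0)
      fix u assume "u \<in> U"
      from in_U[OF this] show "met N d (\<iota> (cinv c u)) [tangent_map c d \<iota> (cinv c u) y, tangent_map c d \<iota> (cinv c u) z] = met S c (cinv c u) [y, z]"
        by (simp add: induced_simps(2) pullback_eq[OF M smooth_N \<iota> c amb.d _ _ tens])
    qed
    then show ?thesis by (simp add: deriv_along_def frechet_derivative_eqI o_def)
  qed
  moreover have linDL: "linear (E y)" for y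
    using has_derivative_linear[OF L_has_derivative[of y]]
    by (auto simp: E_def DD_def linear_simps[OF linear_christoffel_N(2)] linear_simps[OF linear_L]
      linear_add linear_scale algebra_simps intro!: linearI)
  moreover have linDL': "linear (\<lambda>y. E y x)" for x
  proof -
    have "(\<lambda>y. E y x) = E x" by (simp add: E_def fun_eq_iff DL_sym[of _ x])
    then show ?thesis using linDL[of x] by simp
  qed
  have lD1: "linear (D x y)" and lD2: "linear (\<lambda>x. D x y z)" for x y z
    by (rule linearI; simp add: D_def linear_simps[OF linear_L]
      linear_simps[OF amb.met_lin(1)] linear_simps[OF amb.met_lin(2)]
      linear_simps[OF linDL] linear_simps[OF linDL'] algebra_simps)+
  ultimately have kz: "met S c p [christoffel S c p x y, z] = (D x y z + D y x z - D z x y) / 2" for z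
    by (intro met_christoffel[OF ml sym pos])
  have "met N d q [L (christoffel S c p x y), L z] = met N d q [DL y x, L z]" for z
  proof -
    have "D x y z + D y x z - D z x y = 2 * met N d q [DL y x, L z]"
      using amb.met_sym[of "L y" "DL z x"] amb.met_sym[of "L x" "DL z y"] DL_sym[of x y] DL_sym[of z x] DL_sym[of z y]
        amb.met_sym[of "DL x z" "L y"] amb.met_sym[of "L x" "DL y z"]
      by (simp add: D_def E_def)
    then show ?thesis using kz[of z] by (simp add: met_S)
  qed
  moreover have "met N d q [nn, L z] = 0" for z by (rule normal(2)[OF p amb.d amb.q])
  moreover have "met N d q [L z, nn] = 0" for z using normal(2)[OF p amb.d amb.q, of z] amb.met_sym by simp
  ultimately have "L (christoffel S c p x y) - (DL y x - B x y *\<^sub>R nn) = 0"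
    by (intro normal_decomp) (simp_all add: linear_diff[OF amb.met_lin(1)] linear_scale[OF amb.met_lin(1)] normal(1)[OF p amb.d amb.q] B_eq)
  then show ?thesis by simp
qed

end

section \<open>Traces of trilinear forms under the action of an endomorphism\<close>

lemma star0_linear: "linear (\<lambda>x. star0 x y z w)" "linear (\<lambda>y. star0 x y z w)" "linear (\<lambda>z. star0 x y z w)" "linear (star0 x y z)"
  by (rule linearI; simp add: star0_def algebra_simps sum.distrib sum_subtractf sum_distrib_left)+

lemma star0_cycle: "star0 v y z x = star0 v x y z"
  by (simp add: star0_expand algebra_simps)

lemma star0_swap: "star0 v w z y = - star0 v w y z" "star0 v y w z = - star0 v w y z" "star0 w v y z = - star0 v w y z"
  by (simp_all add: star0_expand algebra_simps)

definition trilinear :: "('v::real_vector \<Rightarrow> 'v \<Rightarrow> 'v \<Rightarrow> real) \<Rightarrow> bool" where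
  "trilinear X \<longleftrightarrow> (\<forall>y z. linear (\<lambda>x. X x y z)) \<and> (\<forall>x z. linear (\<lambda>y. X x y z)) \<and> (\<forall>x y. linear (X x y))"

text \<open>The value \<open>r = 0\<close> belongs to an orthonormal basis of R^7 and
  \<open>r = 1\<close> to one of the tangent space; in the latter case \<open>z\<close> makes the
  terms with \<open>e0\<close> in a slot vanish.\<close>

lemma trilinear_trace:
  fixes o' :: "'i::finite \<Rightarrow> real^7"
  assumes tr: "\<And>b. bilinear b \<Longrightarrow> (\<Sum>i\<in>UNIV. b (o' i) (o' i)) = (\<Sum>a\<in>UNIV. b (axis a 1) (axis a 1)) - r * (b e0 e0 :: real)"
    and X: "trilinear X" and Y: "trilinear Y"
    and z: "\<And>a b a' b'. r * (X e0 a b * Y e0 a' b') = 0" "\<And>a b a' b'. r * (X a e0 b * Y a' e0 b') = 0"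
      "\<And>a b a' b'. r * (X a b e0 * Y a' b' e0) = 0"
  shows "(\<Sum>i\<in>UNIV. \<Sum>j\<in>UNIV. \<Sum>k\<in>UNIV. X (o' i) (o' j) (o' k) * Y (o' i) (o' j) (o' k)) =
    (\<Sum>i\<in>UNIV. \<Sum>j\<in>UNIV. \<Sum>k\<in>UNIV. X (axis i 1) (axis j 1) (axis k 1) * Y (axis i 1) (axis j 1) (axis k 1))"
proof -
  have l: "linear (\<lambda>x. Z x y z)" "linear (\<lambda>y. Z x y z)" "linear (Z x y)" if "Z = X \<or> Z = Y" for Z x y z
    using X Y that by (auto simp: trilinear_def)
  have LX: "linear (\<lambda>x. X x y z)" "linear (\<lambda>y. X x y z)" "linear (X x y)"
    and LY: "linear (\<lambda>x. Y x y z)" "linear (\<lambda>y. Y x y z)" "linear (Y x y)" for x y z by (rule l; simp)+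
  note [simp] = linear_add[OF LX(1)] linear_add[OF LX(2)] linear_add[OF LX(3)] linear_scale[OF LX(1)] linear_scale[OF LX(2)] linear_scale[OF LX(3)]
    linear_add[OF LY(1)] linear_add[OF LY(2)] linear_add[OF LY(3)] linear_scale[OF LY(1)] linear_scale[OF LY(2)] linear_scale[OF LY(3)]
  have 1: "(\<Sum>k\<in>UNIV. X u v (o' k) * Y u v (o' k)) = (\<Sum>k\<in>UNIV. X u v (axis k 1) * Y u v (axis k 1))" for u v
  proof -
    have "bilinear (\<lambda>s t. X u v s * Y u v t)"
      unfolding bilinear_def by (intro conjI allI linearI) (simp_all add: algebra_simps)
    from tr[OF this] show ?thesis by (simp add: z)
  qed
  have 2: "(\<Sum>j\<in>UNIV. \<Sum>k\<in>UNIV. X u (o' j) (axis k 1) * Y u (o' j) (axis k 1)) =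
      (\<Sum>j\<in>UNIV. \<Sum>k\<in>UNIV. X u (axis j 1) (axis k 1) * Y u (axis j 1) (axis k 1))" for u
  proof -
    have "bilinear (\<lambda>s t. \<Sum>k\<in>UNIV. X u s (axis k 1) * Y u t (axis k 1))"
      unfolding bilinear_def by (intro conjI allI linearI) (simp_all add: algebra_simps sum.distrib sum_distrib_left)
    from tr[OF this] show ?thesis by (simp add: z sum_distrib_left)
  qed
  have "bilinear (\<lambda>s t. \<Sum>j\<in>UNIV. \<Sum>k\<in>UNIV. X s (axis j 1) (axis k 1) * Y t (axis j 1) (axis k 1))"
    unfolding bilinear_def by (intro conjI allI linearI) (simp_all add: algebra_simps sum.distrib sum_distrib_left)
  from tr[OF this] show ?thesis by (simp add: 1 2 z sum_distrib_left)
qed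

lemma sum_rotate:
  fixes h :: "'i::finite \<Rightarrow> 'i \<Rightarrow> 'i \<Rightarrow> real"
  shows "(\<Sum>i\<in>UNIV. \<Sum>j\<in>UNIV. \<Sum>k\<in>UNIV. h j k i) = (\<Sum>i\<in>UNIV. \<Sum>j\<in>UNIV. \<Sum>k\<in>UNIV. h i j k)"
proof -
  have "(\<Sum>i\<in>UNIV. \<Sum>j\<in>UNIV. \<Sum>k\<in>UNIV. h j k i) = (\<Sum>j\<in>UNIV. \<Sum>i\<in>UNIV. \<Sum>k\<in>UNIV. h j k i)"
    by (rule sum.swap)
  also have "\<dots> = (\<Sum>i\<in>UNIV. \<Sum>j\<in>UNIV. \<Sum>k\<in>UNIV. h i j k)"
    by (intro sum.cong refl sum.swap)
  finally show ?thesis .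
qed

text \<open>The derivation action of an endomorphism; up to sign, the derivative of a form that is
  constant in a moving frame is of this kind.\<close>

definition act3 :: "('v \<Rightarrow> 'v) \<Rightarrow> ('v \<Rightarrow> 'v \<Rightarrow> 'v \<Rightarrow> real) \<Rightarrow> 'v \<Rightarrow> 'v \<Rightarrow> 'v \<Rightarrow> real" where
  "act3 f X x y z = X (f x) y z + X x (f y) z + X x y (f z)"

text \<open>Cyclic invariance of both factors makes the three terms of \<open>act3\<close>
  contribute equally.\<close>

lemma sum_act3:
  assumes X: "\<And>x y z. X y z x = X x y z" and Y: "\<And>x y z. Y y z x = Y x y z"
  shows "(\<Sum>i\<in>UNIV. \<Sum>j\<in>UNIV. \<Sum>k\<in>UNIV. act3 f X (e i) (e j) (e k) * Y (e i) (e j) (e k)) =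
    3 * (\<Sum>i\<in>(UNIV::'i::finite set). \<Sum>j\<in>UNIV. \<Sum>k\<in>UNIV. X (f (e i)) (e j) (e k) * Y (e i) (e j) (e k))"
proof -
  let ?h = "\<lambda>i j k. X (f (e i)) (e j) (e k) * Y (e i) (e j) (e k)"
  have "act3 f X (e i) (e j) (e k) * Y (e i) (e j) (e k) = ?h i j k + ?h j k i + ?h k i j" for i j k
  proof -
    have "X (e i) (f (e j)) (e k) = X (f (e j)) (e k) (e i)" "X (e i) (e j) (f (e k)) = X (f (e k)) (e i) (e j)"
      "Y (e j) (e k) (e i) = Y (e i) (e j) (e k)" "Y (e k) (e i) (e j) = Y (e i) (e j) (e k)"
      by (rule X[symmetric] X Y Y[symmetric])+
    then show ?thesis by (simp only: act3_def distrib_right)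
  qed
  moreover have "(\<Sum>i\<in>UNIV. \<Sum>j\<in>UNIV. \<Sum>k\<in>UNIV. ?h k i j) = (\<Sum>i\<in>UNIV. \<Sum>j\<in>UNIV. \<Sum>k\<in>UNIV. ?h j k i)"
    by (rule sum_rotate[of "\<lambda>i j k. ?h j k i"])
  ultimately show ?thesis
    by (simp add: sum.distrib sum_rotate[of ?h])
qed

lemma contract_act_phi0:
  "(\<Sum>i\<in>UNIV. \<Sum>j\<in>UNIV. \<Sum>k\<in>UNIV. act3 f phi0 (axis i 1) (axis j 1) (axis k 1) * star0 v (axis i 1) (axis j 1) (axis k 1))
    = - 12 * (\<Sum>i\<in>UNIV. phi0 (f (axis i 1)) v (axis i 1))"
  unfolding sum_act3[of phi0 "star0 v", OF phi0_cycle star0_cycle] phi0_axis_sum_star0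
  by (simp add: sum_distrib_left sum_negf)

text \<open>In use, \<open>v\<close> is the operator applied to \<open>e0\<close>, the contracted
  slot. Its term drops out, as contracting the dual with \<open>phi0\<close> leaves phi0(u, v, u) =
  0.\<close>

lemma contract_act_star0:
  "(\<Sum>i\<in>UNIV. \<Sum>j\<in>UNIV. \<Sum>k\<in>UNIV. (star0 v (axis i 1) (axis j 1) (axis k 1) + act3 f (star0 e0) (axis i 1) (axis j 1) (axis k 1))
      * phi0 (axis i 1) (axis j 1) (axis k 1))
    = 12 * (\<Sum>i\<in>UNIV. phi0 (f (axis i 1)) e0 (axis i 1))"
proof -
  have c: "(\<Sum>j\<in>UNIV. \<Sum>k\<in>UNIV. star0 v w (axis j 1) (axis k 1) * phi0 u (axis j 1) (axis k 1)) = - 4 * phi0 u v w" for u v w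
    using phi0_axis_sum_star0[of u v w] by (simp add: mult.commute)
  have p: "phi0 u v u = 0" "phi0 u v w = - phi0 w v u" for u v w
    by (simp_all add: phi0_expand algebra_simps)
  have p2: "phi0 (axis i 1) e0 (f (axis i 1)) = - phi0 (f (axis i 1)) e0 (axis i 1)" for i
    by (rule p(2))
  have 1: "(\<Sum>i\<in>UNIV. \<Sum>j\<in>UNIV. \<Sum>k\<in>UNIV. star0 v (axis i 1) (axis j 1) (axis k 1) * phi0 (axis i 1) (axis j 1) (axis k 1)) = 0"
    by (simp only: c p(1)) simp
  have 2: "(\<Sum>i\<in>UNIV. \<Sum>j\<in>UNIV. \<Sum>k\<in>UNIV. act3 f (star0 e0) (axis i 1) (axis j 1) (axis k 1) * phi0 (axis i 1) (axis j 1) (axis k 1))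
     = 3 * (\<Sum>i\<in>UNIV. - 4 * phi0 (axis i 1) e0 (f (axis i 1)))"
    by (subst sum_act3[OF star0_cycle phi0_cycle]) (simp only: c)
  have 3: "(\<Sum>i\<in>UNIV. - 4 * phi0 (axis i 1) e0 (f (axis i 1))) = 4 * (\<Sum>i\<in>UNIV. phi0 (f (axis i 1)) e0 (axis i 1))"
    unfolding sum_distrib_left
  proof (intro sum.cong refl)
    fix i show "- 4 * phi0 (axis i 1) e0 (f (axis i 1)) = 4 * phi0 (f (axis i 1)) e0 (axis i 1)"
      using p2[of i] by linarith
  qed
  show ?thesis unfolding distrib_right sum.distrib 1 2 3 by simp
qed

text \<open>Terms of \<open>star0\<close> are supported on complements of Fano lines, and any two
  lines meet, so \<open>star0 v\<close> vanishes on the lines that survive the projection. Hence the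
  shape operator does not contribute to \<open>eta\<close> when \<theta> = pi / 2.\<close>

lemma contract_star0_tangent:
  assumes "v $ 0 = 0"
  shows "(\<Sum>i\<in>UNIV. \<Sum>j\<in>UNIV. \<Sum>k\<in>UNIV. star0 v (axis i 1 - axis i 1 $ 0 *\<^sub>R e0) (axis j 1 - axis j 1 $ 0 *\<^sub>R e0)
     (axis k 1 - axis k 1 $ 0 *\<^sub>R e0) * phi0 (axis i 1) (axis j 1) (axis k 1)) = 0"
proof -
  define \<pi> where "\<pi> i = axis i 1 - axis i 1 $ 0 *\<^sub>R e0" for i :: 7
  have \<pi>: "\<pi> i $ j = (if j = i \<and> i \<noteq> 0 then 1 else 0)" for i j
    by (auto simp: \<pi>_def axis_nth_if)
  have \<pi>0: "\<pi> 0 = 0" by (simp add: vec_eq_iff \<pi>)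
  have z: "star0 v 0 y z = 0" "star0 v x 0 z = 0" "star0 v x y 0 = 0" for x y z
    by (simp_all add: star0_def)
  have "star0 v (\<pi> 1) (\<pi> 2) (\<pi> 4) = 0" "star0 v (\<pi> 2) (\<pi> 3) (\<pi> 5) = 0"
    "star0 v (\<pi> 3) (\<pi> 4) (\<pi> 6) = 0" "star0 v (\<pi> 5) (\<pi> 6) (\<pi> 1) = 0"
    unfolding star0_expand by (simp_all add: \<pi> assms)
  then have "\<forall>m. star0 v (\<pi> m) (\<pi> (m+1)) (\<pi> (m+3)) = 0"
    unfolding forall_7 num_7 add_0 by (simp add: \<pi>0 z)
  then have V: "star0 v (\<pi> m) (\<pi> (m+1)) (\<pi> (m+3)) = 0" "star0 v (\<pi> m) (\<pi> (m+3)) (\<pi> (m+1)) = 0"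
    "star0 v (\<pi> (m+1)) (\<pi> (m+3)) (\<pi> m) = 0" "star0 v (\<pi> (m+1)) (\<pi> m) (\<pi> (m+3)) = 0"
    "star0 v (\<pi> (m+3)) (\<pi> m) (\<pi> (m+1)) = 0" "star0 v (\<pi> (m+3)) (\<pi> (m+1)) (\<pi> m) = 0" for m
    by (metis star0_swap(1,2) minus_zero)+
  have "(\<Sum>i\<in>UNIV. \<Sum>j\<in>UNIV. \<Sum>k\<in>UNIV. phi0 (axis i 1) (axis j 1) (axis k 1) * star0 v (\<pi> i) (\<pi> j) (\<pi> k)) = 0"
    unfolding sum_phi0_axis3 V by simp
  then show ?thesis by (simp add: \<pi>_def mult.commute)
qed

section \<open>Covariant derivatives of the induced forms\<close>

context hypersurface begin

text \<open>By the Gauss formula the induced connection differs from the ambient one by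
  \<open>B\<close> times the normal in each slot.\<close>

lemma nabla_pullback:
  assumes tens: "tensorial N k T" and ml: "\<And>q'. q' \<in> fst d \<Longrightarrow> multilinear k (T d q')"
    and diff: "\<And>vs. length vs = k \<Longrightarrow> (\<lambda>w. T d (cinv d w) vs) differentiable (at (snd d q))"
    and vs: "length vs = k"
  shows "nabla S (pullback N \<iota> T) c p x vs =
    nabla N T d q (L x) (map L vs) + (\<Sum>i<k. T d q ((map L vs)[i := B x (vs ! i) *\<^sub>R nn]))"
proof -
  let ?V = "\<lambda>u. map (tangent_map c d \<iota> (cinv c u)) vs"
  have "((\<lambda>u. T d (\<iota> (cinv c u)) (?V u)) has_derivative
     (\<lambda>x. nabla N T d q (L x) (?V u0) + (\<Sum>i<k. T d q ((?V u0)[i := DD (dL (vs ! i)) (?V u0 ! i) x])))) (at u0)"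
    by (rule tensor_along[where k=k and T=T and V="?V" and V'="\<lambda>i. dL (vs ! i)", OF ml diff]) (simp_all add: vs L_has_derivative)
  then have "((\<lambda>u. pullback N \<iota> T c (cinv c u) vs) has_derivative
     (\<lambda>x. nabla N T d q (L x) (?V u0) + (\<Sum>i<k. T d q ((?V u0)[i := DD (dL (vs ! i)) (?V u0 ! i) x])))) (at u0)"
    by (rule has_derivative_transform_within_open[OF _ U])
      (rule pullback_eq[OF M smooth_N \<iota> c amb.d in_U(1,2) tens vs, symmetric])
  from frechet_derivative_eqI[OF this]
  have "deriv_along c (\<lambda>q. pullback N \<iota> T c q vs) p x =
     nabla N T d q (L x) (?V u0) + (\<Sum>i<k. T d q ((?V u0)[i := DD (dL (vs ! i)) (?V u0 ! i) x]))"
    unfolding deriv_along_def o_def by (rule fun_cong)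
  also have "\<dots> = nabla N T d q (L x) (map L vs) + (\<Sum>i<k. T d q ((map L vs)[i := DL (vs ! i) x]))"
    unfolding cinv_u0 by (intro arg_cong2[where f="(+)"] refl sum.cong) (simp add: vs)
  finally have "deriv_along c (\<lambda>q. pullback N \<iota> T c q vs) p x =
     nabla N T d q (L x) (map L vs) + (\<Sum>i<k. T d q ((map L vs)[i := DL (vs ! i) x]))" .
  moreover have "pullback N \<iota> T c p (vs[i := christoffel S c p x (vs ! i)]) =
    T d q ((map L vs)[i := DL (vs ! i) x]) - T d q ((map L vs)[i := B x (vs ! i) *\<^sub>R nn])" if "i < k" for i
    using multilinear_update(3)[OF ml[OF amb.q], of "map L vs" i] vs that
    by (simp add: pullback_def Let_def map_update gauss)
  ultimately show ?thesis by (simp add: nabla_def vs sum_subtractf)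
qed

text \<open>As for \<open>nabla_pullback\<close>, with one more term for the derivative of the
  normal. The factor \<open>a\<close> is there because \<open>psi_plus\<close> is minus a
  contraction when \<theta> = pi / 2.\<close>

lemma nabla_pullback_contr:
  assumes tens: "tensorial N (Suc k) T" and ml: "\<And>q'. q' \<in> fst d \<Longrightarrow> multilinear (Suc k) (T d q')"
    and diff: "\<And>vs. length vs = Suc k \<Longrightarrow> (\<lambda>w. T d (cinv d w) vs) differentiable (at (snd d q))"
    and vs: "length vs = k"
  shows "nabla S (\<lambda>c p vs. a * pullback_contr N \<iota> n T c p vs) c p x vs =
    a * (nabla N T d q (L x) (nn # map L vs) + T d q (Dn x # map L vs)
      + (\<Sum>i<k. T d q (nn # (map L vs)[i := B x (vs ! i) *\<^sub>R nn])))"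
proof -
  let ?V = "\<lambda>u. n d (cinv c u) # map (tangent_map c d \<iota> (cinv c u)) vs"
  let ?V' = "\<lambda>i. case i of 0 \<Rightarrow> dn | Suc j \<Rightarrow> dL (vs ! j)"
  have "((\<lambda>u. T d (\<iota> (cinv c u)) (?V u)) has_derivative
     (\<lambda>x. nabla N T d q (L x) (?V u0) + (\<Sum>i<Suc k. T d q ((?V u0)[i := DD (?V' i) (?V u0 ! i) x])))) (at u0)"
    by (rule tensor_along[where k="Suc k" and T=T and V="?V" and V'="?V'", OF ml diff])
      (auto simp: vs L_has_derivative n_has_derivative split: nat.split)
  from has_derivative_mult_right[OF this, of a]
  have "((\<lambda>u. a * pullback_contr N \<iota> n T c (cinv c u) vs) has_derivative
     (\<lambda>x. a * (nabla N T d q (L x) (?V u0) + (\<Sum>i<Suc k. T d q ((?V u0)[i := DD (?V' i) (?V u0 ! i) x]))))) (at u0)"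
    by (rule has_derivative_transform_within_open[OF _ U])
      (simp only: pullback_contr_eq[OF M smooth_N \<iota> c amb.d in_U(1,2) tens vs n])
  from frechet_derivative_eqI[OF this]
  have "deriv_along c (\<lambda>q. a * pullback_contr N \<iota> n T c q vs) p x =
     a * (nabla N T d q (L x) (?V u0) + (\<Sum>i<Suc k. T d q ((?V u0)[i := DD (?V' i) (?V u0 ! i) x])))"
    unfolding deriv_along_def o_def by (rule fun_cong)
  also have "(\<Sum>i<Suc k. T d q ((?V u0)[i := DD (?V' i) (?V u0 ! i) x])) =
      T d q (Dn x # map L vs) + (\<Sum>i<k. T d q (nn # (map L vs)[i := DL (vs ! i) x]))"
    unfolding cinv_u0 sum.lessThan_Suc_shift
    by (intro arg_cong2[where f="(+)"] sum.cong refl) (simp_all add: vs)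
  finally have "deriv_along c (\<lambda>q. a * pullback_contr N \<iota> n T c q vs) p x =
     a * (nabla N T d q (L x) (nn # map L vs) + T d q (Dn x # map L vs) + (\<Sum>i<k. T d q (nn # (map L vs)[i := DL (vs ! i) x])))"
    unfolding cinv_u0 by (simp only: add.assoc)
  moreover have "(\<Sum>i<k. a * pullback_contr N \<iota> n T c p (vs[i := christoffel S c p x (vs ! i)])) =
    a * (\<Sum>i<k. T d q (nn # (map L vs)[i := DL (vs ! i) x])) - a * (\<Sum>i<k. T d q (nn # (map L vs)[i := B x (vs ! i) *\<^sub>R nn]))"
    unfolding sum_distrib_left sum_subtractf[symmetric]
  proof (rule sum.cong[OF refl])
    fix i assume "i \<in> {..<k}"
    then have i: "Suc i < Suc k" by simp
    have len: "length (nn # map L vs) = Suc k" by (simp add: vs)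
    have "pullback_contr N \<iota> n T c p (vs[i := christoffel S c p x (vs ! i)]) =
      T d q ((nn # map L vs)[Suc i := DL (vs ! i) x - B x (vs ! i) *\<^sub>R nn])"
      by (simp add: pullback_contr_def Let_def map_update gauss)
    then show "a * pullback_contr N \<iota> n T c p (vs[i := christoffel S c p x (vs ! i)]) =
      a * T d q (nn # (map L vs)[i := DL (vs ! i) x]) - a * T d q (nn # (map L vs)[i := B x (vs ! i) *\<^sub>R nn])"
      unfolding multilinear_update(3)[OF ml[OF amb.q] len i] by (simp add: right_diff_distrib)
  qed
  ultimately show ?thesis by (simp only: nabla_def vs) (simp add: distrib_left)
qed

text \<open>\<open>K x v\<close> is the covariant derivative of the field with value
  \<open>v\<close> and constant coefficients in a moving adapted frame. Such fields have constant
  inner products, hence the skew symmetry, and give constant values of both forms, hence the two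
  formulas.\<close>

lemma frame_operator:
  obtains K where "\<And>x. linear (K x)" "\<And>x v w. met N d q [K x v, w] = - met N d q [v, K x w]"
    "\<And>x v w z. nabla N (phi N) d q (L x) [v, w, z] = - (phi N d q [K x v, w, z] + phi N d q [v, K x w, z] + phi N d q [v, w, K x z])"
    "\<And>x v w z y. nabla N (star_phi N) d q (L x) [v, w, z, y] = - (star_phi N d q [K x v, w, z, y]
       + star_phi N d q [v, K x w, z, y] + star_phi N d q [v, w, K x z, y] + star_phi N d q [v, w, z, K x y])"
proof -
  let ?J = "snd d \<circ> \<iota> \<circ> cinv c"
  obtain W E where W: "open W" "snd d q \<in> W" "W \<subseteq> cimg d" "\<And>w. w \<in> W \<Longrightarrow> adapted N d (cinv d w) (E w)"
    and E: "\<And>i. (\<lambda>w. E w i) differentiable (at (snd d q))" by (rule amb.moving_frame) blast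
  define U' where "U' = U \<inter> ?J -` W"
  have Ju0: "?J u0 = snd d q" by (simp add: cinv_u0)
  have U': "open U'" "u0 \<in> U'"
    unfolding U'_def using continuous_open_preimage[OF smooth_on_continuous_on[OF smooth_\<iota>] U(1) W(1)] U(2) W(2) Ju0 by auto
  have dJ: "(?J has_derivative L) (at u0)"
    by (rule smooth_map_has_derivative[OF M smooth_N \<iota> c amb.d p amb.q])
  have "\<exists>e'. ((\<lambda>u. E (?J u) i) has_derivative e') (at u0)" for i
  proof -
    from E obtain E' where "((\<lambda>w. E w i) has_derivative E') (at (?J u0))" unfolding Ju0 differentiable_def by blast
    from has_derivative_compose[OF dJ this] show ?thesis by blast
  qed
  then obtain e' where e': "\<And>i. ((\<lambda>u. E (?J u) i) has_derivative e' i) (at u0)" by metis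
  define V where "V a u = (\<Sum>i\<in>UNIV. a $ i *\<^sub>R E (?J u) i)" for a :: "real^7" and u
  define dV where "dV a x = (\<Sum>i\<in>UNIV. a $ i *\<^sub>R e' i x)" for a :: "real^7" and x
  have V: "(V a has_derivative dV a) (at u0)" for a
    unfolding V_def[abs_def] dV_def[abs_def] by (intro has_derivative_sum has_derivative_scaleR_right e')
  have F: "g2_chart N d (\<iota> (cinv c u))" "g2_iso N d (\<iota> (cinv c u)) (\<lambda>a. V a u)" if "u \<in> U'" for u
  proof -
    have u: "u \<in> U" "?J u \<in> W" using that by (auto simp: U'_def)
    show a: "g2_chart N d (\<iota> (cinv c u))" using N amb.d in_U(2)[OF u(1)] by unfold_locales
    show "g2_iso N d (\<iota> (cinv c u)) (\<lambda>a. V a u)"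
      using g2_chart.adapted_g2_iso[OF a, of "E (?J u)"] W(4)[OF u(2)] in_U(4)[OF u(1)] by (simp add: V_def)
  qed
  define co where "co v = (\<chi> i. met N d q [v, E (snd d q) i])" for v
  have V_co: "V (co v) u0 = v" for v
    using orthonormal_expand[of "\<lambda>x y. met N d q [x, y]" "E (snd d q)" v] amb.met_lin(1) W(4)[OF W(2)] cinv_snd[OF smooth_N amb.d amb.q]
    unfolding V_def co_def Ju0 adapted_def orthonormal_def by simp
  define K where "K x v = DD (dV (co v)) v x" for x v
  have "linear (K x)" for x
    by (rule linearI) (simp_all add: K_def DD_def dV_def co_def linear_simps[OF amb.met_lin(1)]
      linear_simps[OF linear_christoffel_N(1)] algebra_simps sum.distrib scaleR_sum_right)
  moreover have "met N d q [K x v, w] = - met N d q [v, K x w]" for x v w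
  proof -
    have "((\<lambda>u. co v \<bullet> co w) has_derivative (\<lambda>x. met N d q [K x v, w] + met N d q [v, K x w])) (at u0)"
      using has_derivative_transform_within_open[OF met_along[OF V[of "co v"] V[of "co w"]] U', where g="\<lambda>_. co v \<bullet> co w"] F(2)
      by (simp add: V_co K_def g2_iso_def)
    from has_derivative_unique[OF this has_derivative_const] have "met N d q [K x v, w] + met N d q [v, K x w] = 0"
      by (simp add: fun_eq_iff)
    then show ?thesis by simp
  qed
  moreover have "nabla N (phi N) d q (L x) [v, w, z] = - (phi N d q [K x v, w, z] + phi N d q [v, K x w, z] + phi N d q [v, w, K x z])" for x v w z
  proof -
    let ?V = "\<lambda>u. [V (co v) u, V (co w) u, V (co z) u]"
    have "((\<lambda>u. phi N d (\<iota> (cinv c u)) (?V u)) has_derivative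
     (\<lambda>x. nabla N (phi N) d q (L x) (?V u0) + (\<Sum>i<3. phi N d q ((?V u0)[i := DD ([dV (co v), dV (co w), dV (co z)] ! i) (?V u0 ! i) x])))) (at u0)"
    proof (rule tensor_along[where k=3 and T="phi N" and V="?V" and V'="\<lambda>i. [dV (co v), dV (co w), dV (co z)] ! i"])
      fix i :: nat assume "i < 3"
      then show "((\<lambda>u. ?V u ! i) has_derivative [dV (co v), dV (co w), dV (co z)] ! i) (at u0)"
        using V by (auto simp: numeral_eq_Suc less_Suc_eq)
    qed (simp_all add: ml_on amb.phi_has_derivative)
    from has_derivative_transform_within_open[OF this U', where g="\<lambda>_. phi0 (co v) (co w) (co z)"] F(2)
    have "((\<lambda>u. phi0 (co v) (co w) (co z)) has_derivative
     (\<lambda>x. nabla N (phi N) d q (L x) [v, w, z] + (phi N d q [K x v, w, z] + phi N d q [v, K x w, z] + phi N d q [v, w, K x z]))) (at u0)"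
      by (simp add: V_co K_def g2_iso_def numeral_eq_Suc add.assoc)
    from fun_cong[OF has_derivative_unique[OF this has_derivative_const], of x] show ?thesis by simp
  qed
  moreover have "nabla N (star_phi N) d q (L x) [v, w, z, y] = - (star_phi N d q [K x v, w, z, y]
       + star_phi N d q [v, K x w, z, y] + star_phi N d q [v, w, K x z, y] + star_phi N d q [v, w, z, K x y])" for x v w z y
  proof -
    let ?V = "\<lambda>u. [V (co v) u, V (co w) u, V (co z) u, V (co y) u]"
    have "((\<lambda>u. star_phi N d (\<iota> (cinv c u)) (?V u)) has_derivative
     (\<lambda>x. nabla N (star_phi N) d q (L x) (?V u0) + (\<Sum>i<4. star_phi N d q ((?V u0)[i := DD ([dV (co v), dV (co w), dV (co z), dV (co y)] ! i) (?V u0 ! i) x])))) (at u0)"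
    proof (rule tensor_along[where k=4 and T="star_phi N" and V="?V" and V'="\<lambda>i. [dV (co v), dV (co w), dV (co z), dV (co y)] ! i"])
      fix i :: nat assume "i < 4"
      then show "((\<lambda>u. ?V u ! i) has_derivative [dV (co v), dV (co w), dV (co z), dV (co y)] ! i) (at u0)"
        using V by (auto simp: numeral_eq_Suc less_Suc_eq)
    qed (simp_all add: ml_on amb.star_has_derivative)
    from has_derivative_transform_within_open[OF this U', where g="\<lambda>_. star0 (co v) (co w) (co z) (co y)"]
      g2_chart.star_phi_g2_iso[OF F]
    have "((\<lambda>u. star0 (co v) (co w) (co z) (co y)) has_derivative
     (\<lambda>x. nabla N (star_phi N) d q (L x) [v, w, z, y] + (star_phi N d q [K x v, w, z, y]
       + star_phi N d q [v, K x w, z, y] + star_phi N d q [v, w, K x z, y] + star_phi N d q [v, w, z, K x y]))) (at u0)"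
      by (simp add: V_co K_def numeral_eq_Suc add.assoc)
    from fun_cong[OF has_derivative_unique[OF this has_derivative_const], of x] show ?thesis by simp
  qed
  ultimately show ?thesis by (rule that)
qed

lemma tensorials: "tensorial N 3 (phi N)" "tensorial N (Suc 2) (phi N)" "tensorial N (Suc 3) (star_phi N)"
  using tensor_field_tensorial[OF amb.tensor_phi] tensorial_star_phi[OF N] by (simp_all add: eval_nat_numeral)

lemma nabla_phi_pullback:
  "nabla S (pullback N \<iota> (phi N)) c p x [y, z, w] = nabla N (phi N) d q (L x) [L y, L z, L w]
    + (phi N d q [B x y *\<^sub>R nn, L z, L w] + phi N d q [L y, B x z *\<^sub>R nn, L w] + phi N d q [L y, L z, B x w *\<^sub>R nn])"
  by (subst nabla_pullback[OF tensorials(1) ml_on(2) amb.phi_has_derivative]) (simp_all add: numeral_eq_Suc add.assoc)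

lemma nabla_phi_contr:
  "nabla S (pullback_contr N \<iota> n (phi N)) c p x [y, z] = nabla N (phi N) d q (L x) [nn, L y, L z]
    + phi N d q [Dn x, L y, L z] + (phi N d q [nn, B x y *\<^sub>R nn, L z] + phi N d q [nn, L y, B x z *\<^sub>R nn])"
proof -
  have "nabla S (\<lambda>c p vs. 1 * pullback_contr N \<iota> n (phi N) c p vs) c p x [y, z] = 1 *
    (nabla N (phi N) d q (L x) (nn # map L [y, z]) + phi N d q (Dn x # map L [y, z])
      + (\<Sum>i<2. phi N d q (nn # (map L [y, z])[i := B x ([y, z] ! i) *\<^sub>R nn])))"
    by (rule nabla_pullback_contr[OF tensorials(2)]) (use ml_on(2) amb.phi_has_derivative in \<open>auto simp: eval_nat_numeral\<close>)
  then show ?thesis by (simp add: numeral_eq_Suc add.assoc)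
qed

lemma nabla_star_contr:
  "nabla S (\<lambda>c p vs. a * pullback_contr N \<iota> n (star_phi N) c p vs) c p x [y, z, w] = a * (nabla N (star_phi N) d q (L x) [nn, L y, L z, L w]
    + star_phi N d q [Dn x, L y, L z, L w]
    + (star_phi N d q [nn, B x y *\<^sub>R nn, L z, L w] + star_phi N d q [nn, L y, B x z *\<^sub>R nn, L w] + star_phi N d q [nn, L y, L z, B x w *\<^sub>R nn]))"
proof -
  have "nabla S (\<lambda>c p vs. a * pullback_contr N \<iota> n (star_phi N) c p vs) c p x [y, z, w] = a *
    (nabla N (star_phi N) d q (L x) (nn # map L [y, z, w]) + star_phi N d q (Dn x # map L [y, z, w])
      + (\<Sum>i<3. star_phi N d q (nn # (map L [y, z, w])[i := B x ([y, z, w] ! i) *\<^sub>R nn])))"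
    by (rule nabla_pullback_contr[OF tensorials(3)]) (use ml_on(3) amb.star_has_derivative in \<open>auto simp: eval_nat_numeral\<close>)
  then show ?thesis by (simp add: numeral_eq_Suc add.assoc)
qed

lemma nabla_omega_eq_contr: "nabla_omega S c p x y z = nabla S (pullback_contr N \<iota> n (phi N)) c p x [z, y]"
proof -
  have "deriv_along c (\<lambda>q. omega S c q [y, z]) p = deriv_along c (\<lambda>q. pullback_contr N \<iota> n (phi N) c q [z, y]) p"
    unfolding deriv_along_def
    by (rule frechet_derivative_cong_open[OF open_cimg[OF M c] snd_in_cimg[OF M c p]]) (simp add: omega_eq cinv_in)
  then show ?thesis
    by (simp add: nabla_omega_def nabla_def omega_eq[OF p])
qed

section \<open>Passage to an adapted frame that starts with the normal\<close>

lemma adapted_frame: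
  obtains F where "g2_iso N d q F" "F e0 = nn"
proof -
  obtain e where "adapted N d q e" by (rule amb.adapted_exists)
  then have F': "g2_iso N d q (\<lambda>x. \<Sum>i\<in>UNIV. x $ i *\<^sub>R e i)" (is "g2_iso _ _ _ ?F") by (rule amb.adapted_g2_iso)
  obtain m where m: "nn = ?F m" by (rule amb.g2_iso_surj[OF F'])
  have "m \<bullet> m = met N d q [?F m, ?F m]" using F' by (simp add: g2_iso_def)
  then have "m \<bullet> m = 1" using normal(1)[OF p amb.d amb.q] m by simp
  from g2_automorphism_exists[OF this] obtain R :: "real^7 \<Rightarrow> real^7" where R: "linear R" "R e0 = m"
    "\<And>x y. R x \<bullet> R y = x \<bullet> y" "\<And>x y z. phi0 (R x) (R y) (R z) = phi0 x y z" by metis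
  have lin: "linear ?F" and met: "\<And>x y. met N d q [?F x, ?F y] = x \<bullet> y"
    and phi: "\<And>x y z. phi N d q [?F x, ?F y, ?F z] = phi0 x y z"
    using F' unfolding g2_iso_def by blast+
  have "g2_iso N d q (\<lambda>x. ?F (R x))"
    unfolding g2_iso_def met phi R(3,4) using linear_compose[OF R(1) lin] by (simp add: o_def)
  moreover have "?F (R e0) = nn" by (simp only: R(2) m)
  ultimately show ?thesis by (rule that)
qed

lemma form_inner_3:
  "form_inner R c' p' 3 a b = (\<Sum>i\<in>UNIV. \<Sum>j\<in>UNIV. \<Sum>k\<in>UNIV. a [onb R c' p' i, onb R c' p' j, onb R c' p' k]
     * b [onb R c' p' i, onb R c' p' j, onb R c' p' k]) / 6"
  by (simp add: form_inner_def numeral_3_eq_3 sum_lists_length_Suc sum_lists_length_0[simplified] fact_Suc)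

lemma trilinear_act3_phi0: "linear f \<Longrightarrow> trilinear (act3 f phi0)"
  unfolding trilinear_def act3_def
  by (intro conjI allI linearI)
    (simp_all add: linear_add linear_scale phi0_add phi0_scale algebra_simps)

lemma trilinear_phi0: "trilinear phi0"
  unfolding trilinear_def using phi0_linear by blast

lemma trilinear_star0: "trilinear (star0 v)"
  unfolding trilinear_def using star0_linear by blast

text \<open>Transports all data at the point to R^7; what remains afterwards is the algebra of
  \<open>hypersurface_point\<close>.\<close>

lemma adapted_coordinates:
  assumes X4: "type_X4 N" and par: "(\<theta> = 0 \<and> \<epsilon> = Plus) \<or> (\<theta> = pi / 2 \<and> \<epsilon> = Minus)"
  obtains T A P where "hypersurface_point S c p \<epsilon> T A P" "\<And>x y. B x y = A x \<bullet> T y"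
    "\<And>x. pullback N \<iota> (pdstar_phi N) c p [x] = P \<bullet> T x" "pullback_contr N \<iota> n (pdstar_phi N) c p [] = P $ 0"
    "p_phi N d q - met N d q [p_phi N d q, nn] *\<^sub>R nn = 0 \<longleftrightarrow> (\<forall>x. P \<bullet> T x = 0)"
    "\<And>x. 36 * eta S c p x = P \<bullet> T x"
proof -
  obtain F where F: "g2_iso N d q F" and Fe0: "F e0 = nn" by (rule adapted_frame)
  have linF: "linear F" and metF: "\<And>x y. met N d q [F x, F y] = x \<bullet> y"
    and phiF: "\<And>x y z. phi N d q [F x, F y, F z] = phi0 x y z"
    using F unfolding g2_iso_def by blast+
  note starF = amb.star_phi_g2_iso[OF F]
  define G where "G v = (\<chi> i. met N d q [v, F (axis i 1)])" for v
  have GF: "G (F x) = x" for x by (simp add: G_def metF vec_eq_iff inner_axis)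
  have FG: "F (G v) = v" for v using amb.g2_iso_surj[OF F, of v] GF by metis
  have linG: "linear G"
    by (rule linearI) (simp_all add: G_def vec_eq_iff linear_simps[OF amb.met_lin(1)])
  have metG: "met N d q [v, w] = G v \<bullet> G w" for v w using metF[of "G v" "G w"] by (simp add: FG)
  have phiG: "phi N d q [u, v, w] = phi0 (G u) (G v) (G w)" for u v w using phiF[of "G u" "G v" "G w"] by (simp add: FG)
  have starG: "star_phi N d q [u, v, w, z] = star0 (G u) (G v) (G w) (G z)" for u v w z
    using starF[of "G u" "G v" "G w" "G z"] by (simp add: FG)
  have Gn: "G nn = e0" using GF[of e0] by (simp add: Fe0)
  define T where "T x = G (L x)" for x
  define A where "A x = - G (Dn x)" for x
  define P where "P = G (p_phi N d q)"
  have linT: "linear T" using linear_compose[OF linear_L linG] by (simp add: T_def[abs_def] o_def)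
  have G0: "G v $ 0 = met N d q [v, nn]" for v by (simp add: G_def Fe0)
  have T0: "T x $ 0 = 0" for x
    unfolding T_def G0 using normal(2)[OF p amb.d amb.q, of x] amb.met_sym by simp
  have A0: "A x $ 0 = 0" for x by (simp add: A_def G0 Dn_normal)
  have injT: "inj T"
  proof (rule injI)
    fix x y assume "T x = T y"
    then have "L x = L y" unfolding T_def by (metis FG)
    then show "x = y" by (rule L_inj)
  qed
  have surjT: "\<exists>x. v = T x" if "v $ 0 = 0" for v
  proof -
    have "met N d q [nn, F v] = 0" using that by (simp add: metG Gn GF inner_axis')
    from tangent_image[OF p amb.d amb.q this] obtain x where "L x = F v" by blast
    then show ?thesis by (metis T_def GF)
  qed
  have Tacs: "T (acs S c p x) = cross0 e0 (T x)" for x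
    using tangent_map_acs[OF p, of x] amb.cross_g2_iso[OF F, of e0 "T x"] by (simp add: T_def Fe0 FG GF)
  have AB: "B x y = A x \<bullet> T y" for x y
    using Dn_tangent[of x y] by (simp add: A_def T_def metG)
  have linA: "linear A"
  proof -
    have "linear dn" using n_has_derivative has_derivative_linear by blast
    then have "linear Dn"
      by (intro linearI) (simp_all add: DD_def linear_add linear_scale linear_simps[OF linear_L]
        linear_simps[OF linear_christoffel_N(2)] algebra_simps)
    from linear_compose_neg[OF linear_compose[OF this linG]] show ?thesis by (simp add: A_def[abs_def] o_def)
  qed
  obtain K where K: "\<And>x. linear (K x)" "\<And>x v w. met N d q [K x v, w] = - met N d q [v, K x w]"
    "\<And>x v w z. nabla N (phi N) d q (L x) [v, w, z] = - (phi N d q [K x v, w, z] + phi N d q [v, K x w, z] + phi N d q [v, w, K x z])"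
    "\<And>x v w z y. nabla N (star_phi N) d q (L x) [v, w, z, y] = - (star_phi N d q [K x v, w, z, y]
       + star_phi N d q [v, K x w, z, y] + star_phi N d q [v, w, K x z, y] + star_phi N d q [v, w, z, K x y])"
    by (rule frame_operator) blast
  define k where "k x a = G (K x (F a))" for x a
  have link: "linear (k x)" for x
    using linear_compose[OF linear_compose[OF linF K(1)] linG] by (simp add: k_def[abs_def] o_def)
  have skewk: "k x a \<bullet> b = - (a \<bullet> k x b)" for x a b
    using K(2)[of x "F a" "F b"] by (simp add: k_def metG GF)
  have GK: "G (K x v) = k x (G v)" for x v by (simp add: k_def FG)
  have nphi: "nabla N (phi N) d q (L x) [u, v, w] = - act3 (k x) phi0 (G u) (G v) (G w)" for x u v w
    by (simp add: K(3) phiG GK act3_def)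
  \<comment> \<open>Type X4 in the frame: \<open>rbar\<close> equals (1/4) (1/6) (-1) (-12) times
    this trace, that is half of it, which turns the 1/12 into 1/6.\<close>
  have trace_k: "(\<Sum>i\<in>UNIV. phi0 (k x (axis i 1)) v (axis i 1)) = - phi0 P (T x) v / 6" for x v
  proof -
    let ?o = "\<lambda>i. G (onb N d q i)"
    have "\<exists>e. orthonormal N d q e" using amb.adapted_exists unfolding adapted_def by metis
    then have "orthonormal N d q (onb N d q)" unfolding onb_def by (rule someI_ex)
    then have on: "?o i \<bullet> ?o j = (if i = j then 1 else 0)" for i j by (simp add: orthonormal_def metG)
    have lin: "linear (\<lambda>x. x \<bullet> y)" for y :: "real^7"
      by (rule bounded_linear.linear[OF bounded_linear_inner_left])
    have ax: "axis i (1::real) \<bullet> axis j 1 = (if i = j then 1 else (0::real))" for i j :: 7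
      by (simp add: inner_axis axis_nth_if)
    have "(\<Sum>i\<in>UNIV. \<Sum>j\<in>UNIV. \<Sum>m\<in>UNIV. act3 (k x) phi0 (?o i) (?o j) (?o m) * star0 v (?o i) (?o j) (?o m)) =
      (\<Sum>i\<in>UNIV. \<Sum>j\<in>UNIV. \<Sum>m\<in>UNIV. act3 (k x) phi0 (axis i 1) (axis j 1) (axis m 1) * star0 v (axis i 1) (axis j 1) (axis m 1))"
    proof (rule trilinear_trace[where r=0])
      fix b :: "real^7 \<Rightarrow> real^7 \<Rightarrow> real" assume "bilinear b"
      then show "(\<Sum>i\<in>UNIV. b (?o i) (?o i)) = (\<Sum>a\<in>UNIV. b (axis a 1) (axis a 1)) - 0 * b e0 e0"
        using trace_orthonormal_eq[OF _ lin inner_commute on ax, of b] by simp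
    qed (simp_all add: trilinear_act3_phi0 link trilinear_star0)
    also have "\<dots> = - 12 * (\<Sum>i\<in>UNIV. phi0 (k x (axis i 1)) v (axis i 1))" by (rule contract_act_phi0)
    finally have "rbar N d q (L x) (F v) = (\<Sum>i\<in>UNIV. phi0 (k x (axis i 1)) v (axis i 1)) / 2"
      by (simp add: rbar_def form_inner_3 nphi starG GF sum_negf)
    moreover have "rbar N d q (L x) (F v) = - (1 / 12) * phi N d q [p_phi N d q, L x, F v]"
      using X4 amb.d amb.q unfolding type_X4_def by blast
    ultimately show ?thesis by (simp add: phiG GF P_def T_def)
  qed
  have act_e0: "act3 (k x) phi0 e0 y z = star0 (cross0 P (T x)) e0 y z / 12" for x y z
  proof -
    \<comment> \<open>The hypothesis of \<open>skew_act_phi0_e0\<close> asks for twice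
      \<open>w\<close>, so \<open>w\<close> has 1/12 where \<open>trace_k\<close> has 1/6.\<close>
    have "act3 (k x) phi0 e0 y z = - star0 ((- 1 / 12) *\<^sub>R cross0 P (T x)) e0 y z"
      unfolding act3_def
      by (rule skew_act_phi0_e0[OF link skewk]) (simp add: trace_k cross0_inner)
    then show ?thesis by (simp only: linear_scale[OF star0_linear(1)]) simp
  qed
  have phi_e0: "phi0 e0 (b *\<^sub>R e0) y = 0" "phi0 e0 y (b *\<^sub>R e0) = 0" for b y
    by (simp_all add: phi0_expand)
  have nomega: "nabla_omega S c p x y z = phi0 (A x) (T y) (T z) + star0 (cross0 P (T x)) e0 (T y) (T z) / 12" for x y z
  proof -
    have "nabla_omega S c p x y z = - act3 (k x) phi0 e0 (T z) (T y) + phi0 (- A x) (T z) (T y)"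
      unfolding nabla_omega_eq_contr nabla_phi_contr nphi
      by (simp add: phiG Gn linear_scale[OF linG] phi_e0 T_def A_def)
    also have "\<dots> = phi0 (A x) (T y) (T z) + star0 (cross0 P (T x)) e0 (T y) (T z) / 12"
      using phi0_swap'[of "A x" "T z" "T y"] star0_swap(1)[of "cross0 P (T x)" e0 "T z" "T y"] phi0_scale(1)[of "-1" "A x"]
      by (simp add: act_e0)
    finally show ?thesis .
  qed
  have cs: "(cos \<theta> = 1 \<and> sin \<theta> = 0 \<and> \<epsilon> = Plus) \<or> (cos \<theta> = 0 \<and> sin \<theta> = 1 \<and> \<epsilon> = Minus)"
    using par by (elim disjE conjE) (simp_all only: cos_zero sin_zero cos_pi_half sin_pi_half simp_thms)
  have psi: "psi_plus S c p [x, y, z] = phi0 (case \<epsilon> of Plus \<Rightarrow> T x | Minus \<Rightarrow> cross0 e0 (T x)) (T y) (T z)" for x y z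
    using cs by (auto simp: induced_simps(4) pullback_def pullback_contr_def Let_def phiG starG Gn T_def[symmetric] star0_e0 T0)
  have metT: "met S c p [x, y] = T x \<bullet> T y" for x y by (simp add: met_S metG T_def)
  have symA: "A x \<bullet> T y = T x \<bullet> A y" for x y using B_sym[of x y] by (simp add: AB inner_commute)
  have point: "hypersurface_point S c p \<epsilon> T A P"
    by (rule hypersurface_point.intro; fact linT injT T0 surjT metT Tacs psi linA A0 symA nomega)
  then interpret hp: hypersurface_point S c p \<epsilon> T A P .
  have pd: "pdstar_phi N d q [v] = P \<bullet> G v" for v
    using amb.met_p_phi[of v] by (simp add: metG P_def)
  have eta: "36 * eta S c p x = P \<bullet> T x" for x
  proof -
    let ?x = "acs S c p x" and ?o = "\<lambda>i. T (onb S c p i)"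
    have tr: "(\<Sum>i\<in>UNIV. b (?o i) (?o i)) = (\<Sum>a\<in>UNIV. b (axis a 1) (axis a 1)) - 1 * b e0 e0"
      if "bilinear b" for b :: "real^7 \<Rightarrow> real^7 \<Rightarrow> real"
      using hp.trace_onb[OF that] by simp
    \<comment> \<open>Both values of \<theta> lead to twice the trace in \<open>trace_k\<close> with
      \<open>e0\<close> in the middle slot.\<close>
    have main: "form_inner S c p 3 (nabla S (psi_plus S) c p ?x) (psi_minus S c p) = 2 * (- phi0 P (T ?x) e0 / 6)"
      using cs
    proof
      assume th: "cos \<theta> = 1 \<and> sin \<theta> = 0 \<and> \<epsilon> = Plus"
      \<comment> \<open>The multiple of \<open>e0\<close> is the contribution of the second
        fundamental form; it drops out of the contraction, where it meets the second
        \<open>e0\<close>.\<close>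
      define f where "f a = (A ?x \<bullet> a) *\<^sub>R e0 - k ?x a" for a
      have linf: "linear f" by (rule linearI) (simp_all add: f_def linear_simps[OF link] inner_add_right algebra_simps)
      have pp: "psi_plus S = pullback N \<iota> (phi N)" using th by (simp add: induced_simps(4) fun_eq_iff)
      have "nabla S (psi_plus S) c p ?x [y, z, w] = act3 f phi0 (T y) (T z) (T w)" for y z w
        unfolding pp nabla_phi_pullback nphi
        by (simp add: act3_def f_def AB phiG linear_scale[OF linG] Gn T_def[symmetric] linear_diff[OF phi0_linear(1)]
          linear_diff[OF phi0_linear(2)] linear_diff[OF phi0_linear(3)])
      moreover have "psi_minus S c p [y, z, w] = star0 e0 (T y) (T z) (T w)" for y z w
        using th by (simp add: induced_simps(5) pullback_contr_def Let_def starG Gn T_def)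
      ultimately have "form_inner S c p 3 (nabla S (psi_plus S) c p ?x) (psi_minus S c p) =
        (\<Sum>i\<in>UNIV. \<Sum>j\<in>UNIV. \<Sum>m\<in>UNIV. act3 f phi0 (?o i) (?o j) (?o m) * star0 e0 (?o i) (?o j) (?o m)) / 6"
        by (simp add: form_inner_3)
      also have "\<dots> = (\<Sum>i\<in>UNIV. \<Sum>j\<in>UNIV. \<Sum>m\<in>UNIV. act3 f phi0 (axis i 1) (axis j 1) (axis m 1) * star0 e0 (axis i 1) (axis j 1) (axis m 1)) / 6"
        by (subst trilinear_trace[where o'="?o" and r=1 and X="act3 f phi0" and Y="star0 e0"])
          (simp_all add: tr trilinear_act3_phi0 linf trilinear_star0)
      also have "\<dots> = 2 * (\<Sum>i\<in>UNIV. phi0 (k ?x (axis i 1)) e0 (axis i 1))"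
      proof -
        have "phi0 (f (axis i 1)) e0 (axis i 1) = - phi0 (k ?x (axis i 1)) e0 (axis i 1)" for i
          by (simp add: f_def linear_diff[OF phi0_linear(1)]) (simp add: phi0_expand)
        then show ?thesis unfolding contract_act_phi0 by (simp add: sum_negf)
      qed
      finally show ?thesis by (simp add: trace_k)
    next
      assume th: "cos \<theta> = 0 \<and> sin \<theta> = 1 \<and> \<epsilon> = Minus"
      \<comment> \<open>On tangent vectors the projection is the identity. It is inserted so that
        \<open>X\<close> vanishes with \<open>e0\<close> in any slot, as the passage to the full
        trace requires.\<close>
      define \<pi> where "\<pi> a = a - a $ 0 *\<^sub>R e0" for a :: "real^7"
      define X where "X a b c = star0 (A ?x) (\<pi> a) (\<pi> b) (\<pi> c) + (star0 (k ?x e0) a b c + act3 (k ?x) (star0 e0) a b c)" for a b c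
      have lin\<pi>: "linear \<pi>" by (rule linearI) (simp_all add: \<pi>_def algebra_simps)
      have tri: "trilinear X"
        unfolding trilinear_def X_def act3_def
        by (intro conjI allI linearI)
          (simp_all add: linear_simps[OF lin\<pi>] linear_simps[OF link]
            linear_simps[OF star0_linear(2)] linear_simps[OF star0_linear(3)]
            linear_simps[OF star0_linear(4)] algebra_simps)
      have \<pi>e0: "\<pi> e0 = 0" and \<pi>T: "\<pi> (T y) = T y" for y by (simp_all add: \<pi>_def T0)
      have Xe0: "X e0 a b = 0" "X a e0 b = 0" "X a b e0 = 0" for a b
        by (simp_all add: X_def \<pi>e0 act3_def linear_0[OF star0_linear(2)] linear_0[OF star0_linear(3)] linear_0[OF star0_linear(4)])
          (simp_all add: star0_expand algebra_simps)
      have pp: "psi_plus S = (\<lambda>c p vs. (- 1) * pullback_contr N \<iota> n (star_phi N) c p vs)"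
        using th by (simp add: induced_simps(4) fun_eq_iff)
      have star_e0: "star0 e0 (b *\<^sub>R e0) y z = 0" "star0 e0 y (b *\<^sub>R e0) z = 0" "star0 e0 y z (b *\<^sub>R e0) = 0" for b y z
        by (simp_all add: star0_expand)
      have "nabla S (psi_plus S) c p ?x [y, z, w] = X (T y) (T z) (T w)" for y z w
        unfolding pp nabla_star_contr K(4)
        using linear_neg[OF star0_linear(1), of "A ?x" "T y" "T z" "T w"]
        by (simp add: X_def act3_def \<pi>T starG GK linear_scale[OF linG] Gn T_def[symmetric] star_e0 A_def)
      moreover have "psi_minus S c p [y, z, w] = phi0 (T y) (T z) (T w)" for y z w
        using th by (simp add: induced_simps(5) pullback_def Let_def phiG T_def)
      ultimately have "form_inner S c p 3 (nabla S (psi_plus S) c p ?x) (psi_minus S c p) =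
        (\<Sum>i\<in>UNIV. \<Sum>j\<in>UNIV. \<Sum>m\<in>UNIV. X (?o i) (?o j) (?o m) * phi0 (?o i) (?o j) (?o m)) / 6"
        by (simp add: form_inner_3)
      also have "\<dots> = (\<Sum>i\<in>UNIV. \<Sum>j\<in>UNIV. \<Sum>m\<in>UNIV. X (axis i 1) (axis j 1) (axis m 1) * phi0 (axis i 1) (axis j 1) (axis m 1)) / 6"
        by (subst trilinear_trace[where o'="?o" and r=1 and X=X and Y=phi0]) (simp_all add: tr tri trilinear_phi0 Xe0)
      also have "\<dots> = 2 * (\<Sum>i\<in>UNIV. phi0 (k ?x (axis i 1)) e0 (axis i 1))"
        unfolding X_def distrib_right[of "star0 (A ?x) _ _ _"] sum.distrib \<pi>_def contract_star0_tangent[OF A0] contract_act_star0 by simp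
      finally show ?thesis by (simp add: trace_k)
    qed
    \<comment> \<open>Cyclic symmetry turns the triple product into <J P, J T x>, and J preserves
      inner products with tangent vectors.\<close>
    have "phi0 P (T ?x) e0 = cross0 e0 (T x) \<bullet> cross0 e0 P * (-1) * (-1)"
      unfolding Tacs phi0_cycle[of P _ e0, symmetric] phi0_cycle[of _ e0 P, symmetric]
      by (simp add: cross0_inner phi0_expand cross0_nth inner_7 algebra_simps)
    also have "\<dots> = T x \<bullet> P" using cross0_e0_inner[OF T0, of x P] by simp
    finally show ?thesis by (simp add: eta_def main inner_commute)
  qed
  have norm: "p_phi N d q - met N d q [p_phi N d q, nn] *\<^sub>R nn = 0 \<longleftrightarrow> (\<forall>x. P \<bullet> T x = 0)"
  proof
    assume "p_phi N d q - met N d q [p_phi N d q, nn] *\<^sub>R nn = 0"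
    then have "G (p_phi N d q) = G (met N d q [p_phi N d q, nn] *\<^sub>R nn)" by simp
    then have "P = (P $ 0) *\<^sub>R e0" by (simp add: P_def linear_scale[OF linG] Gn G0)
    then have "P \<bullet> T x = P $ 0 * (e0 \<bullet> T x)" for x by (metis inner_scaleR_left)
    then show "\<forall>x. P \<bullet> T x = 0" by (simp add: inner_axis' T0)
  next
    assume P: "\<forall>x. P \<bullet> T x = 0"
    show "p_phi N d q - met N d q [p_phi N d q, nn] *\<^sub>R nn = 0"
    proof (rule normal_decomp)
      have "met N d q [nn, L y] = 0" "met N d q [p_phi N d q, L y] = 0" for y
        using normal(2)[OF p amb.d amb.q] P by (simp_all add: metG[of "p_phi N d q"] P_def T_def)
      then show "met N d q [p_phi N d q - met N d q [p_phi N d q, nn] *\<^sub>R nn, L y] = 0" for y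
        by (simp add: linear_diff[OF amb.met_lin(1)] linear_scale[OF amb.met_lin(1)])
      show "met N d q [p_phi N d q - met N d q [p_phi N d q, nn] *\<^sub>R nn, nn] = 0"
        by (simp add: linear_diff[OF amb.met_lin(1)] linear_scale[OF amb.met_lin(1)] normal(1)[OF p amb.d amb.q])
    qed
  qed
  show thesis
  proof (rule that[OF point AB _ _ norm eta])
    show "pullback N \<iota> (pdstar_phi N) c p [x] = P \<bullet> T x" for x by (simp add: pullback_def Let_def pd T_def)
    show "pullback_contr N \<iota> n (pdstar_phi N) c p [] = P $ 0"
      by (simp add: pullback_contr_def Let_def pd Gn inner_axis)
  qed
qed

end

section \<open>The type conditions at a point and the conclusion\<close>

definition torsion_at :: "'a su3 \<Rightarrow> ('a, 6) chart \<Rightarrow> 'a \<Rightarrow> torsion_class set \<Rightarrow> bool" where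
  "torsion_at S c p U \<longleftrightarrow> (\<exists>C. (\<forall>k\<in>gh_classes. C k \<in> gh_module S c p k) \<and>
     (\<forall>x y z. nabla_omega S c p x y z = (\<Sum>k\<in>gh_classes. C k x y z)) \<and>
     (\<forall>k\<in>gh_classes - U. \<forall>x y z. C k x y z = 0))"

context hypersurface begin

lemma torsion_conditions:
  assumes X4: "type_X4 N" and par: "(\<theta> = 0 \<and> \<epsilon> = Plus) \<or> (\<theta> = pi / 2 \<and> \<epsilon> = Minus)"
  shows "3 * I_form S c p (codiff_omega S c p) x = pullback N \<iota> (pdstar_phi N) c p [x]"
      "pullback N \<iota> (pdstar_phi N) c p [x] = 36 * eta S c p x"
    and "torsion_at S c p {W1 \<epsilon>, W2 \<epsilon>, W3, W4, W5}"
    and "torsion_at S c p {W1 \<epsilon>, W2 \<epsilon>, W3} \<and> (\<forall>x. eta S c p x = 0)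
      \<longleftrightarrow> p_phi N d q - met N d q [p_phi N d q, nn] *\<^sub>R nn = 0"
    and "torsion_at S c p {W1 \<epsilon>, W2 \<epsilon>, W4, W5} \<longleftrightarrow> (\<forall>x y. I_bil S c p B x y = B x y)"
    and "torsion_at S c p {W1 \<epsilon>, W3, W4, W5} \<longleftrightarrow>
      (\<forall>x y. B x y + I_bil S c p B x y = 2 * mean_curv N S \<iota> n c p * met S c p [x, y])"
    and "torsion_at S c p {W2 \<epsilon>, W3, W4, W5} \<longleftrightarrow>
      pullback_contr N \<iota> n (pdstar_phi N) c p [] = 12 * mean_curv N S \<iota> n c p"
    and "torsion_at S c p {W1 \<epsilon>, W4, W5} \<longleftrightarrow>
      (\<forall>x y. B x y = mean_curv N S \<iota> n c p * met S c p [x, y])"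
proof -
  obtain T A P where hp: "hypersurface_point S c p \<epsilon> T A P" and B: "\<And>x y. B x y = A x \<bullet> T y"
    and pd: "\<And>x. pullback N \<iota> (pdstar_phi N) c p [x] = P \<bullet> T x" "pullback_contr N \<iota> n (pdstar_phi N) c p [] = P $ 0"
    and norm: "p_phi N d q - met N d q [p_phi N d q, nn] *\<^sub>R nn = 0 \<longleftrightarrow> (\<forall>x. P \<bullet> T x = 0)"
    and eta: "\<And>x. 36 * eta S c p x = P \<bullet> T x"
    by (rule adapted_coordinates[OF X4 par]) blast
  interpret hp: hypersurface_point S c p \<epsilon> T A P by (rule hp)
  have at: "torsion_at S c p U \<longleftrightarrow> (\<exists>C. hp.torsion_comps U C)" for U
    by (simp only: torsion_at_def hp.torsion_comps_def)
  have H: "mean_curv N S \<iota> n c p = hp.H" by (simp add: mean_curv_def hp.H_def B)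
  have IB: "I_bil S c p B x y = A (acs S c p x) \<bullet> T (acs S c p y)" for x y by (simp add: I_bil_def B)
  show "3 * I_form S c p (codiff_omega S c p) x = pullback N \<iota> (pdstar_phi N) c p [x]"
    by (simp only: hp.codiff_omega_eq pd)
  show "pullback N \<iota> (pdstar_phi N) c p [x] = 36 * eta S c p x" by (simp only: eta pd)
  show "torsion_at S c p {W1 \<epsilon>, W2 \<epsilon>, W3, W4, W5}"
    unfolding at by (rule hp.torsion_compsI) simp_all
  have eta0: "eta S c p x = 0 \<longleftrightarrow> P \<bullet> T x = 0" for x using eta[of x] by linarith
  show "torsion_at S c p {W1 \<epsilon>, W2 \<epsilon>, W3} \<and> (\<forall>x. eta S c p x = 0)
      \<longleftrightarrow> p_phi N d q - met N d q [p_phi N d q, nn] *\<^sub>R nn = 0"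
    \<comment> \<open>Both \<eta> and the W4 form are determined by the tangential part of
      \<open>P\<close>: vanishing of \<eta> already forces normality, and normality removes
      W4.\<close>
    unfolding norm at eta0 using hp.torsion_compsI[of "{W1 \<epsilon>, W2 \<epsilon>, W3}"] by blast
  show "torsion_at S c p {W1 \<epsilon>, W2 \<epsilon>, W4, W5} \<longleftrightarrow> (\<forall>x y. I_bil S c p B x y = B x y)"
    unfolding at IB B using hp.torsion_compsI[of "{W1 \<epsilon>, W2 \<epsilon>, W4, W5}"]
      hp.second_ff_I_if_no_W3[of "{W1 \<epsilon>, W2 \<epsilon>, W4, W5}"] by blast
  show "torsion_at S c p {W1 \<epsilon>, W3, W4, W5} \<longleftrightarrow>
      (\<forall>x y. B x y + I_bil S c p B x y = 2 * mean_curv N S \<iota> n c p * met S c p [x, y])"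
    unfolding at IB B H hp.met using hp.torsion_compsI[of "{W1 \<epsilon>, W3, W4, W5}"]
      hp.second_ff_I_if_no_W2[of "{W1 \<epsilon>, W3, W4, W5}"] by blast
  show "torsion_at S c p {W2 \<epsilon>, W3, W4, W5} \<longleftrightarrow>
      pullback_contr N \<iota> n (pdstar_phi N) c p [] = 12 * mean_curv N S \<iota> n c p"
    unfolding at pd H using hp.torsion_compsI[of "{W2 \<epsilon>, W3, W4, W5}"]
      hp.mean_curv_if_no_W1[of "{W2 \<epsilon>, W3, W4, W5}"] by blast
  show "torsion_at S c p {W1 \<epsilon>, W4, W5} \<longleftrightarrow>
      (\<forall>x y. B x y = mean_curv N S \<iota> n c p * met S c p [x, y])"
    unfolding at B H hp.met
  proof
    \<comment> \<open>Absence of W2 and of W3 gives the conditions of the third and the second type;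
      together they say that the shape operator is a multiple of the identity.\<close>
    assume "\<exists>C. hp.torsion_comps {W1 \<epsilon>, W4, W5} C"
    then obtain C where C: "hp.torsion_comps {W1 \<epsilon>, W4, W5} C" ..
    have "A x \<bullet> T y + A (acs S c p x) \<bullet> T (acs S c p y) = 2 * hp.H * (T x \<bullet> T y)" for x y
      by (rule hp.second_ff_I_if_no_W2[OF C]) simp_all
    moreover have "A (acs S c p x) \<bullet> T (acs S c p y) = A x \<bullet> T y" for x y
      by (rule hp.second_ff_I_if_no_W3[OF C]) simp
    ultimately show "\<forall>x y. A x \<bullet> T y = hp.H * (T x \<bullet> T y)" by simp
  next
    assume "\<forall>x y. A x \<bullet> T y = hp.H * (T x \<bullet> T y)"
    then show "\<exists>C. hp.torsion_comps {W1 \<epsilon>, W4, W5} C"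
      by (intro hp.torsion_compsI) (simp_all add: hp.inner_I)
  qed
qed

end

theorem theorem4p12:
  fixes N :: "'a g2" and M :: "('b, 6) manifold" and \<iota> :: "'b \<Rightarrow> 'a"
    and n :: "('a, 7) chart \<Rightarrow> 'b \<Rightarrow> real ^ 7"
    and \<theta> :: real and \<epsilon> :: parity and S :: "'b su3"
  assumes "g2_manifold N" and "type_X4 N"
    and "smooth_manifold M" and "immersion M N \<iota>" and "unit_normal N M \<iota> n"
    and "(\<theta> = 0 \<and> \<epsilon> = Plus) \<or> (\<theta> = pi / 2 \<and> \<epsilon> = Minus)"
    and "S = induced_su3 N M \<iota> n \<theta>"
  shows
    "(\<forall>c\<in>charts M. \<forall>p\<in>fst c. \<forall>x.
        3 * I_form S c p (codiff_omega S c p) x = pullback N \<iota> (pdstar_phi N) c p [x] \<and>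
        pullback N \<iota> (pdstar_phi N) c p [x] = 36 * eta S c p x) \<and>
     torsion_type S {W1 \<epsilon>, W2 \<epsilon>, W3, W4, W5} \<and>
     (torsion_type S {W1 \<epsilon>, W2 \<epsilon>, W3} \<longleftrightarrow> p_phi_normal N M \<iota> n) \<and>
     (torsion_type S {W1 \<epsilon>, W2 \<epsilon>, W4, W5} \<longleftrightarrow>
        (\<forall>c\<in>charts M. \<forall>p\<in>fst c. \<forall>x y.
           I_bil S c p (second_ff N \<iota> n c p) x y = second_ff N \<iota> n c p x y)) \<and>
     (torsion_type S {W1 \<epsilon>, W3, W4, W5} \<longleftrightarrow>
        (\<forall>c\<in>charts M. \<forall>p\<in>fst c. \<forall>x y.
           second_ff N \<iota> n c p x y + I_bil S c p (second_ff N \<iota> n c p) x y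
             = 2 * mean_curv N S \<iota> n c p * met S c p [x, y])) \<and>
     (torsion_type S {W2 \<epsilon>, W3, W4, W5} \<longleftrightarrow>
        (\<forall>c\<in>charts M. \<forall>p\<in>fst c.
           pullback_contr N \<iota> n (pdstar_phi N) c p [] = 12 * mean_curv N S \<iota> n c p)) \<and>
     (torsion_type S {W1 \<epsilon>, W4, W5} \<longleftrightarrow> totally_umbilic N S \<iota> n)"
proof -
  have hyp: "hypersurface N M \<iota> n \<theta> S c p" if "c \<in> charts M" "p \<in> fst c" for c p
    by (rule hypersurface.intro) (use assms that in simp_all)
  note conds = hypersurface.torsion_conditions[OF hyp assms(2,6)]
  have charts: "charts S = charts M" by (simp add: assms(7) induced_su3_def)
  have type: "torsion_type S U \<longleftrightarrow>
      (\<forall>c\<in>charts M. \<forall>p\<in>fst c. torsion_at S c p U \<and> (W5 \<notin> U \<longrightarrow> (\<forall>x. eta S c p x = 0)))" for U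
    unfolding torsion_type_def torsion_at_def charts ..
  have topspace: "topspace (topo M) = \<Union> (fst ` charts M)"
    using assms(3) by (simp add: smooth_manifold_def)
  have normal: "p_phi_normal N M \<iota> n \<longleftrightarrow> (\<forall>c\<in>charts M. \<forall>p\<in>fst c.
      p_phi N (chart_at N (\<iota> p)) (\<iota> p) - met N (chart_at N (\<iota> p)) (\<iota> p)
        [p_phi N (chart_at N (\<iota> p)) (\<iota> p), n (chart_at N (\<iota> p)) p] *\<^sub>R n (chart_at N (\<iota> p)) p = 0)"
    unfolding p_phi_normal_def topspace Let_def by blast
  show ?thesis
  proof (intro conjI ballI allI)
    show "torsion_type S {W1 \<epsilon>, W2 \<epsilon>, W3} \<longleftrightarrow> p_phi_normal N M \<iota> n"
      unfolding type normal by (intro ball_cong refl) (frule (1) conds(4), simp)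
    show "torsion_type S {W1 \<epsilon>, W4, W5} \<longleftrightarrow> totally_umbilic N S \<iota> n"
      unfolding type totally_umbilic_def charts by (intro ball_cong refl) (simp add: conds(8))
  qed (simp_all add: type conds(1,2,3,5,6,7) cong: ball_cong)
qed

end
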